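(* Assume the standing conditions ($\mathcal L$), ($E\mathcal S$), ($G|\Gamma$), ($\mathcal L_0$) of the context. Let $n$ be the large-sample parameter (e.g. $n=\sigma^{-2}$) and $\mathtt x=2\log n$. Let $\Omega(\mathtt x)$ be a random event with $P(\Omega(\mathtt x))\ge1-e^{-\mathtt x}$ on which $\sigma^{-2}\varepsilon^\top\mathbb H_G^{-1}\varepsilon\le z^2(B_{\mathcal S|G},\mathtt x)$. Let $\mathtt r_G$ be such that $\Upsilon_0\supseteq\{\upsilon:\|\mathcal D_G(\upsilon-\upsilon^*_G)\|\le\mathtt r_G\}$, $3\delta_{3,G}(\mathtt r_G)/\mathtt r_G^2\le\rho\le1/2$ and $(1-\rho)\mathtt r_G\ge z(B_{\mathcal S|G},\mathtt x)$. Suppose that $\mathtt r_0$ satisfies $$\diamondsuit(\mathtt r_0):=4\delta_3^2(\mathtt r_0)+4\delta_4(\mathtt r_0)\le\tfrac12,\quad C_0:=1-3\mathtt r_0^{-2}\delta_3(\mathtt r_0)\ge\tfrac12,\quad C_0\mathtt r_0\ge2\sqrt{\mathtt p_G(\upsilon)}+\sqrt{\mathtt x}\ \ \forall\upsilon\in\Upsilon_0 .$$ Then on $\Omega(\mathtt x)$, with a fixed constant $C$, $$\sup_{B\in\mathcal B_s(\Upsilon^d)}\bigl|P(\upsilon_G-\tilde\upsilon_G\in B\mid Y)-P'(\tilde{\mathcal D}_G^{-1}\gamma\in B)\bigr|\le C\{\diamondsuit(\mathtt r_0)+1/n\},$$ $$\sup_{B\in\mathcal B(\Upsilon^d)}\bigl|P(\upsilon_G-\tilde\upsilon_G\in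 B\mid Y)-P'(\tilde{\mathcal D}_G^{-1}\gamma\in B)\bigr|\le C\{\delta_3(\mathtt r_0)+1/n\}.$$ Let also $\mathcal Q$ be a linear mapping from $\Upsilon^d$ to $\mathbb R^m$. Then on $\Omega(\mathtt x)$ $$P\Bigl(\|\mathcal Q(\upsilon_G-\tilde\upsilon_G)\|>z\bigl(\mathcal Q\,\tilde{\mathcal D}_G^{-2}\mathcal Q^\top,\mathtt x\bigr)\,\Big|\,Y\Bigr)\le C\{\diamondsuit(\mathtt r_0)+1/n\}.$$ Here $\mathcal B(\Upsilon^d)$ and $\mathcal B_s(\Upsilon^d)$ are the classes of all Borel sets and of all centrally symmetric Borel sets in $\Upsilon^d$, and under $P'$ the vector $\gamma$ is standard normal in $\Upsilon^d$ given $\tilde{\mathcal D}_G$.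
   Context: Model. $\mathcal X^d,\mathcal Y^d$ are finite-dimensional Euclidean spaces, $q=\dim\mathcal Y^d$, $\Upsilon^d=\mathcal X^d\times\mathcal Y^d$, with points $\upsilon=(f,g)$; $A:\mathcal X^d\to\mathcal Y^d$ is a known smooth, possibly nonlinear operator; $\sigma,\lambda>0$. One observes a random $Y\in\mathcal Y^d$ with $EY=g^*:=A(f^* )$ for an unknown $f^*$; $\varepsilon:=\sigma^{-1}(Y-EY)$. Given $f_0\in\mathcal X^d$, $g_0\in\mathcal Y^d$ and prior precision operators $G^2$ on $\mathcal X^d$, $\Gamma^2$ on $\mathcal Y^d$ (symmetric, positive), put $$\mathcal L(\upsilon)=-\tfrac1{2\sigma^2}\|Y-g\|^2-\tfrac\lambda2\|g-A(f)\|^2,\quad \mathcal L_G(\upsilon)=\mathcal L(\upsilon)-\tfrac12\|G(f-f_0)\|^2-\tfrac12\|\Gamma(g-g_0)\|^2 .$$ $\Upsilon^\circ\subseteq\Upsilon^d$ is a parameter set to which the prior is restricted and $\Upsilon_0\subseteq\Upsilon^\circ$ an open local set. $\tilde\upsilon_G=(\tilde f_G,\tilde g_G)=\arg\max_{\Upsilon^\circ}\mathcal L_G$, $\upsilon^*_G=(f^*_G,g^*_G)=\arg\max_{\Upsilon^\circ}E\mathcal L_G$. Matrices. $\mathcal F_G(\upsilon)=-\nabla^2E\mathcal L_G(\upsilon)$, $\mathcal F(\upsilon)=-\nabla^2E\mathcal L(\upsilon)$, $\mathcal D(\upsilon)=\mathcal F(\upsilon)^{1/2}$, $\mathcal D_G=\mathcal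 F_G(\upsilon^*_G)^{1/2}$, $\tilde{\mathcal D}_G=\mathcal F_G(\tilde\upsilon_G)^{1/2}$; $F_G(\upsilon),F(\upsilon)$ are the $ff$-blocks of $\mathcal F_G(\upsilon),\mathcal F(\upsilon)$; $\mathbb H_G^{-1}$ is the $gg$-block of $\mathcal F_G^{-1}(\upsilon_G^* )$. Standing conditions. ($\mathcal L$): $\Upsilon^\circ$ is open and convex and $E\mathcal L_G$ is concave on it. ($E\mathcal S$): there are a positive symmetric $q\times q$ matrix $\mathcal S$ and constants $\mathtt g>0$, $\nu_0\ge1$ with $\mathrm{Var}(\varepsilon)\le\mathcal S^2$ and $\sup_{u\in\mathcal Y^d}\log E\exp\{t\langle u,\varepsilon\rangle/\|\mathcal Su\|\}\le\nu_0^2t^2/2$ for $|t|\le\mathtt g$ (with $\mathtt g=\infty$ where $z$ below is used). ($G|\Gamma$): $g_0=A(f_0)$ and for a constant $C_{G|\Gamma}$, $\|\Gamma\{A(f^* )-g_0\}\|^2\le C_{G|\Gamma}\|G(f^*-f_0)\|^2$ and $\mathrm{tr}(\sigma^2\Gamma^2+I_q)^{-1}\le C_{G|\Gamma}\,\mathrm{tr}\{F_G^{-1}(\upsilon_G^* )F(\upsilon_G^* )\}$. ($\mathcal L_0$): for the local set $\Upsilon_0$ and a set $\mathcal U^\circ\subseteq\Upsilon^d$, the directional derivatives $\partial_\alpha^mA(f)=\frac{d^m}{dt^m}A(f+t\alpha)|_{t=0}$, $m=3,4$, exist and are bounded uniformly over $(f,g)\in\Upsilon_0$, $(\alpha,\beta)\in\mathcal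 U^\circ$. Quantities. $z(B,\mathtt x)=\sqrt{\mathrm{tr}B}+\sqrt{2\lambda_{\max}(B)\mathtt x}$; $B_{\mathcal S|G}=\sigma^{-2}\mathcal S\,\mathbb H_G^{-1}\mathcal S$. With $\partial_u^m\Phi(\upsilon)=\frac{d^m}{dt^m}\Phi(\upsilon+tu)|_{t=0}$ and $\Phi(\upsilon)=\frac\lambda2\|g-A(f)\|^2$, $$\delta_m(\mathtt r)=\sup_{\upsilon\in\Upsilon_0}\ \sup_{u:\|\mathcal D(\upsilon)u\|\le\mathtt r}|\partial_u^m\Phi(\upsilon)|\ (m=3,4),\qquad \delta_{3,G}(\mathtt r)=\sup_{\upsilon:\|\mathcal D_G(\upsilon-\upsilon^*_G)\|\le\mathtt r}\ \sup_{u:\|\mathcal D_Gu\|\le\mathtt r}|\partial_u^3\Phi(\upsilon)| .$$ Effective dimension: $\mathtt p_G(\upsilon)=\mathrm{tr}\{\mathcal F(\upsilon)\mathcal F_G^{-1}(\upsilon)\}$. Posterior. Given $Y$, $\upsilon_G$ has density proportional to $\exp\mathcal L_G(\upsilon)$ on $\Upsilon^\circ$.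
   Formalization: Added: for every υ with ‖D_G(υ−υ*_G)‖ ≤ r_G, the set {υ' : ‖D(υ)(υ'−υ)‖ ≤ r_0} lies in Υ_0. Without it the claim fails, e.g. for A = id with Υ° = Υ_0 a tiny ball, where δ_3 = δ_4 = 0 but the restricted posterior is far from Gaussian. *)

theory Defs
  imports "HOL-Probability.Probability"
begin

section \<open>Operators on Euclidean spaces\<close>

definition self_adjoint :: "('a::euclidean_space \<Rightarrow> 'a) \<Rightarrow> bool" where
  "self_adjoint T \<longleftrightarrow> linear T \<and> (\<forall>u v. T u \<bullet> v = u \<bullet> T v)"

definition psd :: "('a::euclidean_space \<Rightarrow> 'a) \<Rightarrow> bool" where
  "psd T \<longleftrightarrow> self_adjoint T \<and> (\<forall>u. 0 \<le> T u \<bullet> u)"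

definition pos_def :: "('a::euclidean_space \<Rightarrow> 'a) \<Rightarrow> bool" where
  "pos_def T \<longleftrightarrow> self_adjoint T \<and> (\<forall>u. u \<noteq> 0 \<longrightarrow> 0 < T u \<bullet> u)"

definition loewner_le :: "('a::euclidean_space \<Rightarrow> 'a) \<Rightarrow> ('a \<Rightarrow> 'a) \<Rightarrow> bool" where
  "loewner_le T R \<longleftrightarrow> (\<forall>u. T u \<bullet> u \<le> R u \<bullet> u)"

definition psd_sqrt :: "('a::euclidean_space \<Rightarrow> 'a) \<Rightarrow> 'a \<Rightarrow> 'a" where
  "psd_sqrt T = (THE R. psd R \<and> R \<circ> R = T)"

definition op_trace :: "('a::euclidean_space \<Rightarrow> 'a) \<Rightarrow> real" where
  "op_trace T = (\<Sum>b\<in>Basis. T b \<bullet> b)"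

definition lambda_max :: "('a::euclidean_space \<Rightarrow> 'a) \<Rightarrow> real" where
  "lambda_max T = Max {\<mu>. \<exists>v. v \<noteq> 0 \<and> T v = \<mu> *\<^sub>R v}"

definition z_quant :: "('a::euclidean_space \<Rightarrow> 'a) \<Rightarrow> real \<Rightarrow> real" where
  "z_quant B x = sqrt (op_trace B) + sqrt (2 * lambda_max B * x)"

section \<open>Derivatives\<close>

text \<open>In finite dimension, \<open>C\<^sup>k\<close> amounts to existence and continuity of all iterated
  directional derivatives up to order \<open>k\<close>, which is what the recursion expresses.\<close>

primrec C_k :: "nat \<Rightarrow> ('a::euclidean_space \<Rightarrow> 'b::euclidean_space) \<Rightarrow> bool" where
  "C_k 0 f \<longleftrightarrow> continuous_on UNIV f"
| "C_k (Suc k) f \<longleftrightarrow> (\<forall>x. f differentiable (at x)) \<and>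
     (\<forall>v. C_k k (\<lambda>x. frechet_derivative f (at x) v))"

definition smooth :: "('a::euclidean_space \<Rightarrow> 'b::euclidean_space) \<Rightarrow> bool" where
  "smooth f \<longleftrightarrow> (\<forall>k. C_k k f)"

definition gradient :: "('a::euclidean_space \<Rightarrow> real) \<Rightarrow> 'a \<Rightarrow> 'a" where
  "gradient f x = (THE D. GDERIV f x :> D)"

definition hessian :: "('a::euclidean_space \<Rightarrow> real) \<Rightarrow> 'a \<Rightarrow> 'a \<Rightarrow> 'a" where
  "hessian f x = frechet_derivative (gradient f) (at x)"

text \<open>The \<open>k\<close>-th derivative of a curve; \<open>dir_deriv k f x u\<close> is its value at \<open>t = 0\<close>
  for \<open>t \<mapsto> f (x + t u)\<close>.\<close>

definition curve_deriv :: "nat \<Rightarrow> (real \<Rightarrow> 'b::real_normed_vector) \<Rightarrow> real \<Rightarrow> 'b" where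
  "curve_deriv k = (\<lambda>c t. vector_derivative c (at t)) ^^ k"

definition dir_deriv ::
  "nat \<Rightarrow> ('a::euclidean_space \<Rightarrow> 'b::euclidean_space) \<Rightarrow> 'a \<Rightarrow> 'a \<Rightarrow> 'b" where
  "dir_deriv k f x u = curve_deriv k (\<lambda>t. f (x + t *\<^sub>R u)) 0"

definition has_dir_deriv ::
  "nat \<Rightarrow> ('a::euclidean_space \<Rightarrow> 'b::euclidean_space) \<Rightarrow> 'a \<Rightarrow> 'a \<Rightarrow> bool" where
  "has_dir_deriv k f x u \<longleftrightarrow> (\<forall>j<k. \<forall>\<^sub>F t in nhds 0.
     curve_deriv j (\<lambda>t. f (x + t *\<^sub>R u)) differentiable (at t))"

section \<open>The model\<close>

text \<open>\<open>Gop\<close> and \<open>Gam\<close> are the operators \<open>G\<close> and \<open>\<Gamma>\<close>, i.e. the positive square roots of the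
  prior precision operators.\<close>

record ('w, 'x, 'y) calming_model =
  Pr    :: "'w measure"
  Obs   :: "'w \<Rightarrow> 'y"
  Aop   :: "'x \<Rightarrow> 'y"
  sig   :: real
  lam   :: real
  fstar :: 'x
  f0    :: 'x
  g0    :: 'y
  Gop   :: "'x \<Rightarrow> 'x"
  Gam   :: "'y \<Rightarrow> 'y"
  Ups   :: "('x \<times> 'y) set"

definition is_model :: "('w, 'x::euclidean_space, 'y::euclidean_space) calming_model \<Rightarrow> bool" where
  "is_model P \<longleftrightarrow>
     prob_space (Pr P) \<and>
     Obs P \<in> borel_measurable (Pr P) \<and> integrable (Pr P) (Obs P) \<and>
     (\<integral>\<omega>. Obs P \<omega> \<partial>Pr P) = Aop P (fstar P) \<and>
     smooth (Aop P) \<and> 0 < sig P \<and> 0 < lam P \<and> pos_def (Gop P) \<and> pos_def (Gam P)"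

definition noise ::
  "('w, 'x::euclidean_space, 'y::euclidean_space) calming_model \<Rightarrow> 'w \<Rightarrow> 'y" where
  "noise P \<omega> = (1 / sig P) *\<^sub>R (Obs P \<omega> - (\<integral>\<omega>'. Obs P \<omega>' \<partial>Pr P))"

definition structure_term ::
  "('w, 'x::euclidean_space, 'y::euclidean_space) calming_model \<Rightarrow> 'x \<times> 'y \<Rightarrow> real" where
  "structure_term P \<upsilon> = lam P / 2 * (norm (snd \<upsilon> - Aop P (fst \<upsilon>)))\<^sup>2"

definition loglik ::
  "('w, 'x::euclidean_space, 'y::euclidean_space) calming_model \<Rightarrow> 'y \<Rightarrow> 'x \<times> 'y \<Rightarrow> real" where
  "loglik P y \<upsilon> = - (1 / (2 * (sig P)\<^sup>2)) * (norm (y - snd \<upsilon>))\<^sup>2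
                  - lam P / 2 * (norm (snd \<upsilon> - Aop P (fst \<upsilon>)))\<^sup>2"

definition loglik_G ::
  "('w, 'x::euclidean_space, 'y::euclidean_space) calming_model \<Rightarrow> 'y \<Rightarrow> 'x \<times> 'y \<Rightarrow> real" where
  "loglik_G P y \<upsilon> = loglik P y \<upsilon> - 1 / 2 * (norm (Gop P (fst \<upsilon> - f0 P)))\<^sup>2
                                    - 1 / 2 * (norm (Gam P (snd \<upsilon> - g0 P)))\<^sup>2"

definition E_loglik ::
  "('w, 'x::euclidean_space, 'y::euclidean_space) calming_model \<Rightarrow> 'x \<times> 'y \<Rightarrow> real" where
  "E_loglik P \<upsilon> = (\<integral>\<omega>. loglik P (Obs P \<omega>) \<upsilon> \<partial>Pr P)"

definition E_loglik_G ::
  "('w, 'x::euclidean_space, 'y::euclidean_space) calming_model \<Rightarrow> 'x \<times> 'y \<Rightarrow> real" where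
  "E_loglik_G P \<upsilon> = (\<integral>\<omega>. loglik_G P (Obs P \<omega>) \<upsilon> \<partial>Pr P)"

definition is_MAP ::
  "('w, 'x::euclidean_space, 'y::euclidean_space) calming_model \<Rightarrow> 'w \<Rightarrow> 'x \<times> 'y \<Rightarrow> bool" where
  "is_MAP P \<omega> \<upsilon> \<longleftrightarrow> is_arg_max (loglik_G P (Obs P \<omega>)) (\<lambda>\<upsilon>'. \<upsilon>' \<in> Ups P) \<upsilon>"

definition is_target ::
  "('w, 'x::euclidean_space, 'y::euclidean_space) calming_model \<Rightarrow> 'x \<times> 'y \<Rightarrow> bool" where
  "is_target P \<upsilon> \<longleftrightarrow> is_arg_max (E_loglik_G P) (\<lambda>\<upsilon>'. \<upsilon>' \<in> Ups P) \<upsilon>"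

section \<open>Information operators\<close>

definition Fisher ::
  "('w, 'x::euclidean_space, 'y::euclidean_space) calming_model \<Rightarrow> 'x \<times> 'y \<Rightarrow> 'x \<times> 'y \<Rightarrow> 'x \<times> 'y" where
  "Fisher P \<upsilon> = (\<lambda>u. - hessian (E_loglik P) \<upsilon> u)"

definition Fisher_G ::
  "('w, 'x::euclidean_space, 'y::euclidean_space) calming_model \<Rightarrow> 'x \<times> 'y \<Rightarrow> 'x \<times> 'y \<Rightarrow> 'x \<times> 'y" where
  "Fisher_G P \<upsilon> = (\<lambda>u. - hessian (E_loglik_G P) \<upsilon> u)"

definition D_op ::
  "('w, 'x::euclidean_space, 'y::euclidean_space) calming_model \<Rightarrow> 'x \<times> 'y \<Rightarrow> 'x \<times> 'y \<Rightarrow> 'x \<times> 'y" where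
  "D_op P \<upsilon> = psd_sqrt (Fisher P \<upsilon>)"

definition D_G_op ::
  "('w, 'x::euclidean_space, 'y::euclidean_space) calming_model \<Rightarrow> 'x \<times> 'y \<Rightarrow> 'x \<times> 'y \<Rightarrow> 'x \<times> 'y" where
  "D_G_op P \<upsilon> = psd_sqrt (Fisher_G P \<upsilon>)"

definition ff_block :: "('x::euclidean_space \<times> 'y::euclidean_space \<Rightarrow> 'x \<times> 'y) \<Rightarrow> 'x \<Rightarrow> 'x" where
  "ff_block T = (\<lambda>f. fst (T (f, 0)))"

definition gg_block :: "('x::euclidean_space \<times> 'y::euclidean_space \<Rightarrow> 'x \<times> 'y) \<Rightarrow> 'y \<Rightarrow> 'y" where
  "gg_block T = (\<lambda>g. snd (T (0, g)))"

text \<open>\<open>HG_inv P \<upsilon>\<close> is the \<open>gg\<close>-block of the inverse of \<open>Fisher_G P \<upsilon>\<close>, not the inverse of its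
  \<open>gg\<close>-block.\<close>

definition HG_inv ::
  "('w, 'x::euclidean_space, 'y::euclidean_space) calming_model \<Rightarrow> 'x \<times> 'y \<Rightarrow> 'y \<Rightarrow> 'y" where
  "HG_inv P \<upsilon> = gg_block (inv (Fisher_G P \<upsilon>))"

definition B_SG :: "('w, 'x::euclidean_space, 'y::euclidean_space) calming_model \<Rightarrow>
    ('y \<Rightarrow> 'y) \<Rightarrow> 'x \<times> 'y \<Rightarrow> 'y \<Rightarrow> 'y" where
  "B_SG P S \<upsilon> = (\<lambda>g. (1 / (sig P)\<^sup>2) *\<^sub>R S (HG_inv P \<upsilon> (S g)))"

definition eff_dim ::
  "('w, 'x::euclidean_space, 'y::euclidean_space) calming_model \<Rightarrow> 'x \<times> 'y \<Rightarrow> real" where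
  "eff_dim P \<upsilon> = op_trace (Fisher P \<upsilon> \<circ> inv (Fisher_G P \<upsilon>))"

section \<open>Smoothness quantities\<close>

text \<open>The suprema are taken in the extended reals, so that they have the value infinity, instead of
  an unspecified real value, when the derivatives are unbounded.\<close>

definition delta :: "('w, 'x::euclidean_space, 'y::euclidean_space) calming_model \<Rightarrow>
    ('x \<times> 'y) set \<Rightarrow> nat \<Rightarrow> real \<Rightarrow> ereal" where
  "delta P U0 k r = (SUP \<upsilon>\<in>U0. SUP u\<in>{u. norm (D_op P \<upsilon> u) \<le> r}.
     ereal \<bar>dir_deriv k (structure_term P) \<upsilon> u\<bar>)"

definition local_ball_G :: "('w, 'x::euclidean_space, 'y::euclidean_space) calming_model \<Rightarrow>
    'x \<times> 'y \<Rightarrow> real \<Rightarrow> ('x \<times> 'y) set" where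
  "local_ball_G P \<upsilon>s r = {\<upsilon>. norm (D_G_op P \<upsilon>s (\<upsilon> - \<upsilon>s)) \<le> r}"

definition delta3_G :: "('w, 'x::euclidean_space, 'y::euclidean_space) calming_model \<Rightarrow>
    'x \<times> 'y \<Rightarrow> real \<Rightarrow> ereal" where
  "delta3_G P \<upsilon>s r = (SUP \<upsilon>\<in>local_ball_G P \<upsilon>s r. SUP u\<in>{u. norm (D_G_op P \<upsilon>s u) \<le> r}.
     ereal \<bar>dir_deriv 3 (structure_term P) \<upsilon> u\<bar>)"

definition diamond :: "('w, 'x::euclidean_space, 'y::euclidean_space) calming_model \<Rightarrow>
    ('x \<times> 'y) set \<Rightarrow> real \<Rightarrow> ereal" where
  "diamond P U0 r = 4 * (delta P U0 3 r)\<^sup>2 + 4 * delta P U0 4 r"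

definition C0_const :: "('w, 'x::euclidean_space, 'y::euclidean_space) calming_model \<Rightarrow>
    ('x \<times> 'y) set \<Rightarrow> real \<Rightarrow> ereal" where
  "C0_const P U0 r = 1 - ereal (3 / r\<^sup>2) * delta P U0 3 r"

section \<open>Standing conditions\<close>

definition cond_L :: "('w, 'x::euclidean_space, 'y::euclidean_space) calming_model \<Rightarrow> bool" where
  "cond_L P \<longleftrightarrow> open (Ups P) \<and> convex (Ups P) \<and> concave_on (Ups P) (E_loglik_G P)"

definition cov_op :: "'w measure \<Rightarrow> ('w \<Rightarrow> 'y::euclidean_space) \<Rightarrow> 'y \<Rightarrow> 'y" where
  "cov_op M X = (\<lambda>u. \<integral>\<omega>. ((X \<omega> - (\<integral>\<omega>'. X \<omega>' \<partial>M)) \<bullet> u) *\<^sub>R (X \<omega> - (\<integral>\<omega>'. X \<omega>' \<partial>M)) \<partial>M)"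

definition cond_ES :: "('w, 'x::euclidean_space, 'y::euclidean_space) calming_model \<Rightarrow>
    ('y \<Rightarrow> 'y) \<Rightarrow> ereal \<Rightarrow> real \<Rightarrow> bool" where
  "cond_ES P S gg \<nu>0 \<longleftrightarrow> pos_def S \<and> 0 < gg \<and> 1 \<le> \<nu>0 \<and>
     integrable (Pr P) (\<lambda>\<omega>. (norm (noise P \<omega>))\<^sup>2) \<and>
     loewner_le (cov_op (Pr P) (noise P)) (S \<circ> S) \<and>
     (\<forall>t. ereal \<bar>t\<bar> \<le> gg \<longrightarrow> (\<forall>u. u \<noteq> 0 \<longrightarrow>
        integrable (Pr P) (\<lambda>\<omega>. exp (t * (u \<bullet> noise P \<omega>) / norm (S u))) \<and>
        ln (\<integral>\<omega>. exp (t * (u \<bullet> noise P \<omega>) / norm (S u)) \<partial>Pr P) \<le> \<nu>0\<^sup>2 * t\<^sup>2 / 2))"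

definition cond_GGam :: "('w, 'x::euclidean_space, 'y::euclidean_space) calming_model \<Rightarrow>
    'x \<times> 'y \<Rightarrow> real \<Rightarrow> bool" where
  "cond_GGam P \<upsilon>s CG \<longleftrightarrow>
     g0 P = Aop P (f0 P) \<and>
     (norm (Gam P (Aop P (fstar P) - g0 P)))\<^sup>2 \<le> CG * (norm (Gop P (fstar P - f0 P)))\<^sup>2 \<and>
     op_trace (inv (\<lambda>g. (sig P)\<^sup>2 *\<^sub>R Gam P (Gam P g) + g))
       \<le> CG * op_trace (inv (ff_block (Fisher_G P \<upsilon>s)) \<circ> ff_block (Fisher P \<upsilon>s))"

definition cond_L0 :: "('w, 'x::euclidean_space, 'y::euclidean_space) calming_model \<Rightarrow>
    ('x \<times> 'y) set \<Rightarrow> ('x \<times> 'y) set \<Rightarrow> bool" where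
  "cond_L0 P U0 Ucirc \<longleftrightarrow> (\<forall>k\<in>{3, 4}.
     (\<forall>(f, g)\<in>U0. \<forall>(\<alpha>, \<beta>)\<in>Ucirc. has_dir_deriv k (Aop P) f \<alpha>) \<and>
     (\<exists>K. \<forall>(f, g)\<in>U0. \<forall>(\<alpha>, \<beta>)\<in>Ucirc. norm (dir_deriv k (Aop P) f \<alpha>) \<le> K))"

section \<open>Posterior and Gaussian law\<close>

definition posterior :: "('w, 'x::euclidean_space, 'y::euclidean_space) calming_model \<Rightarrow>
    'y \<Rightarrow> ('x \<times> 'y) measure" where
  "posterior P y =
     (let \<mu> = density lborel (\<lambda>\<upsilon>. ennreal (indicator (Ups P) \<upsilon> * exp (loglik_G P y \<upsilon>)))
      in scale_measure (1 / emeasure \<mu> UNIV) \<mu>)"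

definition std_gauss :: "'a::euclidean_space measure" where
  "std_gauss = density lborel (\<lambda>x. ennreal (\<Prod>b\<in>Basis. std_normal_density (x \<bullet> b)))"

definition posterior_gap :: "('w, 'x::euclidean_space, 'y::euclidean_space) calming_model \<Rightarrow>
    'w \<Rightarrow> 'x \<times> 'y \<Rightarrow> ('x \<times> 'y) set \<Rightarrow> real" where
  "posterior_gap P \<omega> \<upsilon>t B =
     \<bar>measure (posterior P (Obs P \<omega>)) {\<upsilon>. \<upsilon> - \<upsilon>t \<in> B}
      - measure std_gauss {\<gamma>. inv (D_G_op P \<upsilon>t) \<gamma> \<in> B}\<bar>"

definition sym_borel :: "'a::euclidean_space set set" where
  "sym_borel = {B \<in> sets borel. uminus ` B = B}"

end

theory Submission
  imports Defs
begin

text \<open>The log-posterior is concave, and only the structure term \<open>\<Phi>\<close> contributes to its derivatives of order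
three and higher, because the data term and the penalties are quadratic and the noise enters
linearly. Hence \<open>\<delta>\<^sub>3\<close> and \<open>\<delta>\<^sub>4\<close> control all Taylor remainders, concavity controls everything far from the
maximum, and three comparisons give the theorem.

\<^item> Location. On \<open>\<Omega>\<close> the slope of the log-posterior at the target in direction \<open>u\<close> is at most \<open>z \<parallel>D\<^sub>G u\<parallel>\<close>.
At distance \<open>r\<^sub>G\<close> the curvature has consumed it, so by concavity the maximum a posteriori point lies
within \<open>r\<^sub>G\<close> of the target (\<open>MAP_in_local_ball\<close>) and all local conditions hold at that point.

\<^item> Inside \<open>\<parallel>D u\<parallel> \<le> r\<^sub>0\<close>. The bound on third derivatives also limits how fast the metric itself varies
(\<open>self_concordance\<close>), so the remainder is at most \<open>\<delta>\<^sub>3/3\<close>, and its even part at most \<open>\<delta>\<^sub>4/12\<close>. The density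
of the posterior relative to the Gaussian law is therefore \<open>1 + O(\<delta>\<^sub>3)\<close>; on a symmetric set the odd
cubic term integrates to zero, which leaves \<open>O(\<delta>\<^sub>3\<^sup>2 + \<delta>\<^sub>4)\<close>.

\<^item> Outside. Diagonalise \<open>F\<^sub>G\<close> and \<open>F\<close> simultaneously into \<open>I\<close> and \<open>\<Lambda> = diag(l)\<close>, whose trace is the effective
dimension \<open>p\<close>. A point \<open>z\<close> outside is joined to \<open>w = (I + c\<Lambda>)\<^bsup>-1\<^esup> z\<close>, with \<open>c\<close> just large enough to bring \<open>w\<close>
into the region where Taylor's formula holds. Concavity on the line through \<open>(I - \<Lambda>) w\<close>, \<open>w\<close> and \<open>z\<close>
bounds the log-posterior at \<open>z\<close> by the Gaussian exponent at \<open>w\<close> minus a multiple of \<open>c r\<^sub>0\<^sup>2\<close>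
(\<open>concave_extrapolation\<close>). The substitution \<open>z \<mapsto> w\<close> costs \<open>det (I + c\<Lambda>) \<le> exp (c p)\<close>, which the gain absorbs
because \<open>4 p \<le> r\<^sub>0\<^sup>2\<close>. Summing over a grid of \<open>c\<close> gives a geometric series times a Gaussian probability
of order \<open>exp (-x/2) = 1/n\<close> (\<open>posterior_outside\<close>). A radial contraction instead of \<open>(I + c\<Lambda>)\<^bsup>-1\<^esup>\<close> would
cost a factor that grows with the full dimension.

Normalising the density turns these errors into the stated ones, and the tail of a linear image of the
posterior follows from the symmetric bound and the Gaussian deviation bound. For \<open>n \<le> 10\<^sup>6\<close> the
right-hand sides are at least one; for larger \<open>n\<close> the radius \<open>r\<^sub>0\<close> is at least four, which leaves room in all
numerical estimates.\<close>

section \<open>Self-adjoint operators and their square roots\<close>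

lemma self_adjointD: "self_adjoint T \<Longrightarrow> T u \<bullet> v = u \<bullet> T v"
  by (simp add: self_adjoint_def)

lemma self_adjoint_linear: "self_adjoint T \<Longrightarrow> linear T"
  by (simp add: self_adjoint_def)

text \<open>A maximiser \<open>v\<close> of the quadratic form over the unit sphere of \<open>S\<close> is an eigenvector: optimality of \<open>v\<close>
against \<open>v + t w\<close> with \<open>w = T v - \<mu> v\<close> reads \<open>2 t |w|\<^sup>2 \<le> O(t\<^sup>2)\<close>, which forces \<open>w = 0\<close>.\<close>

lemma self_adjoint_eigenvector_in_subspace:
  fixes T :: "'a::euclidean_space \<Rightarrow> 'a"
  assumes T: "self_adjoint T" and S: "subspace S" "T ` S \<subseteq> S" "S \<noteq> {0}"
  shows "\<exists>v\<in>S. norm v = 1 \<and> T v = (T v \<bullet> v) *\<^sub>R v"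
proof -
  interpret linear T using T by (rule self_adjoint_linear)
  obtain y where y: "y \<in> S" "y \<noteq> 0"
    using S subspace_0 by blast
  have "(1 / norm y) *\<^sub>R y \<in> S \<inter> sphere 0 1"
    using y S by (simp add: subspace_scale)
  then have "S \<inter> sphere 0 1 \<noteq> {}" by blast
  moreover have "compact (S \<inter> sphere 0 1)"
    by (intro closed_Int_compact closed_subspace S compact_sphere)
  moreover have "continuous_on (S \<inter> sphere 0 1) (\<lambda>v. T v \<bullet> v)"
    using linear_axioms by (intro continuous_on_inner continuous_on_id linear_continuous_on) (simp add: linear_conv_bounded_linear)
  ultimately obtain v where v: "v \<in> S" "norm v = 1"
    and max: "\<And>w. w \<in> S \<Longrightarrow> norm w = 1 \<Longrightarrow> T w \<bullet> w \<le> T v \<bullet> v"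
    by (metis (no_types, lifting) continuous_attains_sup[of "S \<inter> sphere 0 1" "\<lambda>v. T v \<bullet> v"] IntD1 IntD2 IntI mem_sphere_0)
  define \<mu> where "\<mu> = T v \<bullet> v"
  have max': "T w \<bullet> w \<le> \<mu> * (w \<bullet> w)" if "w \<in> S" for w
  proof (cases "w = 0")
    case False
    have "T ((1 / norm w) *\<^sub>R w) \<bullet> ((1 / norm w) *\<^sub>R w) \<le> \<mu>"
      unfolding \<mu>_def using that False S by (intro max) (auto simp: subspace_scale)
    then have "(T w \<bullet> w) / (norm w)\<^sup>2 \<le> \<mu>"
      by (simp add: scale power2_eq_square field_simps)
    then show ?thesis
      using False by (simp add: field_simps power2_norm_eq_inner)
  qed (simp add: zero)
  define w where "w = T v - \<mu> *\<^sub>R v"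
  have wS: "w \<in> S"
    unfolding w_def using v S by (intro subspace_diff subspace_scale) auto
  have vv: "v \<bullet> v = 1" using v by (simp add: norm_eq_1)
  define K where "K = \<mu> * (w \<bullet> w) - T w \<bullet> w"
  have ineq: "2 * t * (w \<bullet> w) \<le> t\<^sup>2 * K" for t
  proof -
    have "T (v + t *\<^sub>R w) \<bullet> (v + t *\<^sub>R w) \<le> \<mu> * ((v + t *\<^sub>R w) \<bullet> (v + t *\<^sub>R w))"
      using v wS S by (intro max') (simp add: subspace_add subspace_scale)
    moreover have "T w \<bullet> v = T v \<bullet> w"
      by (metis T inner_commute self_adjointD)
    then have "T (v + t *\<^sub>R w) \<bullet> (v + t *\<^sub>R w) = \<mu> + 2 * t * (T v \<bullet> w) + t\<^sup>2 * (T w \<bullet> w)"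
      by (simp add: add scale inner_add_left inner_add_right power2_eq_square algebra_simps flip: \<mu>_def)
    moreover have "(v + t *\<^sub>R w) \<bullet> (v + t *\<^sub>R w) = 1 + 2 * t * (v \<bullet> w) + t\<^sup>2 * (w \<bullet> w)"
      by (simp add: inner_add_left inner_add_right vv inner_commute[of w v] power2_eq_square algebra_simps)
    moreover have "T v \<bullet> w = w \<bullet> w + \<mu> * (v \<bullet> w)"
      by (simp add: w_def inner_diff_left inner_diff_right algebra_simps)
    ultimately have "\<mu> + 2 * t * (w \<bullet> w + \<mu> * (v \<bullet> w)) + t\<^sup>2 * (T w \<bullet> w) \<le> \<mu> * (1 + 2 * t * (v \<bullet> w) + t\<^sup>2 * (w \<bullet> w))"
      by metis
    then show ?thesis
      by (simp add: K_def algebra_simps)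
  qed
  have "w \<bullet> w \<le> 0"
  proof (rule ccontr)
    assume "\<not> w \<bullet> w \<le> 0"
    then have p: "w \<bullet> w > 0" by (simp only: not_le)
    have "2 * (w \<bullet> w) \<le> K" using ineq[of 1] by simp
    then have K: "K > 0" using p by linarith
    have "2 * ((w \<bullet> w) / K) * (w \<bullet> w) \<le> ((w \<bullet> w) / K) * (w \<bullet> w)"
      using ineq[of "(w \<bullet> w) / K"] K by (simp add: power2_eq_square)
    moreover have "0 < ((w \<bullet> w) / K) * (w \<bullet> w)" using p K by simp
    ultimately show False by linarith
  qed
  then have "w = 0" by (metis inner_ge_zero inner_eq_zero_iff order_antisym)
  then show ?thesis using v by (auto simp: w_def \<mu>_def intro!: bexI[of _ v])
qed

text \<open>An orthonormal set of eigenvectors of maximal size is a basis: otherwise its orthogonal complement is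
a nonzero invariant subspace and contains a further eigenvector.\<close>

lemma self_adjoint_eigenbasis:
  fixes T :: "'a::euclidean_space \<Rightarrow> 'a"
  assumes T: "self_adjoint T"
  obtains B where "finite B" "card B = DIM('a)" "\<And>v. v \<in> B \<Longrightarrow> norm v = 1"
    "pairwise orthogonal B" "\<And>v. v \<in> B \<Longrightarrow> T v = (T v \<bullet> v) *\<^sub>R v"
proof -
  define good where "good B \<longleftrightarrow> pairwise orthogonal B \<and>
     (\<forall>v\<in>B. norm v = 1 \<and> T v = (T v \<bullet> v) *\<^sub>R v)" for B :: "'a set"
  have fin: "finite B \<and> card B \<le> DIM('a)" if "good B" for B
    using that independent_bound[OF pairwise_orthogonal_independent, of B] by (force simp: good_def)
  obtain B where B: "good B" and max: "\<And>B'. good B' \<Longrightarrow> card B' \<le> card B"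
  proof -
    have "\<exists>B. good B \<and> (\<forall>B'. good B' \<longrightarrow> card B' \<le> card B)"
      using fin by (intro ex_has_greatest_nat[of good "{}" card "Suc DIM('a)"]) (auto simp: good_def pairwise_empty less_Suc_eq_le)
    then show ?thesis using that by blast
  qed
  have "card B = DIM('a)"
  proof (rule ccontr)
    assume "card B \<noteq> DIM('a)"
    then have "dim (span B) < DIM('a)"
      using fin[OF B] dim_le_card'[of B] by (simp add: dim_span)
    then obtain y where y: "y \<noteq> 0" "\<And>z. z \<in> span B \<Longrightarrow> orthogonal y z"
      using orthogonal_to_subspace_exists[of B] by (auto simp: dim_span)
    define S where "S = {z. \<forall>b\<in>B. z \<bullet> b = 0}"
    have "subspace S"
      by (auto simp: S_def subspace_def inner_add_left)
    moreover have "T ` S \<subseteq> S"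
    proof (clarsimp simp: S_def)
      fix z b assume "\<forall>b\<in>B. z \<bullet> b = 0" and b: "b \<in> B"
      then have "z \<bullet> ((T b \<bullet> b) *\<^sub>R b) = 0" by simp
      also have "(T b \<bullet> b) *\<^sub>R b = T b" using B b by (simp add: good_def)
      finally show "T z \<bullet> b = 0" by (simp add: self_adjointD[OF T])
    qed
    moreover have "y \<in> S" using y by (auto simp: S_def orthogonal_def span_base)
    ultimately obtain v where v: "v \<in> S" "norm v = 1" "T v = (T v \<bullet> v) *\<^sub>R v"
      using self_adjoint_eigenvector_in_subspace[OF T, of S] y by auto
    have "v \<notin> B"
      using v by (auto simp: S_def)
    moreover have "good (insert v B)"
      using B v by (auto simp: good_def pairwise_insert S_def orthogonal_def inner_commute)
    ultimately show False using max[of "insert v B"] fin[OF B] by simp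
  qed
  with B fin[OF B] that show ?thesis by (auto simp: good_def)
qed

definition diag :: "('a::euclidean_space \<Rightarrow> real) \<Rightarrow> 'a \<Rightarrow> 'a" where
  "diag l z = (\<Sum>b\<in>Basis. (l b * (z \<bullet> b)) *\<^sub>R b)"

lemma diag_inner_Basis [simp]: "b \<in> Basis \<Longrightarrow> diag l z \<bullet> b = l b * (z \<bullet> b)"
  by (simp add: diag_def inner_sum_left_Basis)

lemma linear_diag: "linear (diag l)"
  by (rule linearI; rule euclidean_eqI) (simp_all add: inner_add_left algebra_simps)

lemma diag_Basis: "b \<in> Basis \<Longrightarrow> diag l b = l b *\<^sub>R b"
  by (rule euclidean_eqI) (simp add: inner_Basis)

lemma inner_diag: "diag l z \<bullet> w = (\<Sum>b\<in>Basis. l b * (z \<bullet> b) * (w \<bullet> b))"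
  by (subst euclidean_inner) (simp add: mult_ac)

lemma diag_quadratic: "diag l z \<bullet> z = (\<Sum>b\<in>Basis. l b * (z \<bullet> b)\<^sup>2)"
  by (simp add: inner_diag power2_eq_square mult_ac)

text \<open>Eigenbasis and eigenvalues are packaged as a rotation \<open>R\<close> of the standard basis and a diagonal operator
there. This form transports traces and Gaussian integrals to sums and products over coordinates.\<close>

lemma spectral_theorem:
  fixes T :: "'a::euclidean_space \<Rightarrow> 'a"
  assumes T: "self_adjoint T"
  shows "\<exists>(R :: 'a \<Rightarrow> 'a) l. orthogonal_transformation R \<and> (\<forall>z. T (R z) = R (diag l z))"
proof -
  obtain B where B: "finite B" "card B = DIM('a)" "\<And>v. v \<in> B \<Longrightarrow> norm v = 1"
    "pairwise orthogonal B" "\<And>v. v \<in> B \<Longrightarrow> T v = (T v \<bullet> v) *\<^sub>R v"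
    using self_adjoint_eigenbasis[OF T] by blast
  then obtain \<pi> where \<pi>: "bij_betw \<pi> (Basis::'a set) B"
    using bij_betw_iff_card[of "Basis::'a set" B] by auto
  define R where "R x = (\<Sum>b\<in>Basis. (x \<bullet> b) *\<^sub>R \<pi> b)" for x :: 'a
  have linR: "linear R"
    unfolding R_def by (intro linear_compose_sum ballI linearI) (auto simp: inner_add_left scaleR_add_left)
  have Rb: "R b = \<pi> b" if "b \<in> Basis" for b
  proof -
    have "R b = (\<Sum>c\<in>Basis. if c = b then \<pi> c else 0)"
      unfolding R_def using that by (intro sum.cong) (auto simp: inner_Basis)
    then show ?thesis using that by simp
  qed
  have ip: "\<pi> b \<bullet> \<pi> c = (if b = c then 1 else 0)" if "b \<in> Basis" "c \<in> Basis" for b c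
  proof (cases "b = c")
    case True then show ?thesis using B(3)[of "\<pi> b"] \<pi> that by (auto simp: bij_betw_def norm_eq_1)
  next
    case False
    then have "\<pi> b \<noteq> \<pi> c" using \<pi> that by (auto simp: bij_betw_def inj_on_def)
    then show ?thesis using False B(4) \<pi> that by (auto simp: bij_betw_def pairwise_def orthogonal_def)
  qed
  have "R v \<bullet> R w = v \<bullet> w" for v w
  proof -
    have "R v \<bullet> R w = (\<Sum>b\<in>Basis. \<Sum>c\<in>Basis. (v \<bullet> b) * (w \<bullet> c) * (\<pi> b \<bullet> \<pi> c))"
      by (simp add: R_def inner_sum_left inner_sum_right sum_distrib_left mult_ac)
         (subst sum.swap, simp)
    also have "\<dots> = (\<Sum>b\<in>Basis. \<Sum>c\<in>Basis. if b = c then (v \<bullet> b) * (w \<bullet> c) else 0)"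
      by (intro sum.cong) (auto simp: ip)
    also have "\<dots> = (\<Sum>b\<in>Basis. (v \<bullet> b) * (w \<bullet> b))" by simp
    also have "\<dots> = v \<bullet> w" by (rule euclidean_inner[symmetric])
    finally show ?thesis .
  qed
  then have "orthogonal_transformation R" using linR by (simp add: orthogonal_transformation_def)
  moreover have "T (R b) = (T (\<pi> b) \<bullet> \<pi> b) *\<^sub>R R b" if "b \<in> Basis" for b
    using B(5)[of "\<pi> b"] \<pi> that by (auto simp: Rb bij_betw_def)
  then have "(T \<circ> R) b = (R \<circ> diag (\<lambda>b. T (\<pi> b) \<bullet> \<pi> b)) b" if "b \<in> Basis" for b
    using that linear_scale[OF linR] by (simp add: diag_Basis)
  then have "T \<circ> R = R \<circ> diag (\<lambda>b. T (\<pi> b) \<bullet> \<pi> b)"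
    using linear_compose[OF linR self_adjoint_linear[OF T]] linear_compose[OF linear_diag linR]
    by (rule linear_eq_stdbasis[rotated 2])
  ultimately show ?thesis by (metis comp_apply)
qed

lemma orthogonal_transformation_surj_ex:
  fixes R :: "'a::euclidean_space \<Rightarrow> 'a"
  shows "orthogonal_transformation R \<Longrightarrow> \<exists>z. x = R z"
  using orthogonal_transformation_surj[of R] by auto

lemma orthogonal_transformation_inner: "orthogonal_transformation R \<Longrightarrow> R u \<bullet> R v = u \<bullet> v"
  by (simp add: orthogonal_transformation_def)

lemma psd_self_adjoint: "psd T \<Longrightarrow> self_adjoint T"
  and psd_nonneg: "psd T \<Longrightarrow> 0 \<le> T u \<bullet> u"
  and psd_linear: "psd T \<Longrightarrow> linear T"
  by (auto simp: psd_def self_adjoint_def)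

lemma pos_def_imp_psd: "pos_def T \<Longrightarrow> psd T"
  unfolding psd_def pos_def_def
  by (metis inner_zero_right order_less_imp_le order_refl)

lemma diagonal_entry:
  assumes "orthogonal_transformation R" "T (R b) = R (diag l b)" "b \<in> Basis"
  shows "l b = T (R b) \<bullet> R b"
  using assms by (simp add: orthogonal_transformation_inner)

text \<open>On an eigenvector \<open>e\<close> of \<open>A\<close> with eigenvalue \<open>l\<close> the assumption gives \<open>(B + l) (B - l) e = 0\<close>. For \<open>l > 0\<close> the
factor \<open>B + l\<close> is injective, and for \<open>l = 0\<close> one has \<open>|B e|\<^sup>2 = B (B e) \<bullet> e = 0\<close>; so \<open>B e = l e\<close>.\<close>

lemma psd_square_inj:
  fixes A B :: "'a::euclidean_space \<Rightarrow> 'a"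
  assumes A: "psd A" and B: "psd B" and eq: "A \<circ> A = B \<circ> B"
  shows "A = B"
proof -
  obtain R :: "'a \<Rightarrow> 'a" and l where R: "orthogonal_transformation R" and AR: "\<And>z. A (R z) = R (diag l z)"
    using spectral_theorem[OF psd_self_adjoint[OF A]] by blast
  have linR: "linear R" and linA: "linear A" and linB: "linear B"
    using R A B by (auto simp: orthogonal_transformation_linear psd_linear)
  have "A (R b) = B (R b)" if b: "b \<in> Basis" for b
  proof -
    define e w where "e = R b" and "w = B e - l b *\<^sub>R e"
    have Ae: "A e = l b *\<^sub>R e"
      using b by (simp add: e_def AR diag_Basis linear_scale[OF linR])
    have l0: "0 \<le> l b"
      using diagonal_entry[of R A, OF R AR b] psd_nonneg[OF A] by simp
    have BB: "B (B e) = (l b * l b) *\<^sub>R e"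
      using fun_cong[OF eq, of e] by (simp add: Ae linear_scale[OF linA])
    have Bw: "B w = - (l b) *\<^sub>R w"
      by (simp add: w_def linear_diff[OF linB] linear_scale[OF linB] BB scaleR_diff_right)
    have "w = 0"
    proof (cases "l b = 0")
      case True
      then have "B e \<bullet> B e = 0"
        using self_adjointD[OF psd_self_adjoint[OF B], of e "B e"] BB by simp
      then show ?thesis using True by (simp add: w_def)
    next
      case False
      have "0 \<le> - (l b * (w \<bullet> w))" using psd_nonneg[OF B, of w] Bw by simp
      then have "w \<bullet> w \<le> 0" using False l0 by (simp add: mult_le_0_iff)
      then show ?thesis by (metis inner_ge_zero inner_eq_zero_iff order_antisym)
    qed
    then show ?thesis using Ae by (simp add: w_def e_def)
  qed
  then have "A \<circ> R = B \<circ> R"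
    by (intro linear_eq_stdbasis[of "A \<circ> R" "B \<circ> R"]) (auto intro: linear_compose linR linA linB)
  then show ?thesis using orthogonal_transformation_surj_ex[OF R]
    by (metis comp_apply ext)
qed

lemma psd_sqrt_exists:
  fixes T :: "'a::euclidean_space \<Rightarrow> 'a"
  assumes T: "psd T"
  shows "\<exists>S. psd S \<and> S \<circ> S = T"
proof -
  obtain R :: "'a \<Rightarrow> 'a" and l where R: "orthogonal_transformation R" and TR: "\<And>z. T (R z) = R (diag l z)"
    using spectral_theorem[OF psd_self_adjoint[OF T]] by blast
  have linR: "linear R" and injR: "inj R"
    using R by (auto simp: orthogonal_transformation_linear orthogonal_transformation_inj)
  have l0: "0 \<le> l b" if "b \<in> Basis" for b
    using diagonal_entry[of R T, OF R TR that] psd_nonneg[OF T] by simp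
  define S where "S x = R (diag (\<lambda>b. sqrt (l b)) (inv R x))" for x
  have SR: "S (R z) = R (diag (\<lambda>b. sqrt (l b)) z)" for z
    by (simp add: S_def inv_f_f[OF injR])
  have "linear (inv R)"
    using R by (simp add: orthogonal_transformation_inv orthogonal_transformation_linear)
  then have "linear S" unfolding S_def
    using linear_compose[OF linear_compose[OF _ linear_diag] linR, of "inv R"] by (simp add: o_def)
  moreover have "S u \<bullet> v = u \<bullet> S v" for u v
  proof -
    obtain u' v' where "u = R u'" "v = R v'" using orthogonal_transformation_surj_ex[OF R] by metis
    then show ?thesis
      by (simp add: SR orthogonal_transformation_inner[OF R] inner_diag inner_commute[of u'] mult_ac)
  qed
  moreover have "0 \<le> S u \<bullet> u" for u
  proof -
    obtain u' where "u = R u'" using orthogonal_transformation_surj_ex[OF R] by metis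
    then show ?thesis
      by (simp add: SR orthogonal_transformation_inner[OF R] diag_quadratic l0 sum_nonneg)
  qed
  moreover have "S \<circ> S = T"
  proof
    fix u
    obtain u' where u: "u = R u'" using orthogonal_transformation_surj_ex[OF R] by metis
    have "diag (\<lambda>b. sqrt (l b)) (diag (\<lambda>b. sqrt (l b)) u') = diag l u'"
      by (rule euclidean_eqI) (simp add: l0 flip: mult.assoc)
    then show "(S \<circ> S) u = T u" by (simp add: u SR TR)
  qed
  ultimately show ?thesis by (auto simp: psd_def self_adjoint_def)
qed

lemma
  fixes T :: "'a::euclidean_space \<Rightarrow> 'a"
  assumes T: "psd T"
  shows psd_psd_sqrt: "psd (psd_sqrt T)"
    and psd_sqrt_twice: "psd_sqrt T (psd_sqrt T u) = T u"
proof -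
  have "\<exists>!S. psd S \<and> S \<circ> S = T"
    using psd_sqrt_exists[OF T] psd_square_inj by metis
  from theI'[OF this] have *: "psd (psd_sqrt T)" "psd_sqrt T \<circ> psd_sqrt T = T"
    by (auto simp: psd_sqrt_def)
  then show "psd (psd_sqrt T)" by simp
  show "psd_sqrt T (psd_sqrt T u) = T u" using fun_cong[OF *(2), of u] by simp
qed

lemma norm_psd_sqrt:
  fixes T :: "'a::euclidean_space \<Rightarrow> 'a"
  assumes "psd T" shows "(norm (psd_sqrt T u))\<^sup>2 = T u \<bullet> u"
  using self_adjointD[OF psd_self_adjoint[OF psd_psd_sqrt[OF assms]], of "psd_sqrt T u" u]
  by (simp add: psd_sqrt_twice[OF assms] power2_norm_eq_inner)

lemma pos_def_bij:
  fixes T :: "'a::euclidean_space \<Rightarrow> 'a"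
  assumes "pos_def T" shows "bij T"
proof -
  have lin: "linear T" using assms by (simp add: pos_def_def self_adjoint_def)
  have "T u = 0 \<Longrightarrow> u = 0" for u
    using assms by (metis inner_zero_left less_irrefl pos_def_def)
  then have "inj T" using lin by (simp add: linear_injective_0)
  then show ?thesis using lin by (simp add: bij_def linear_injective_imp_surjective)
qed

lemma pos_def_psd_sqrt:
  fixes T :: "'a::euclidean_space \<Rightarrow> 'a"
  assumes "pos_def T" shows "pos_def (psd_sqrt T)"
proof -
  note p = pos_def_imp_psd[OF assms]
  have "0 < psd_sqrt T u \<bullet> u" if "u \<noteq> 0" for u
  proof -
    define S where "S = psd_sqrt (psd_sqrt T)"
    have S: "psd_sqrt T u \<bullet> u = (norm (S u))\<^sup>2"
      by (simp add: S_def norm_psd_sqrt[OF psd_psd_sqrt[OF p]])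
    have "S u \<noteq> 0"
    proof
      assume "S u = 0"
      then have "psd_sqrt T u = 0"
        using psd_sqrt_twice[OF psd_psd_sqrt[OF p], of u] linear_0[OF psd_linear[OF psd_psd_sqrt[OF psd_psd_sqrt[OF p]]]]
        by (simp add: S_def)
      then have "T u \<bullet> u = 0" using norm_psd_sqrt[OF p, of u] by simp
      then show False using assms that by (auto simp: pos_def_def)
    qed
    then show ?thesis by (simp add: S)
  qed
  then show ?thesis using psd_self_adjoint[OF psd_psd_sqrt[OF p]] by (simp add: pos_def_def)
qed

lemma self_adjoint_inv:
  fixes T :: "'a::euclidean_space \<Rightarrow> 'a"
  assumes "self_adjoint T" "bij T" shows "self_adjoint (inv T)"
proof -
  have "linear (inv T)"
    using assms by (simp add: bij_def linear_injective_left_inverse inj_linear_imp_inv_linear self_adjoint_linear)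
  moreover have "inv T u \<bullet> v = u \<bullet> inv T v" for u v
    using self_adjointD[OF assms(1), of "inv T u" "inv T v"] assms(2)
    by (simp add: bij_is_surj surj_f_inv_f)
  ultimately show ?thesis by (simp add: self_adjoint_def)
qed

lemma op_trace_commute:
  fixes A B :: "'a::euclidean_space \<Rightarrow> 'a"
  assumes "linear A" "linear B"
  shows "op_trace (A \<circ> B) = op_trace (B \<circ> A)"
proof -
  have tr: "op_trace (A \<circ> B) = (\<Sum>b\<in>Basis. \<Sum>c\<in>Basis. (B b \<bullet> c) * (A c \<bullet> b))"
    if "linear A" for A B :: "'a \<Rightarrow> 'a"
  proof -
    have "A (B b) \<bullet> b = (\<Sum>c\<in>Basis. (B b \<bullet> c) * (A c \<bullet> b))" for b
      by (subst euclidean_representation[of "B b", symmetric], subst linear_sum[OF that])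
         (simp add: linear_scale[OF that] inner_sum_left)
    then show ?thesis by (simp add: op_trace_def)
  qed
  show ?thesis
    unfolding tr[OF assms(1)] tr[OF assms(2)] by (subst sum.swap) (simp add: mult.commute)
qed

lemma op_trace_diagonalized:
  fixes R T :: "'a::euclidean_space \<Rightarrow> 'a"
  assumes R: "orthogonal_transformation R" and TR: "\<And>z. T (R z) = R (diag l z)"
  shows "op_trace T = (\<Sum>b\<in>Basis. l b)"
proof -
  have bijR: "bij R" using R by (rule orthogonal_transformation_bij)
  have "linear (R \<circ> diag l)" "linear (inv R)"
    using R by (auto intro!: linear_compose linear_diag simp: orthogonal_transformation_linear orthogonal_transformation_inv)
  moreover have "T = (R \<circ> diag l) \<circ> inv R"
    using bijR by (auto simp: TR[symmetric] bij_is_surj surj_f_inv_f)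
  moreover have "inv R \<circ> (R \<circ> diag l) = diag l"
    using bijR by (auto simp: bij_is_inj)
  ultimately have "op_trace T = op_trace (diag l)"
    by (metis op_trace_commute)
  then show ?thesis by (simp add: op_trace_def)
qed

text \<open>With \<open>D\<close> the root of \<open>FG\<close> and \<open>R\<close> a rotation that diagonalises \<open>D\<^bsup>-1\<^esup> F D\<^bsup>-1\<^esup>\<close>, the map \<open>L = D\<^bsup>-1\<^esup> R\<close> turns \<open>FG\<close> into
the identity and \<open>F\<close> into a diagonal form. The trace identity is cyclicity.\<close>

lemma simultaneous_diagonalization:
  fixes F FG :: "'a::euclidean_space \<Rightarrow> 'a"
  assumes FG: "pos_def FG" and F: "psd F" and le: "loewner_le F FG"
  obtains L :: "'a \<Rightarrow> 'a" and l where "linear L" "bij L" "orthogonal_transformation (psd_sqrt FG \<circ> L)"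
    "\<And>z. FG (L z) \<bullet> L z = z \<bullet> z" "\<And>z. F (L z) \<bullet> L z = diag l z \<bullet> z"
    "\<And>b. b \<in> Basis \<Longrightarrow> 0 \<le> l b \<and> l b \<le> 1"
    "op_trace (F \<circ> inv FG) = (\<Sum>b\<in>Basis. l b)"
proof -
  define D where "D = psd_sqrt FG"
  define M where "M = inv D \<circ> (F \<circ> inv D)"
  have bD: "bij D" and saD: "self_adjoint D"
    using pos_def_psd_sqrt[OF FG] by (auto simp: D_def pos_def_bij pos_def_def)
  note saDi = self_adjoint_inv[OF saD bD]
  have DD: "D (D u) = FG u" for u
    by (simp add: D_def psd_sqrt_twice pos_def_imp_psd FG)
  have DDi [simp]: "D (inv D u) = u" for u using bD by (simp add: bij_is_surj surj_f_inv_f)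
  have "linear M" unfolding M_def
    by (intro linear_compose self_adjoint_linear[OF saDi] psd_linear[OF F])
  moreover have "M u \<bullet> v = u \<bullet> M v" for u v
    by (simp add: M_def self_adjointD[OF saDi] self_adjointD[OF psd_self_adjoint[OF F]])
  ultimately have saM: "self_adjoint M" by (simp add: self_adjoint_def)
  obtain R :: "'a \<Rightarrow> 'a" and l where R: "orthogonal_transformation R" and MR: "\<And>z. M (R z) = R (diag l z)"
    using spectral_theorem[OF saM] by blast
  define L where "L = inv D \<circ> R"
  have 1: "linear L" unfolding L_def
    by (intro linear_compose self_adjoint_linear[OF saDi] orthogonal_transformation_linear[OF R])
  have 2: "bij L" unfolding L_def
    using bij_comp[OF orthogonal_transformation_bij[OF R] bij_imp_bij_inv[OF bD]] .
  have DL: "D \<circ> L = R" by (auto simp: L_def)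
  have 3: "FG (L z) \<bullet> L z = z \<bullet> z" for z
    using self_adjointD[OF saD, of "D (L z)" "L z"] fun_cong[OF DL, of z]
    by (simp add: DD orthogonal_transformation_inner[OF R])
  have 4: "F (L z) \<bullet> L z = diag l z \<bullet> z" for z
  proof -
    have "diag l z \<bullet> z = M (R z) \<bullet> R z" by (simp add: MR orthogonal_transformation_inner[OF R])
    also have "\<dots> = F (L z) \<bullet> L z" by (simp add: M_def L_def self_adjointD[OF saDi])
    finally show ?thesis by simp
  qed
  have 5: "0 \<le> l b \<and> l b \<le> 1" if "b \<in> Basis" for b
    using 3[of b] 4[of b] that psd_nonneg[OF F, of "L b"] le[unfolded loewner_le_def, rule_format, of "L b"]
    by simp
  have "inv FG = inv D \<circ> inv D"
    using o_inv_distrib[OF bD bD] DD by (metis comp_apply ext)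
  then have "op_trace (F \<circ> inv FG) = op_trace ((F \<circ> inv D) \<circ> inv D)" by (simp add: comp_assoc)
  also have "\<dots> = op_trace M" unfolding M_def
    by (intro op_trace_commute linear_compose self_adjoint_linear[OF saDi] psd_linear[OF F])
  also have "\<dots> = (\<Sum>b\<in>Basis. l b)" by (rule op_trace_diagonalized[OF R MR])
  finally show ?thesis using that[OF 1 2 _ 3 4 5] R DL by (simp add: D_def)
qed

text \<open>The set of eigenvalues is finite and nonempty, so that the maximum in \<open>lambda_max\<close> is meaningful.\<close>

lemma lambda_max_spectrum:
  fixes R T :: "'a::euclidean_space \<Rightarrow> 'a"
  assumes R: "orthogonal_transformation R" and TR: "\<And>z. T (R z) = R (diag l z)"
  shows "lambda_max T = Max (l ` Basis)"
proof -
  have linR: "linear R" and injR: "inj R"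
    using R by (auto simp: orthogonal_transformation_linear orthogonal_transformation_inj)
  have "{\<mu>. \<exists>v. v \<noteq> 0 \<and> T v = \<mu> *\<^sub>R v} = l ` Basis"
  proof (intro equalityI subsetI)
    fix \<mu> assume "\<mu> \<in> {\<mu>. \<exists>v. v \<noteq> 0 \<and> T v = \<mu> *\<^sub>R v}"
    then obtain v where v: "v \<noteq> 0" "T v = \<mu> *\<^sub>R v" by blast
    obtain z where z: "v = R z" using orthogonal_transformation_surj_ex[OF R] by metis
    have "R (diag l z) = R (\<mu> *\<^sub>R z)" using v by (simp add: z TR linear_scale[OF linR])
    then have *: "diag l z = \<mu> *\<^sub>R z" using injR by (simp add: inj_eq)
    have "z \<noteq> 0" using v z linear_0[OF linR] by auto
    then obtain b where b: "b \<in> Basis" "z \<bullet> b \<noteq> 0" using euclidean_all_zero_iff[of z] by blast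
    have "diag l z \<bullet> b = \<mu> * (z \<bullet> b)" using * by simp
    then show "\<mu> \<in> l ` Basis" using b by auto
  next
    fix \<mu> assume "\<mu> \<in> l ` Basis"
    then obtain b where b: "b \<in> Basis" "\<mu> = l b" by blast
    have "R b \<noteq> 0" using injR b linear_0[OF linR] by (metis inj_eq nonzero_Basis)
    then show "\<mu> \<in> {\<mu>. \<exists>v. v \<noteq> 0 \<and> T v = \<mu> *\<^sub>R v}"
      using b by (auto simp: TR diag_Basis linear_scale[OF linR] intro!: exI[of _ "R b"])
  qed
  then show ?thesis by (simp add: lambda_max_def)
qed

lemma quadratic_le_lambda_max:
  fixes T :: "'a::euclidean_space \<Rightarrow> 'a"
  assumes "self_adjoint T"
  shows "T u \<bullet> u \<le> lambda_max T * (u \<bullet> u)"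
proof -
  obtain R :: "'a \<Rightarrow> 'a" and l where R: "orthogonal_transformation R" and TR: "\<And>z. T (R z) = R (diag l z)"
    using spectral_theorem[OF assms] by blast
  obtain z where z: "u = R z" using orthogonal_transformation_surj_ex[OF R] by metis
  have "T u \<bullet> u = (\<Sum>b\<in>Basis. l b * (z \<bullet> b)\<^sup>2)"
    by (simp add: z TR orthogonal_transformation_inner[OF R] diag_quadratic)
  also have "\<dots> \<le> (\<Sum>b\<in>Basis. lambda_max T * (z \<bullet> b)\<^sup>2)"
    unfolding lambda_max_spectrum[OF R TR] by (intro sum_mono mult_right_mono) auto
  also have "\<dots> = lambda_max T * (u \<bullet> u)"
    by (simp add: z orthogonal_transformation_inner[OF R] euclidean_inner[of z z] power2_eq_square sum_distrib_left)
  finally show ?thesis .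
qed

lemma psd_op_trace_nonneg: "psd T \<Longrightarrow> 0 \<le> op_trace T"
  unfolding op_trace_def by (intro sum_nonneg) (simp add: psd_nonneg)

lemma psd_lambda_max_nonneg:
  fixes T :: "'a::euclidean_space \<Rightarrow> 'a"
  assumes "psd T" shows "0 \<le> lambda_max T"
proof -
  obtain b :: 'a where "b \<in> Basis" using nonempty_Basis by blast
  then show ?thesis
    using quadratic_le_lambda_max[OF psd_self_adjoint[OF assms], of b] psd_nonneg[OF assms, of b] by simp
qed

lemma z_quant_nonneg:
  fixes T :: "'a::euclidean_space \<Rightarrow> 'a"
  assumes "psd T" "0 \<le> x" shows "0 \<le> z_quant T x"
  using assms by (simp add: z_quant_def psd_op_trace_nonneg psd_lambda_max_nonneg)

lemma psd_inv:
  fixes T :: "'a::euclidean_space \<Rightarrow> 'a"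
  assumes T: "pos_def T" shows "psd (inv T)"
proof -
  have b: "bij T" by (rule pos_def_bij[OF T])
  have "0 \<le> inv T u \<bullet> u" for u
  proof -
    have "0 \<le> T (inv T u) \<bullet> inv T u" by (rule psd_nonneg[OF pos_def_imp_psd[OF T]])
    then show ?thesis using b by (simp add: bij_is_surj surj_f_inv_f inner_commute)
  qed
  then show ?thesis using self_adjoint_inv[OF _ b] T by (simp add: psd_def pos_def_def)
qed

section \<open>Lebesgue measure and the Gaussian law under linear maps\<close>

lemma nn_integral_lborel_translate:
  fixes a :: "'a::euclidean_space"
  assumes [measurable]: "f \<in> borel_measurable borel"
  shows "(\<integral>\<^sup>+x. f (a + x) \<partial>lborel) = (\<integral>\<^sup>+x. f x \<partial>lborel)"
proof -
  have "(\<integral>\<^sup>+x. f x \<partial>lborel) = (\<integral>\<^sup>+x. f x \<partial>distr lborel borel ((+) a))"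
    by (simp add: lborel_distr_plus)
  then show ?thesis by (simp add: nn_integral_distr)
qed

lemma linear_borel_measurable:
  fixes L :: "'a::euclidean_space \<Rightarrow> 'b::euclidean_space"
  shows "linear L \<Longrightarrow> L \<in> borel_measurable borel"
  by (intro borel_measurable_continuous_onI linear_continuous_on) (simp add: linear_conv_bounded_linear)

text \<open>Both sides equal \<open>\<integral>\<integral> f (L x + y) g y dx dy\<close>: for fixed \<open>y\<close> translate \<open>x\<close> by the preimage of \<open>y\<close>, for fixed \<open>x\<close>
translate \<open>y\<close> by \<open>L x\<close>. Translation invariance alone thus yields the change of variables up to a
constant, without determinants.\<close>

lemma nn_integral_lborel_linear_ratio:
  fixes L :: "'a::euclidean_space \<Rightarrow> 'a"
  assumes L: "linear L" "bij L"
    and [measurable]: "f \<in> borel_measurable borel" "g \<in> borel_measurable borel"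
    and even: "\<And>x. g (- x) = g x"
  shows "(\<integral>\<^sup>+x. f (L x) \<partial>lborel) * (\<integral>\<^sup>+y. g y \<partial>lborel)
       = (\<integral>\<^sup>+y. f y \<partial>lborel) * (\<integral>\<^sup>+x. g (L x) \<partial>lborel)"
proof -
  note [measurable] = linear_borel_measurable[OF L(1)]
  define K where "K = inv L"
  have LK: "L (K y) = y" for y using L(2) by (simp add: K_def bij_is_surj surj_f_inv_f)
  have Ladd: "L (x + y) = L x + L y" and Lminus: "L (- x) = - L x" for x y
    using L(1) by (simp_all add: linear_add linear_neg)
  have shiftL: "(\<integral>\<^sup>+x. h (L x + y) \<partial>lborel) = (\<integral>\<^sup>+x. h (L x) \<partial>lborel)"
    if [measurable]: "h \<in> borel_measurable borel" for h :: "'a \<Rightarrow> ennreal" and y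
  proof -
    have "(\<integral>\<^sup>+x. h (L (K y + x)) \<partial>lborel) = (\<integral>\<^sup>+x. h (L x) \<partial>lborel)"
      by (rule nn_integral_lborel_translate[of "\<lambda>x. h (L x)"]) simp
    then show ?thesis by (simp add: Ladd LK add.commute)
  qed
  have "(\<integral>\<^sup>+x. f (L x) \<partial>lborel) * (\<integral>\<^sup>+y. g y \<partial>lborel)
      = (\<integral>\<^sup>+y. (\<integral>\<^sup>+x. f (L x + y) * g y \<partial>lborel) \<partial>lborel)"
    by (simp add: nn_integral_multc nn_integral_cmult shiftL)
  also have "\<dots> = (\<integral>\<^sup>+x. (\<integral>\<^sup>+y. f (L x + y) * g y \<partial>lborel) \<partial>lborel)"
    by (rule lborel_pair.Fubini') simp
  also have "\<dots> = (\<integral>\<^sup>+x. (\<integral>\<^sup>+y. f y * g (L x - y) \<partial>lborel) \<partial>lborel)"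
  proof (rule nn_integral_cong)
    fix x
    have "(\<integral>\<^sup>+y. f (L x + y) * g (- ((L x + y) - L x)) \<partial>lborel) = (\<integral>\<^sup>+y. f y * g (- (y - L x)) \<partial>lborel)"
      by (rule nn_integral_lborel_translate[of "\<lambda>y. f y * g (- (y - L x))"]) simp
    then show "(\<integral>\<^sup>+y. f (L x + y) * g y \<partial>lborel) = (\<integral>\<^sup>+y. f y * g (L x - y) \<partial>lborel)"
      by (simp add: even)
  qed
  also have "\<dots> = (\<integral>\<^sup>+y. (\<integral>\<^sup>+x. f y * g (L x + (- y)) \<partial>lborel) \<partial>lborel)"
    by (subst lborel_pair.Fubini') simp_all
  also have "\<dots> = (\<integral>\<^sup>+y. f y \<partial>lborel) * (\<integral>\<^sup>+x. g (L x) \<partial>lborel)"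
  proof -
    have "(\<integral>\<^sup>+x. f y * g (L x + (- y)) \<partial>lborel) = f y * (\<integral>\<^sup>+x. g (L x) \<partial>lborel)" for y
      by (subst nn_integral_cmult) (simp_all add: shiftL del: add_uminus_conv_diff)
    then show ?thesis by (simp add: nn_integral_multc)
  qed
  finally show ?thesis .
qed

lemma nn_integral_lborel_diag:
  fixes d :: "'a::euclidean_space \<Rightarrow> real"
  assumes d: "\<And>b. b \<in> Basis \<Longrightarrow> d b > 0" and [measurable]: "h \<in> borel_measurable borel"
  shows "(\<integral>\<^sup>+z. h z \<partial>lborel) = ennreal (\<Prod>b\<in>Basis. d b) * (\<integral>\<^sup>+z. h (diag d z) \<partial>lborel)"
proof -
  note [measurable] = linear_borel_measurable[OF linear_diag[of d]]
  have "(\<integral>\<^sup>+z. h z \<partial>lborel) = (\<integral>\<^sup>+z. h z \<partial>density (distr lborel borel (diag d)) (\<lambda>_. ennreal (\<Prod>j\<in>Basis. \<bar>d j\<bar>)))"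
    using d by (subst lborel_affine_euclidean[of d 0]) (force simp: diag_def[abs_def])+
  also have "\<dots> = ennreal (\<Prod>j\<in>Basis. \<bar>d j\<bar>) * (\<integral>\<^sup>+z. h (diag d z) \<partial>lborel)"
    by (simp add: nn_integral_density nn_integral_distr nn_integral_cmult)
  also have "(\<Prod>j\<in>Basis. \<bar>d j\<bar>) = (\<Prod>b\<in>Basis. d b)"
    using d by (intro prod.cong) (auto simp: less_imp_le)
  finally show ?thesis .
qed

definition gauss_dens :: "'a::euclidean_space \<Rightarrow> real" where
  "gauss_dens x = (\<Prod>b\<in>Basis. std_normal_density (x \<bullet> b))"

lemma std_gauss_eq: "std_gauss = density lborel (\<lambda>x. ennreal (gauss_dens x))"
  by (simp add: std_gauss_def gauss_dens_def)

lemma gauss_dens_eq: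
  "gauss_dens (x::'a::euclidean_space) = (1 / sqrt (2 * pi)) ^ DIM('a) * exp (- (x \<bullet> x) / 2)"
proof -
  have "gauss_dens x = (\<Prod>b\<in>(Basis::'a set). 1 / sqrt (2 * pi)) * (\<Prod>b\<in>Basis. exp (- (x \<bullet> b)\<^sup>2 / 2))"
    unfolding gauss_dens_def std_normal_density_def by (simp add: prod.distrib prod_dividef power_one_over)
  also have "(\<Prod>b\<in>Basis. exp (- (x \<bullet> b)\<^sup>2 / 2)) = exp (- (x \<bullet> x) / 2)"
    by (simp add: exp_sum[symmetric] sum_negf sum_divide_distrib[symmetric] euclidean_inner[of x x] power2_eq_square)
  finally show ?thesis by simp
qed

lemma gauss_dens_minus: "gauss_dens (- x) = gauss_dens x"
  by (simp add: gauss_dens_eq)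

lemma gauss_dens_pos: "gauss_dens x > 0"
  unfolding gauss_dens_eq by (simp add: power_divide)

lemma gauss_dens_measurable [measurable]: "gauss_dens \<in> borel_measurable borel"
  unfolding gauss_dens_def[abs_def] by measurable

lemma space_std_gauss [simp]: "space std_gauss = UNIV"
  and sets_std_gauss [simp, measurable_cong]: "sets std_gauss = sets borel"
  by (simp_all add: std_gauss_def)

lemma nn_integral_std_gauss:
  "f \<in> borel_measurable borel \<Longrightarrow> (\<integral>\<^sup>+x. f x \<partial>std_gauss) = (\<integral>\<^sup>+x. ennreal (gauss_dens x) * f x \<partial>lborel)"
  by (simp add: std_gauss_eq nn_integral_density)

text \<open>The integrand is a multiple of the normal density with variance \<open>1/(1 - a)\<close>.\<close>

lemma nn_integral_exp_square_std_normal: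
  assumes "a < 1"
  shows "(\<integral>\<^sup>+s. ennreal (std_normal_density s * exp (a * s\<^sup>2 / 2)) \<partial>lborel) = ennreal (1 / sqrt (1 - a))"
proof -
  define \<sigma> where "\<sigma> = 1 / sqrt (1 - a)"
  have \<sigma>: "\<sigma> > 0" "\<sigma>\<^sup>2 = 1 / (1 - a)" using assms by (simp_all add: \<sigma>_def power_divide)
  have eq: "std_normal_density s * exp (a * s\<^sup>2 / 2) = \<sigma> * normal_density 0 \<sigma> s" for s
  proof -
    have "exp (- s\<^sup>2 / 2) * exp (a * s\<^sup>2 / 2) = exp (- s\<^sup>2 / (2 * \<sigma>\<^sup>2))"
      using assms by (simp add: \<sigma>(2) exp_add[symmetric] field_simps)
    moreover have "sqrt (2 * pi * \<sigma>\<^sup>2) = sqrt (2 * pi) * \<sigma>"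
      using \<sigma>(1) by (simp add: real_sqrt_mult)
    ultimately show ?thesis using \<sigma>(1)
      by (simp add: normal_density_def std_normal_density_def)
  qed
  interpret prob_space "density lborel (\<lambda>s. ennreal (normal_density 0 \<sigma> s))"
    using \<sigma>(1) by (rule prob_space_normal_density)
  have "(\<integral>\<^sup>+s. ennreal (normal_density 0 \<sigma> s) \<partial>lborel) = 1"
    using emeasure_space_1 by (simp add: emeasure_density)
  moreover have "(\<integral>\<^sup>+s. ennreal (\<sigma> * normal_density 0 \<sigma> s) \<partial>lborel) = ennreal \<sigma> * (\<integral>\<^sup>+s. ennreal (normal_density 0 \<sigma> s) \<partial>lborel)"
    using \<sigma>(1) by (simp add: ennreal_mult nn_integral_cmult)
  ultimately show ?thesis by (simp add: eq \<sigma>_def)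
qed

lemma nn_integral_exp_quadratic_std_gauss:
  fixes a :: "'a::euclidean_space \<Rightarrow> real"
  assumes "\<And>b. b \<in> Basis \<Longrightarrow> a b < 1"
  shows "(\<integral>\<^sup>+z. ennreal (exp (\<Sum>b\<in>Basis. a b * (z \<bullet> b)\<^sup>2 / 2)) \<partial>std_gauss)
       = ennreal (\<Prod>b\<in>Basis. 1 / sqrt (1 - a b))"
proof -
  have "(\<integral>\<^sup>+z. ennreal (exp (\<Sum>b\<in>Basis. a b * (z \<bullet> b)\<^sup>2 / 2)) \<partial>std_gauss)
      = (\<integral>\<^sup>+z. (\<Prod>b\<in>Basis. ennreal (std_normal_density (z \<bullet> b) * exp (a b * (z \<bullet> b)\<^sup>2 / 2))) \<partial>lborel)"
    by (subst nn_integral_std_gauss)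
       (auto simp: gauss_dens_def exp_sum prod_ennreal ennreal_mult[symmetric] prod_nonneg prod.distrib intro!: nn_integral_cong)
  also have "\<dots> = (\<Prod>b\<in>Basis. (\<integral>\<^sup>+s. ennreal (std_normal_density s * exp (a b * s\<^sup>2 / 2)) \<partial>lborel))"
    by (rule nn_integral_lborel_prod) auto
  also have "\<dots> = (\<Prod>b\<in>Basis. ennreal (1 / sqrt (1 - a b)))"
    using assms by (intro prod.cong refl nn_integral_exp_square_std_normal)
  also have "\<dots> = ennreal (\<Prod>b\<in>Basis. 1 / sqrt (1 - a b))"
    using assms by (intro prod_ennreal) (auto simp: less_imp_le)
  finally show ?thesis .
qed

interpretation std_gauss: prob_space "std_gauss :: 'a::euclidean_space measure"
proof
  have "emeasure (std_gauss :: 'a measure) (space std_gauss) = (\<integral>\<^sup>+(z::'a). ennreal (exp (\<Sum>b\<in>Basis. 0 * (z \<bullet> b)\<^sup>2 / 2)) \<partial>std_gauss)"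
    by simp
  also have "\<dots> = 1" by (subst nn_integral_exp_quadratic_std_gauss) simp_all
  finally show "emeasure (std_gauss :: 'a measure) (space std_gauss) = 1" .
qed

lemma nn_integral_gauss_dens: "(\<integral>\<^sup>+(x::'a::euclidean_space). ennreal (gauss_dens x) \<partial>lborel) = 1"
  using std_gauss.emeasure_space_1[where 'a='a] by (simp add: std_gauss_eq emeasure_density)

text \<open>The constant is the integral of the Gaussian density composed with \<open>L\<close>. Its value is immaterial, since it
cancels from normalised densities.\<close>

lemma nn_integral_lborel_linear:
  fixes L :: "'a::euclidean_space \<Rightarrow> 'a"
  assumes L: "linear L" "bij L"
  obtains k where "0 < k" "k < \<infinity>"
    "\<And>f. f \<in> borel_measurable borel \<Longrightarrow> (\<integral>\<^sup>+x. f (L x) \<partial>lborel) = k * (\<integral>\<^sup>+x. f x \<partial>lborel)"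
proof
  note [measurable] = linear_borel_measurable[OF L(1)]
  define k where "k = (\<integral>\<^sup>+x. ennreal (gauss_dens (L x)) \<partial>lborel)"
  show *: "(\<integral>\<^sup>+x. f (L x) \<partial>lborel) = k * (\<integral>\<^sup>+x. f x \<partial>lborel)" if "f \<in> borel_measurable borel" for f :: "'a \<Rightarrow> ennreal"
    using nn_integral_lborel_linear_ratio[OF L that, of "\<lambda>x. ennreal (gauss_dens x)"]
    by (simp add: nn_integral_gauss_dens gauss_dens_minus k_def mult.commute)
  show "0 < k"
  proof (rule ccontr)
    assume "\<not> 0 < k"
    then have "AE x::'a in lborel. ennreal (gauss_dens (L x)) = 0"
      by (simp add: k_def nn_integral_0_iff_AE not_gr_zero)
    moreover have "ennreal (gauss_dens (L x)) \<noteq> 0" for x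
      using gauss_dens_pos[of "L x"] by simp
    ultimately have "AE x::'a in lborel. False" by simp
    then show False by (simp add: eventually_False ae_filter_eq_bot_iff)
  qed
  show "k < \<infinity>"
  proof -
    obtain B where B: "0 < B" "\<And>x. B * norm x \<le> norm (L x)"
      using linear_inj_bounded_below_pos[OF L(1)] L(2) by (metis bij_is_inj)
    have "(\<integral>\<^sup>+x. indicator (cball 0 1) (L x) \<partial>lborel) \<le> (\<integral>\<^sup>+(x::'a). indicator (cball 0 (1 / B)) x \<partial>lborel)"
    proof (rule nn_integral_mono)
      fix x show "(indicator (cball 0 1) (L x) :: ennreal) \<le> indicator (cball 0 (1 / B)) x"
        using B(1) B(2)[of x] by (auto split: split_indicator simp: field_simps)
    qed
    also have "\<dots> < \<infinity>" using emeasure_bounded_finite[OF bounded_cball, of 0 "1 / B"] by simp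
    finally have "k * emeasure lborel (cball 0 1 :: 'a set) < \<infinity>"
      using *[of "indicator (cball 0 1)"] by (simp add: borel_measurable_indicator)
    moreover have "emeasure lborel (cball 0 1 :: 'a set) > 0"
      using content_cball_pos[of 1 "0::'a"] by (auto simp: measure_def zero_less_iff_neq_zero)
    ultimately show ?thesis
      by (metis ennreal_top_mult infinity_ennreal_def less_irrefl not_gr_zero top.not_eq_extremum)
  qed
qed

text \<open>The Gaussian density is itself rotation invariant; integrating it shows that a rotation scales Lebesgue
measure by the factor one.\<close>

lemma nn_integral_std_gauss_orthogonal:
  fixes R :: "'a::euclidean_space \<Rightarrow> 'a"
  assumes R: "orthogonal_transformation R" and [measurable]: "f \<in> borel_measurable borel"
  shows "(\<integral>\<^sup>+x. f (R x) \<partial>std_gauss) = (\<integral>\<^sup>+x. f x \<partial>std_gauss)"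
proof -
  note [measurable] = linear_borel_measurable[OF orthogonal_transformation_linear[OF R]]
  have g: "gauss_dens (R x) = gauss_dens x" for x
    by (simp add: gauss_dens_eq orthogonal_transformation_inner[OF R])
  obtain k where k: "\<And>f. f \<in> borel_measurable borel \<Longrightarrow> (\<integral>\<^sup>+x. f (R x) \<partial>lborel) = k * (\<integral>\<^sup>+x. f x \<partial>lborel)"
    using nn_integral_lborel_linear[OF orthogonal_transformation_linear[OF R] orthogonal_transformation_bij[OF R]] by metis
  have "k = 1"
    using k[of "\<lambda>x. ennreal (gauss_dens x)"] by (simp add: g nn_integral_gauss_dens)
  then show ?thesis
    using k[of "\<lambda>x. ennreal (gauss_dens x) * f x"] by (simp add: g nn_integral_std_gauss)
qed

text \<open>Exponential Markov inequality for the quadratic form. Since \<open>(1 - a)\<^bsup>-1/2\<^esup> \<le> exp (a / (2 (1 - \<tau>)))\<close> for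
\<open>0 \<le> a \<le> \<tau> < 1\<close>, only the trace of the form enters, and \<open>1 - \<tau> = \<surd>t / r\<close> optimises the exponent.\<close>

lemma std_gauss_diag_tail:
  fixes l :: "'a::euclidean_space \<Rightarrow> real"
  assumes l: "\<And>b. b \<in> Basis \<Longrightarrow> 0 \<le> l b \<and> l b \<le> m" and m: "0 < m"
    and t: "(\<Sum>b\<in>Basis. l b) = t" and r: "sqrt t \<le> r"
  shows "emeasure std_gauss {z. diag l z \<bullet> z > r\<^sup>2} \<le> ennreal (exp (- (r - sqrt t)\<^sup>2 / (2 * m)))"
proof -
  have t0: "0 \<le> t" unfolding t[symmetric] using l by (intro sum_nonneg) auto
  consider "r = sqrt t" | "t = 0" "r > 0" | "t > 0" "r > sqrt t"
    using t0 r by fastforce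
  then show ?thesis
  proof cases
    case 1 then show ?thesis by (simp add: std_gauss.emeasure_le_1)
  next
    case 2
    then have "l b = 0" if "b \<in> Basis" for b
      using l t that sum_nonneg_eq_0_iff[of Basis l] by auto
    then have "diag l z \<bullet> z = 0" for z by (simp add: diag_quadratic)
    then show ?thesis by simp
  next
    case 3
    define \<tau> where "\<tau> = 1 - sqrt t / r"
    have r0: "r > 0" using 3 by (metis less_trans real_sqrt_gt_zero)
    have \<tau>: "0 < \<tau>" "\<tau> < 1" using 3 r0 by (simp_all add: \<tau>_def)
    define a where "a b = \<tau> * l b / m" for b
    have a: "0 \<le> a b" "a b \<le> \<tau>" if "b \<in> Basis" for b
      using l[OF that] m \<tau> by (auto simp: a_def field_simps)
    then have a1: "a b < 1" if "b \<in> Basis" for b using \<tau> that by fastforce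
    have factor: "1 / sqrt (1 - a b) \<le> exp (a b / (2 * (1 - \<tau>)))" if b: "b \<in> Basis" for b
    proof -
      have "1 / (1 - a b) = 1 + a b / (1 - a b)" using a[OF b] \<tau> by (simp add: field_simps)
      also have "\<dots> \<le> exp (a b / (1 - a b))" by (rule exp_ge_add_one_self)
      also have "\<dots> \<le> exp (a b / (1 - \<tau>))" using a[OF b] \<tau> by (simp add: frac_le)
      finally have "sqrt (1 / (1 - a b)) \<le> sqrt (exp (a b / (1 - \<tau>)))" by (rule real_sqrt_le_mono)
      also have "exp (a b / (1 - \<tau>)) = (exp (a b / (2 * (1 - \<tau>))))\<^sup>2"
        by (simp flip: exp_double del: right_diff_distrib_numeral)
      finally show ?thesis by (simp add: real_sqrt_divide)
    qed
    have "emeasure std_gauss {z. diag l z \<bullet> z > r\<^sup>2} = (\<integral>\<^sup>+z. indicator {z. diag l z \<bullet> z > r\<^sup>2} z \<partial>std_gauss)"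
      using linear_borel_measurable[OF linear_diag[of l]] by (intro nn_integral_indicator[symmetric]) simp
    also have "\<dots> \<le> (\<integral>\<^sup>+z. ennreal (exp (- \<tau> * r\<^sup>2 / (2 * m))) * ennreal (exp (\<Sum>b\<in>Basis. a b * (z \<bullet> b)\<^sup>2 / 2)) \<partial>std_gauss)"
    proof (rule nn_integral_mono)
      fix z :: 'a
      have "(\<Sum>b\<in>Basis. a b * (z \<bullet> b)\<^sup>2 / 2) = \<tau> * (diag l z \<bullet> z) / (2 * m)"
        by (simp add: diag_quadratic sum_distrib_left sum_divide_distrib a_def mult_ac)
      moreover have "- \<tau> * r\<^sup>2 / (2 * m) + \<tau> * (diag l z \<bullet> z) / (2 * m) \<ge> 0" if "diag l z \<bullet> z > r\<^sup>2"
        using that m \<tau> by (simp add: divide_right_mono)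
      ultimately show "indicator {z. diag l z \<bullet> z > r\<^sup>2} z
          \<le> ennreal (exp (- \<tau> * r\<^sup>2 / (2 * m))) * ennreal (exp (\<Sum>b\<in>Basis. a b * (z \<bullet> b)\<^sup>2 / 2))"
        by (auto split: split_indicator simp: ennreal_mult[symmetric] exp_add[symmetric] simp del: ennreal_1 simp flip: ennreal_1)
    qed
    also have "\<dots> = ennreal (exp (- \<tau> * r\<^sup>2 / (2 * m)) * (\<Prod>b\<in>Basis. 1 / sqrt (1 - a b)))"
    proof -
      have "0 \<le> (\<Prod>b\<in>Basis. 1 / sqrt (1 - a b))"
        using a1 by (intro prod_nonneg) (simp add: less_imp_le)
      then show ?thesis
        by (simp only: nn_integral_exp_quadratic_std_gauss[of a, OF a1] ennreal_mult exp_ge_zero nn_integral_cmult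
            borel_measurable_exp measurable_ennreal) (subst nn_integral_cmult, simp_all add: nn_integral_exp_quadratic_std_gauss[of a, OF a1] ennreal_mult)
    qed
    also have "\<dots> \<le> ennreal (exp (- \<tau> * r\<^sup>2 / (2 * m)) * exp (\<Sum>b\<in>Basis. a b / (2 * (1 - \<tau>))))"
      unfolding exp_sum[OF finite_Basis] using factor a1
      by (intro ennreal_leI mult_left_mono prod_mono) (auto simp: less_imp_le)
    also have "exp (- \<tau> * r\<^sup>2 / (2 * m)) * exp (\<Sum>b\<in>Basis. a b / (2 * (1 - \<tau>))) = exp (- (r - sqrt t)\<^sup>2 / (2 * m))"
    proof -
      have "(\<Sum>b\<in>Basis. a b / (2 * (1 - \<tau>))) = \<tau> * t / (2 * m * (1 - \<tau>))"
        by (simp add: a_def t[symmetric] sum_distrib_left sum_divide_distrib mult_ac)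
      also have "\<dots> = \<tau> * sqrt t * r / (2 * m)"
      proof -
        define s where "s = sqrt t"
        have s: "s > 0" "t = s * s" using 3 by (simp_all add: s_def)
        have "1 - \<tau> = s / r" by (simp add: \<tau>_def s_def)
        then have "\<tau> * t / (2 * m * (1 - \<tau>)) = \<tau> * (s * s) / (2 * m * (s / r))" using s by simp
        also have "\<dots> = \<tau> * s * r / (2 * m)" using s r0 m by (simp add: field_simps)
        finally show ?thesis by (simp add: s_def)
      qed
      finally have "- \<tau> * r\<^sup>2 / (2 * m) + (\<Sum>b\<in>Basis. a b / (2 * (1 - \<tau>))) = - (\<tau> * r) * (r - sqrt t) / (2 * m)"
        by (simp add: power2_eq_square algebra_simps diff_divide_distrib)
      also have "\<tau> * r = r - sqrt t" using r0 by (simp add: \<tau>_def field_simps)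
      also have "- (r - sqrt t) * (r - sqrt t) / (2 * m) = - (r - sqrt t)\<^sup>2 / (2 * m)"
        by (simp only: power2_eq_square mult_minus_left)
      finally show ?thesis by (simp only: exp_add[symmetric])
    qed
    finally show ?thesis .
  qed
qed

lemma std_gauss_quadratic_tail:
  fixes T :: "'a::euclidean_space \<Rightarrow> 'a"
  assumes T: "psd T" and m: "0 < m" "\<And>u. T u \<bullet> u \<le> m * (u \<bullet> u)" and r: "sqrt (op_trace T) \<le> r"
  shows "emeasure std_gauss {u. T u \<bullet> u > r\<^sup>2} \<le> ennreal (exp (- (r - sqrt (op_trace T))\<^sup>2 / (2 * m)))"
proof -
  obtain R :: "'a \<Rightarrow> 'a" and l where R: "orthogonal_transformation R" and TR: "\<And>z. T (R z) = R (diag l z)"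
    using spectral_theorem[OF psd_self_adjoint[OF T]] by blast
  note [measurable] = linear_borel_measurable[OF psd_linear[OF T]] linear_borel_measurable[OF linear_diag[of l]]
  have "0 \<le> l b \<and> l b \<le> m" if "b \<in> Basis" for b
    using diagonal_entry[of R T, OF R TR that] psd_nonneg[OF T, of "R b"] m(2)[of "R b"] that
    by (simp add: orthogonal_transformation_inner[OF R])
  note tail = std_gauss_diag_tail[OF this m(1) op_trace_diagonalized[OF R TR, symmetric] r]
  have "emeasure std_gauss {u. T u \<bullet> u > r\<^sup>2} = (\<integral>\<^sup>+u. indicator {u. T u \<bullet> u > r\<^sup>2} u \<partial>std_gauss)"
    by (intro nn_integral_indicator[symmetric]) simp
  also have "\<dots> = (\<integral>\<^sup>+z. indicator {u. T u \<bullet> u > r\<^sup>2} (R z) \<partial>std_gauss)"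
    by (rule nn_integral_std_gauss_orthogonal[OF R, symmetric]) simp
  also have "\<dots> = (\<integral>\<^sup>+z. indicator {z. diag l z \<bullet> z > r\<^sup>2} z \<partial>std_gauss)"
    by (intro nn_integral_cong) (simp add: indicator_def TR orthogonal_transformation_inner[OF R])
  also have "\<dots> = emeasure std_gauss {z. diag l z \<bullet> z > r\<^sup>2}"
    by (intro nn_integral_indicator) simp
  finally show ?thesis using tail by simp
qed

lemma distr_std_gauss_orthogonal:
  fixes R :: "'a::euclidean_space \<Rightarrow> 'a"
  assumes R: "orthogonal_transformation R"
  shows "distr std_gauss borel R = std_gauss"
proof (rule measure_eqI)
  note m [measurable] = linear_borel_measurable[OF orthogonal_transformation_linear[OF R]]
  fix A assume "A \<in> sets (distr std_gauss borel R)"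
  then have A [measurable]: "A \<in> sets borel" by simp
  have "emeasure (distr std_gauss borel R) A = (\<integral>\<^sup>+x. indicator A x \<partial>distr std_gauss borel R)"
    by simp
  also have "\<dots> = (\<integral>\<^sup>+x. indicator A (R x) \<partial>std_gauss)"
    by (rule nn_integral_distr) measurable
  also have "\<dots> = emeasure std_gauss A"
    by (simp add: nn_integral_std_gauss_orthogonal[OF R] A)
  finally show "emeasure (distr std_gauss borel R) A = emeasure std_gauss A" .
qed simp

lemma norm_square_Basis: "(norm v)\<^sup>2 = (\<Sum>b\<in>Basis. (v \<bullet> b)\<^sup>2)"
  by (subst power2_norm_eq_inner, subst euclidean_inner) (simp add: power2_eq_square)

text \<open>The operators \<open>M\<^sup>T M\<close> and \<open>M M\<^sup>T\<close> have the same trace and the same largest eigenvalue, so the deviation bound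
for the quadratic form \<open>|M \<gamma>|\<^sup>2\<close> is expressed by the quantile of \<open>M M\<^sup>T\<close>.\<close>

lemma gauss_image_tail:
  fixes M :: "'a::euclidean_space \<Rightarrow> 'b::euclidean_space"
  assumes M: "linear M" and x: "0 \<le> x"
  shows "measure std_gauss {\<gamma>. norm (M \<gamma>) > z_quant (M \<circ> adjoint M) x} \<le> exp (- x)"
proof -
  note adj = adjoint_works[OF M]
  have linA: "linear (adjoint M)" by (rule adjoint_linear[OF M])
  define B where "B = M \<circ> adjoint M"
  define T where "T = adjoint M \<circ> M"
  have Bq: "B v \<bullet> v = (norm (adjoint M v))\<^sup>2" for v
    using adj[of "adjoint M v" v] by (simp add: B_def power2_norm_eq_inner inner_commute)
  have Tq: "T u \<bullet> u = (norm (M u))\<^sup>2" for u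
    using adj[of u "M u"] by (simp add: T_def power2_norm_eq_inner inner_commute)
  have Bpsd: "psd B" unfolding psd_def self_adjoint_def
  proof (intro conjI allI)
    show "linear B" unfolding B_def by (intro linear_compose M linA)
    show "B u \<bullet> v = u \<bullet> B v" for u v
      using adj[of "adjoint M u" v] adj[of "adjoint M v" u] by (simp add: B_def inner_commute)
    show "0 \<le> B u \<bullet> u" for u by (simp add: Bq)
  qed
  have Tpsd: "psd T" unfolding psd_def self_adjoint_def
  proof (intro conjI allI)
    show "linear T" unfolding T_def by (intro linear_compose M linA)
    show "T u \<bullet> v = u \<bullet> T v" for u v
      using adj[of v "M u"] adj[of u "M v"] by (simp add: T_def inner_commute)
    show "0 \<le> T u \<bullet> u" for u by (simp add: Tq)
  qed
  define m where "m = lambda_max B"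
  have m0: "0 \<le> m" unfolding m_def by (rule psd_lambda_max_nonneg[OF Bpsd])
  have norm_adj: "(norm (adjoint M v))\<^sup>2 \<le> m * (norm v)\<^sup>2" for v
    using quadratic_le_lambda_max[OF psd_self_adjoint[OF Bpsd], of v] by (simp add: Bq m_def power2_norm_eq_inner)
  have Tle: "T u \<bullet> u \<le> m * (u \<bullet> u)" for u
  proof -
    have "(norm (M u))\<^sup>2 = u \<bullet> adjoint M (M u)" using adj[of u "M u"] by (simp add: power2_norm_eq_inner)
    also have "\<dots> \<le> norm u * norm (adjoint M (M u))" by (rule norm_cauchy_schwarz)
    also have "norm (adjoint M (M u)) \<le> sqrt m * norm (M u)"
      using real_sqrt_le_mono[OF norm_adj[of "M u"]] by (simp add: real_sqrt_mult)
    then have "norm u * norm (adjoint M (M u)) \<le> norm u * (sqrt m * norm (M u))" by (intro mult_left_mono) auto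
    finally have *: "norm (M u) * norm (M u) \<le> (sqrt m * norm u) * norm (M u)" by (simp add: power2_eq_square mult_ac)
    have "norm (M u) \<le> sqrt m * norm u"
    proof (cases "norm (M u) = 0")
      case True then show ?thesis using m0 by simp
    next
      case False then show ?thesis using * by (simp add: mult_le_cancel_right)
    qed
    then have "(norm (M u))\<^sup>2 \<le> (sqrt m * norm u)\<^sup>2" by (intro power_mono) auto
    then show ?thesis using m0 by (simp add: Tq power_mult_distrib power2_norm_eq_inner)
  qed
  have trace: "op_trace T = op_trace B"
  proof -
    have "op_trace T = (\<Sum>b\<in>Basis. \<Sum>c\<in>Basis. (M b \<bullet> c)\<^sup>2)"
      unfolding op_trace_def Tq norm_square_Basis ..
    also have "\<dots> = (\<Sum>c\<in>Basis. \<Sum>b\<in>Basis. (M b \<bullet> c)\<^sup>2)" by (rule sum.swap)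
    also have "\<dots> = op_trace B"
      unfolding op_trace_def Bq norm_square_Basis
      by (simp add: adj inner_commute[of "adjoint M _"])
    finally show ?thesis .
  qed
  define z where "z = z_quant B x"
  have zq: "z = sqrt (op_trace T) + sqrt (2 * m * x)" by (simp add: z_def z_quant_def trace m_def)
  have z0: "0 \<le> z" unfolding z_def by (rule z_quant_nonneg[OF Bpsd x])
  have set_eq: "{\<gamma>. norm (M \<gamma>) > z} = {\<gamma>. T \<gamma> \<bullet> \<gamma> > z\<^sup>2}"
  proof -
    have "norm (M \<gamma>) > z \<longleftrightarrow> (norm (M \<gamma>))\<^sup>2 > z\<^sup>2" for \<gamma>
      using z0 by (meson norm_ge_zero power2_less_imp_less power_strict_mono zero_less_numeral)
    then show ?thesis by (simp add: Tq)
  qed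
  show ?thesis
  proof (cases "m = 0")
    case True
    then have "T \<gamma> \<bullet> \<gamma> \<le> z\<^sup>2" for \<gamma> using Tle[of \<gamma>] by (simp add: order_trans[OF _ zero_le_power2])
    then have "{\<gamma>. T \<gamma> \<bullet> \<gamma> > z\<^sup>2} = {}" by (simp add: not_less)
    then have "measure std_gauss {\<gamma>. norm (M \<gamma>) > z} = 0" unfolding set_eq by simp
    then show ?thesis by (simp add: z_def B_def)
  next
    case False
    then have m: "0 < m" using m0 by simp
    have "emeasure std_gauss {\<gamma>. T \<gamma> \<bullet> \<gamma> > z\<^sup>2} \<le> ennreal (exp (- (z - sqrt (op_trace T))\<^sup>2 / (2 * m)))"
      using m x by (intro std_gauss_quadratic_tail[OF Tpsd m Tle]) (simp add: zq)
    also have "- (z - sqrt (op_trace T))\<^sup>2 / (2 * m) = - x"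
      using m x by (simp add: zq)
    finally have "measure std_gauss {\<gamma>. norm (M \<gamma>) > z} \<le> exp (- x)"
      by (simp add: std_gauss.emeasure_eq_measure set_eq)
    then show ?thesis by (simp add: z_def B_def)
  qed
qed

section \<open>Laplace approximation in whitened coordinates\<close>

lemma exp_minus_one_minus_self: "\<bar>exp y - 1 - y\<bar> \<le> y\<^sup>2" if "\<bar>y\<bar> \<le> 1" for y :: real
proof -
  have "exp y \<le> 1 + y + y\<^sup>2"
  proof (cases "0 \<le> y")
    case True then show ?thesis using that exp_bound[of y] by simp
  next
    case False
    define t where "t = - y"
    have t: "0 < t" "t \<le> 1" using False that by (auto simp: t_def)
    have "1 \<le> (1 + t) * (1 - t + t\<^sup>2)" using t by (simp add: algebra_simps power2_eq_square)
    also have "\<dots> \<le> exp t * (1 - t + t\<^sup>2)"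
      using t exp_ge_add_one_self[of t] by (intro mult_right_mono) auto
    finally have "exp (- t) \<le> 1 - t + t\<^sup>2"
      by (simp add: exp_minus field_simps)
    then show ?thesis by (simp add: t_def)
  qed
  then show ?thesis using exp_ge_add_one_self[of y] zero_le_power2[of y] by linarith
qed

lemma integrable_bounded_gauss:
  fixes f :: "'a::euclidean_space \<Rightarrow> real"
  assumes "f \<in> borel_measurable borel" "\<And>z. \<bar>f z\<bar> \<le> c"
  shows "integrable std_gauss f" "\<bar>LINT z|std_gauss. f z\<bar> \<le> c"
proof -
  show i: "integrable std_gauss f"
    using assms by (intro std_gauss.integrable_const_bound[of _ c]) auto
  have "\<bar>LINT z|std_gauss. f z\<bar> \<le> (LINT z|std_gauss. \<bar>f z\<bar>)"
    using integral_norm_bound[of std_gauss f] by simp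
  also have "\<dots> \<le> (LINT z|(std_gauss :: 'a measure). c)"
    using i assms by (intro Bochner_Integration.integral_mono) auto
  finally show "\<bar>LINT z|std_gauss. f z\<bar> \<le> c" by (simp add: std_gauss.prob_space[where 'a='a, simplified])
qed

lemma integrable_indicator_gauss: "B \<in> sets borel \<Longrightarrow> integrable std_gauss (indicator B :: 'a::euclidean_space \<Rightarrow> real)"
  by (intro integrable_bounded_gauss[where c = 1]) (auto split: split_indicator)

text \<open>Laplace approximation after a linear change of coordinates. The numbers \<open>l\<close> are the eigenvalues of the
information \<open>F\<close> relative to the penalised information, \<open>H\<close> is the log-posterior relative to its maximum,
\<open>V\<close> is the parameter set, and \<open>\<epsilon>\<close> bounds the Taylor remainder on the region where \<open>\<parallel>D u\<parallel> \<le> r\<close>.\<close>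

locale diagonal_laplace =
  fixes l :: "'a::euclidean_space \<Rightarrow> real" and r x \<epsilon> :: real and V :: "'a set" and H :: "'a \<Rightarrow> real"
  assumes l: "\<And>b. b \<in> Basis \<Longrightarrow> 0 \<le> l b \<and> l b \<le> 1"
    and V: "open V" and conc: "concave_on V H" and H [measurable]: "H \<in> borel_measurable borel"
    and inV: "\<And>z. diag l z \<bullet> z \<le> r\<^sup>2 \<Longrightarrow> z \<in> V"
    and approx: "\<And>z. diag l z \<bullet> z \<le> r\<^sup>2 \<Longrightarrow> \<bar>H z + z \<bullet> z / 2\<bar> \<le> \<epsilon>"
    and \<epsilon>: "\<epsilon> \<le> 1 / 8" and x: "16 \<le> x" and r: "2 * sqrt (\<Sum>b\<in>Basis. l b) + sqrt x \<le> r"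
begin

definition q :: "'a \<Rightarrow> real" where "q z = diag l z \<bullet> z"
definition p :: real where "p = (\<Sum>b\<in>Basis. l b)"
definition K :: "'a set" where "K = {z. q z \<le> r\<^sup>2}"

lemma q_eq: "q z = (\<Sum>b\<in>Basis. l b * (z \<bullet> b)\<^sup>2)" by (simp add: q_def diag_quadratic)

lemma q_measurable [measurable]: "q \<in> borel_measurable borel"
  unfolding q_def[abs_def] using linear_borel_measurable[OF linear_diag[of l]] by measurable

lemma V_measurable [measurable]: "V \<in> sets borel" using V by (rule borel_open)
lemma K_measurable [measurable]: "K \<in> sets borel" unfolding K_def by measurable

lemma p0: "0 \<le> p" unfolding p_def using l by (intro sum_nonneg) auto
lemma r4: "4 \<le> r" and sqrt_x_le: "sqrt x \<le> r" and sqrt_p_le: "2 * sqrt p \<le> r"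
proof -
  have "4 \<le> sqrt x" using x by (intro real_le_rsqrt) simp
  then show "4 \<le> r" "sqrt x \<le> r" "2 * sqrt p \<le> r"
    using r p0 x real_sqrt_ge_zero[OF p0] unfolding p_def[symmetric] by linarith+
qed

lemma p_le: "p \<le> r\<^sup>2 / 4"
proof -
  have "(2 * sqrt p)\<^sup>2 \<le> r\<^sup>2" using sqrt_p_le p0 by (intro power_mono) auto
  then show ?thesis using p0 by (simp add: power_mult_distrib)
qed

lemma \<epsilon>0: "0 \<le> \<epsilon>"
  using approx[of 0] by (simp add: linear_0[OF linear_diag])

definition shrink :: "real \<Rightarrow> 'a \<Rightarrow> 'a" where "shrink c = diag (\<lambda>b. 1 / (1 + c * l b))"

lemma shrink_inner: "b \<in> Basis \<Longrightarrow> shrink c z \<bullet> b = (z \<bullet> b) / (1 + c * l b)"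
  by (simp add: shrink_def)

lemma one_plus_pos: "0 \<le> c \<Longrightarrow> b \<in> Basis \<Longrightarrow> 0 < 1 + c * l b"
  using l by (simp add: add_pos_nonneg)

text \<open>Put \<open>w = shrink c z\<close> and \<open>w' = (I - \<Lambda>) w\<close>. Then \<open>w\<close> divides the segment from \<open>w'\<close> to \<open>z\<close> in the ratio \<open>1 : c\<close>,
hence \<open>H z \<le> H w + c (H w - H w')\<close>, and the right-hand side is known up to \<open>\<epsilon>\<close> because \<open>w\<close> and \<open>w'\<close> lie in the
region where \<open>H\<close> is nearly quadratic. There \<open>|w|\<^sup>2 - |w'|\<^sup>2 \<ge> q w\<close>.\<close>

lemma concave_extrapolation:
  assumes z: "z \<in> V" and c: "0 \<le> c" and w: "q (shrink c z) \<le> r\<^sup>2"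
  shows "H z \<le> - (shrink c z \<bullet> shrink c z) / 2 + \<epsilon> - c * (q (shrink c z) / 2 - 2 * \<epsilon>)"
proof -
  define w where "w = shrink c z"
  \<comment> \<open>The continuation of the segment from \<open>z\<close> to \<open>w\<close> beyond \<open>w\<close> by a step \<open>(z - w) / c = \<Lambda> w\<close>.\<close>
  define w' where "w' = diag (\<lambda>b. 1 - l b) w"
  have w'b: "w' \<bullet> b = (1 - l b) * (w \<bullet> b)" if "b \<in> Basis" for b using that by (simp add: w'_def)
  have "q w' \<le> q w" unfolding q_eq
  proof (rule sum_mono)
    fix b :: 'a assume b: "b \<in> Basis"
    have "(1 - l b)\<^sup>2 \<le> 1" using l[OF b] by (simp add: power_le_one)
    then have "(1 - l b)\<^sup>2 * (w \<bullet> b)\<^sup>2 \<le> 1 * (w \<bullet> b)\<^sup>2" by (intro mult_right_mono) auto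
    then show "l b * (w' \<bullet> b)\<^sup>2 \<le> l b * (w \<bullet> b)\<^sup>2"
      using l[OF b] by (intro mult_left_mono) (auto simp: w'b b power_mult_distrib)
  qed
  then have K: "q w \<le> r\<^sup>2" "q w' \<le> r\<^sup>2" using w by (auto simp: w_def)
  have c1: "1 + c > 0" using c by simp
  have conv: "w = (1 - c / (1 + c)) *\<^sub>R z + (c / (1 + c)) *\<^sub>R w'"
  proof (rule euclidean_eqI)
    fix b :: 'a assume b: "b \<in> Basis"
    have zb: "z \<bullet> b = (1 + c * l b) * (w \<bullet> b)"
      using one_plus_pos[OF c b] by (simp add: w_def shrink_inner b)
    have "1 - c / (1 + c) = 1 / (1 + c)" using c1 by (simp add: field_simps)
    then have "((1 - c / (1 + c)) *\<^sub>R z + (c / (1 + c)) *\<^sub>R w') \<bullet> b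
        = ((1 + c * l b) * (w \<bullet> b) + c * ((1 - l b) * (w \<bullet> b))) / (1 + c)"
      by (simp add: inner_add_left zb w'b b add_divide_distrib)
    also have "(1 + c * l b) * (w \<bullet> b) + c * ((1 - l b) * (w \<bullet> b)) = (1 + c) * (w \<bullet> b)"
      by (simp add: algebra_simps)
    finally show "w \<bullet> b = ((1 - c / (1 + c)) *\<^sub>R z + (c / (1 + c)) *\<^sub>R w') \<bullet> b" using c1 by simp
  qed
  have "- H w \<le> (1 - c / (1 + c)) * - H z + c / (1 + c) * - H w'"
    unfolding conv using conc z inV K c
    by (intro convex_onD[of V "\<lambda>z. - H z"]) (auto simp: concave_on_def q_def)
  then have "(1 + c) * (- H w) \<le> (1 + c) * ((1 - c / (1 + c)) * - H z + c / (1 + c) * - H w')"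
    using c1 by (intro mult_left_mono) auto
  also have "1 - c / (1 + c) = 1 / (1 + c)" using c1 by (simp add: field_simps)
  also have "(1 + c) * (1 / (1 + c) * - H z + c / (1 + c) * - H w') = - H z - c * H w'"
    using c1 by (subst distrib_left) simp
  finally have 1: "H z \<le> H w + c * (H w - H w')" by (simp add: algebra_simps)
  have 2: "H w \<le> - (w \<bullet> w) / 2 + \<epsilon>" and "H w' \<ge> - (w' \<bullet> w') / 2 - \<epsilon>"
    using approx[of w] approx[of w'] K by (auto simp: q_def abs_le_iff)
  moreover have "w' \<bullet> w' + q w \<le> w \<bullet> w"
  proof -
    have "(\<Sum>b\<in>Basis. (w' \<bullet> b) * (w' \<bullet> b) + l b * (w \<bullet> b)\<^sup>2) \<le> (\<Sum>b\<in>Basis. (w \<bullet> b) * (w \<bullet> b))"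
    proof (rule sum_mono)
      fix b :: 'a assume b: "b \<in> Basis"
      have "(1 - l b) * (1 - l b) + l b \<le> 1"
        using l[OF b] mult_right_mono[of "l b" 1 "l b"] by (simp add: algebra_simps)
      then have "((1 - l b) * (1 - l b) + l b) * (w \<bullet> b)\<^sup>2 \<le> 1 * (w \<bullet> b)\<^sup>2"
        by (intro mult_right_mono) auto
      then show "(w' \<bullet> b) * (w' \<bullet> b) + l b * (w \<bullet> b)\<^sup>2 \<le> (w \<bullet> b) * (w \<bullet> b)"
        by (simp add: w'b b power2_eq_square algebra_simps)
    qed
    then show ?thesis by (simp add: sum.distrib q_eq euclidean_inner[of w w] euclidean_inner[of w' w'])
  qed
  ultimately have "H w - H w' \<le> - (q w / 2 - 2 * \<epsilon>)" by simp
  then have "c * (H w - H w') \<le> c * - (q w / 2 - 2 * \<epsilon>)" using c by (rule mult_left_mono)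
  then have "c * (H w - H w') \<le> - (c * (q w / 2 - 2 * \<epsilon>))" by (simp only: mult_minus_right)
  then show ?thesis using 1 2 unfolding w_def[symmetric] by linarith
qed

text \<open>
  The grid width for \<open>c\<close>. It is so fine that one step changes the radius \<open>r\<close> only to \<open>\<rho> \<ge> r - 1/r\<close>, which costs a
  bounded factor in Gaussian tails, and so coarse that consecutive layers decay at least by the factor \<open>exp (-1/8)\<close>.
\<close>

definition \<eta> :: real where "\<eta> = 1 / r\<^sup>2"
definition \<rho> :: real where "\<rho> = r / (1 + \<eta>)"

lemma \<eta>: "0 < \<eta>" using r4 by (simp add: \<eta>_def)

lemma \<rho>0: "0 < \<rho>" using r4 \<eta> by (simp add: \<rho>_def)

lemma \<rho>_ge: "r - 1 / r \<le> \<rho>"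
proof -
  have "(r - 1 / r) * (1 + \<eta>) = r - 1 / (r * r * r)"
    using r4 by (simp add: \<eta>_def power2_eq_square field_simps)
  also have "\<dots> \<le> r" using r4 by simp
  finally show ?thesis using \<eta> by (simp add: \<rho>_def pos_le_divide_eq)
qed

text \<open>In passing from one grid value of \<open>c\<close> to the next, the bound gains \<open>\<rho>\<^sup>2/2 - 2 \<epsilon>\<close> per unit of \<open>c\<close> and loses \<open>p\<close>
through the Jacobian. The net gain is positive because \<open>p \<le> r\<^sup>2/4\<close>.\<close>

lemma rate: "1 / 8 \<le> \<eta> * (\<rho>\<^sup>2 / 2 - 2 * \<epsilon> - p)"
proof -
  have r16: "16 \<le> r\<^sup>2" using power_mono[OF r4, of 2] by simp
  have "r - 1 / r \<ge> 0" using r4 mult_mono[of 1 r 1 r] by (simp add: field_simps)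
  then have "(r - 1 / r)\<^sup>2 \<le> \<rho>\<^sup>2" using \<rho>_ge by (intro power_mono)
  moreover have "(r - 1 / r)\<^sup>2 = r\<^sup>2 - 2 + 1 / r\<^sup>2"
    using r4 by (simp add: power2_eq_square field_simps)
  moreover have "0 \<le> 1 / r\<^sup>2" by simp
  ultimately have "\<rho>\<^sup>2 \<ge> r\<^sup>2 - 2" by linarith
  then have "\<rho>\<^sup>2 / 2 - 2 * \<epsilon> - p \<ge> r\<^sup>2 / 8"
    using p_le \<epsilon> r16 by linarith
  then have "\<eta> * (r\<^sup>2 / 8) \<le> \<eta> * (\<rho>\<^sup>2 / 2 - 2 * \<epsilon> - p)" using \<eta> by (intro mult_left_mono) auto
  then show ?thesis using r4 by (simp add: \<eta>_def)
qed

lemma shrink_0: "shrink 0 z = z"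
  by (rule euclidean_eqI) (simp add: shrink_inner)

text \<open>Take the first grid point at which the image lies in the region. One step earlier it was still outside,
and one step changes each coordinate by a factor of at most \<open>1 + \<eta>\<close>, so \<open>q\<close> still exceeds \<open>\<rho>\<^sup>2\<close>.\<close>

lemma shrink_layer:
  assumes "q z > r\<^sup>2"
  obtains j :: nat where "q (shrink (Suc j * \<eta>) z) \<le> r\<^sup>2" "\<rho>\<^sup>2 < q (shrink (Suc j * \<eta>) z)"
proof -
  define P where "P j \<longleftrightarrow> q (shrink (real j * \<eta>) z) \<le> r\<^sup>2" for j :: nat
  have bound: "q (shrink c z) \<le> (z \<bullet> z) / (4 * c)" if c: "c > 0" for c
  proof -
    have "q (shrink c z) \<le> (\<Sum>b\<in>Basis. (1 / (4 * c)) * ((z \<bullet> b) * (z \<bullet> b)))"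
      unfolding q_eq
    proof (rule sum_mono)
      fix b :: 'a assume b: "b \<in> Basis"
      have pos: "0 < 1 + c * l b" using one_plus_pos b c by simp
      have "0 \<le> (1 - c * l b)\<^sup>2" by simp
      then have "4 * c * l b \<le> (1 + c * l b)\<^sup>2" by (simp add: power2_eq_square algebra_simps)
      then have "l b / (1 + c * l b)\<^sup>2 \<le> 1 / (4 * c)"
        using c pos by (simp add: field_simps)
      then have "l b / (1 + c * l b)\<^sup>2 * (z \<bullet> b)\<^sup>2 \<le> 1 / (4 * c) * (z \<bullet> b)\<^sup>2"
        by (intro mult_right_mono) auto
      then show "l b * (shrink c z \<bullet> b)\<^sup>2 \<le> (1 / (4 * c)) * ((z \<bullet> b) * (z \<bullet> b))"
        by (simp add: shrink_inner b power_divide power2_eq_square)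
    qed
    then show ?thesis by (simp add: sum_distrib_left[symmetric] sum_divide_distrib[symmetric] euclidean_inner[of z z])
  qed
  obtain N :: nat where N: "z \<bullet> z < real N * (4 * \<eta> * r\<^sup>2)"
    using ex_less_of_nat_mult[of "4 * \<eta> * r\<^sup>2"] \<eta> r4 by auto
  have N0: "N > 0"
  proof (rule ccontr)
    assume "\<not> N > 0" then show False using N inner_ge_zero[of z] by simp
  qed
  have "P N"
  proof -
    have "(z \<bullet> z) / (4 * (real N * \<eta>)) \<le> r\<^sup>2"
      using N N0 \<eta> by (simp add: field_simps)
    then show ?thesis using bound[of "real N * \<eta>"] N0 \<eta> by (simp add: P_def)
  qed
  then have PL: "P (LEAST j. P j)" by (rule LeastI)
  have "\<not> P 0" using assms by (simp add: P_def shrink_0)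
  then obtain j where j: "(LEAST j. P j) = Suc j"
    using PL by (metis not0_implies_Suc)
  then have nPj: "\<not> P j" using not_less_Least[of j P] by simp
  have "q (shrink (real j * \<eta>) z) \<le> (1 + \<eta>)\<^sup>2 * q (shrink (Suc j * \<eta>) z)"
    unfolding q_eq sum_distrib_left
  proof (rule sum_mono)
    fix b :: 'a assume b: "b \<in> Basis"
    define d d' where "d = 1 + real j * \<eta> * l b" and "d' = 1 + Suc j * \<eta> * l b"
    have e1: "shrink (real j * \<eta>) z \<bullet> b = (z \<bullet> b) / d" and e2: "shrink (Suc j * \<eta>) z \<bullet> b = (z \<bullet> b) / d'"
      using b by (simp_all only: shrink_inner d_def d'_def)
    have d: "d \<ge> 1" using l[OF b] \<eta> by (simp add: d_def)
    have d'eq: "d' = d + \<eta> * l b" by (simp add: d_def d'_def algebra_simps)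
    have "\<eta> * l b \<le> \<eta> * d" using l[OF b] d \<eta> by (intro mult_left_mono) auto
    then have dd: "d' \<le> (1 + \<eta>) * d" by (simp add: d'eq algebra_simps)
    have d': "d' > 0" using l[OF b] \<eta> d by (simp add: d'eq add_pos_nonneg)
    have "1 / d \<le> (1 + \<eta>) / d'" using dd d d' by (simp add: field_simps)
    then have "(1 / d)\<^sup>2 \<le> ((1 + \<eta>) / d')\<^sup>2" using d by (intro power_mono) auto
    then have "(1 / d)\<^sup>2 * (l b * (z \<bullet> b)\<^sup>2) \<le> ((1 + \<eta>) / d')\<^sup>2 * (l b * (z \<bullet> b)\<^sup>2)"
      using l[OF b] by (intro mult_right_mono) auto
    then show "l b * (shrink (real j * \<eta>) z \<bullet> b)\<^sup>2 \<le> (1 + \<eta>)\<^sup>2 * (l b * (shrink (Suc j * \<eta>) z \<bullet> b)\<^sup>2)"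
      unfolding e1 e2 by (simp add: power_divide mult_ac)
  qed
  then have "r\<^sup>2 < (1 + \<eta>)\<^sup>2 * q (shrink (Suc j * \<eta>) z)" using nPj by (simp add: P_def)
  then have "\<rho>\<^sup>2 < q (shrink (Suc j * \<eta>) z)"
    using \<eta> by (simp add: \<rho>_def power_divide pos_divide_less_eq mult.commute)
  moreover have "q (shrink (Suc j * \<eta>) z) \<le> r\<^sup>2" using PL[unfolded j] unfolding P_def .
  ultimately show ?thesis using that by blast
qed

text \<open>Bounds \<open>exp (H z)\<close> as a function of \<open>w = shrink (Suc j * \<eta>) z\<close>; see \<open>outside_le_layers\<close>.\<close>

definition layer :: "nat \<Rightarrow> 'a \<Rightarrow> real" where
  "layer j w = indicator {w. q w > \<rho>\<^sup>2} w * exp (- (w \<bullet> w) / 2 + \<epsilon> - Suc j * \<eta> * (\<rho>\<^sup>2 / 2 - 2 * \<epsilon>))"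

lemma layer_measurable [measurable]: "layer j \<in> borel_measurable borel"
  unfolding layer_def[abs_def] by measurable

lemma outside_le_layers:
  "ennreal (indicator (V - K) z * exp (H z)) \<le> (\<Sum>j. ennreal (layer j (shrink (Suc j * \<eta>) z)))"
proof (cases "z \<in> V - K")
  case True
  then obtain j :: nat where j: "q (shrink (Suc j * \<eta>) z) \<le> r\<^sup>2" "\<rho>\<^sup>2 < q (shrink (Suc j * \<eta>) z)"
    using shrink_layer[of z] by (auto simp: K_def)
  define w where "w = shrink (Suc j * \<eta>) z"
  have "H z \<le> - (w \<bullet> w) / 2 + \<epsilon> - Suc j * \<eta> * (q w / 2 - 2 * \<epsilon>)"
    unfolding w_def using True j \<eta> by (intro concave_extrapolation) auto
  also have "\<dots> \<le> - (w \<bullet> w) / 2 + \<epsilon> - Suc j * \<eta> * (\<rho>\<^sup>2 / 2 - 2 * \<epsilon>)"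
    using j \<eta> by (intro diff_left_mono mult_left_mono) (auto simp: w_def)
  finally have "exp (H z) \<le> layer j w"
    using j by (simp add: layer_def w_def)
  then have "ennreal (indicator (V - K) z * exp (H z)) \<le> ennreal (layer j (shrink (Suc j * \<eta>) z))"
    using True by (simp add: w_def ennreal_leI)
  also have "\<dots> \<le> (\<Sum>j. ennreal (layer j (shrink (Suc j * \<eta>) z)))"
    using sum_le_suminf[of "\<lambda>j. ennreal (layer j (shrink (Suc j * \<eta>) z))" "{j}"] by simp
  finally show ?thesis .
qed simp

definition \<kappa> :: real where "\<kappa> = (1 / sqrt (2 * pi)) ^ DIM('a)"

lemma \<kappa>: "\<kappa> > 0" by (simp add: \<kappa>_def power_divide)

lemma gauss_dens_\<kappa>: "gauss_dens (z::'a) = \<kappa> * exp (- (z \<bullet> z) / 2)"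
  by (simp add: gauss_dens_eq \<kappa>_def)

text \<open>After the substitution \<open>z = (I + c\<Lambda>) w\<close> the layer is a constant times the Gaussian density restricted
to \<open>q > \<rho>\<^sup>2\<close>, and the Jacobian is at most \<open>exp (c p)\<close>.\<close>

lemma nn_integral_layer:
  "(\<integral>\<^sup>+z. ennreal (\<kappa> * layer j (shrink (Suc j * \<eta>) z)) \<partial>lborel)
     \<le> ennreal (exp \<epsilon> * exp (- 1 / 8) ^ Suc j) * emeasure std_gauss {z. q z > \<rho>\<^sup>2}"
proof -
  define c where "c = Suc j * \<eta>"
  define A where "A = exp (\<epsilon> - c * (\<rho>\<^sup>2 / 2 - 2 * \<epsilon>))"
  have c: "c > 0" using \<eta> by (simp add: c_def)
  note [measurable] = linear_borel_measurable[OF linear_diag[of "\<lambda>b. 1 / (1 + c * l b)"], folded shrink_def]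
  have inv: "shrink c (diag (\<lambda>b. 1 + c * l b) w) = w" for w
    by (rule euclidean_eqI) (use one_plus_pos[of c] c in \<open>simp add: shrink_inner less_imp_neq[symmetric]\<close>)
  have "(\<integral>\<^sup>+z. ennreal (\<kappa> * layer j (shrink c z)) \<partial>lborel)
      = ennreal (\<Prod>b\<in>Basis. 1 + c * l b) * (\<integral>\<^sup>+w. ennreal (\<kappa> * layer j (shrink c (diag (\<lambda>b. 1 + c * l b) w))) \<partial>lborel)"
    using one_plus_pos[of c] c by (intro nn_integral_lborel_diag) simp_all
  also have "\<dots> = ennreal (\<Prod>b\<in>Basis. 1 + c * l b) * (\<integral>\<^sup>+w. ennreal (\<kappa> * layer j w) \<partial>lborel)"
    by (simp only: inv)
  also have "(\<integral>\<^sup>+w. ennreal (\<kappa> * layer j w) \<partial>lborel) = (\<integral>\<^sup>+w. ennreal A * indicator {z. q z > \<rho>\<^sup>2} w \<partial>std_gauss)"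
  proof (subst nn_integral_std_gauss, measurable, rule nn_integral_cong)
    fix w
    have "\<kappa> * layer j w = gauss_dens w * (A * indicator {z. q z > \<rho>\<^sup>2} w)"
      by (simp add: layer_def gauss_dens_\<kappa> A_def c_def exp_add[symmetric] exp_diff[symmetric] mult_ac add_diff_eq split: split_indicator)
    then show "ennreal (\<kappa> * layer j w) = ennreal (gauss_dens w) * (ennreal A * indicator {z. q z > \<rho>\<^sup>2} w)"
      using gauss_dens_pos[of w] by (simp add: ennreal_mult'[symmetric] A_def less_imp_le split: split_indicator)
  qed
  also have "\<dots> = ennreal A * emeasure std_gauss {z. q z > \<rho>\<^sup>2}"
    by (subst nn_integral_cmult_indicator) simp_all
  also have "ennreal (\<Prod>b\<in>Basis. 1 + c * l b) * (ennreal A * emeasure std_gauss {z. q z > \<rho>\<^sup>2})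
      = ennreal ((\<Prod>b\<in>Basis. 1 + c * l b) * A) * emeasure std_gauss {z. q z > \<rho>\<^sup>2}"
  proof -
    have "0 \<le> (\<Prod>b\<in>Basis. 1 + c * l b)"
      using one_plus_pos[of c] c by (intro prod_nonneg) (simp add: less_imp_le)
    then show ?thesis by (subst ennreal_mult) (auto simp: A_def mult.assoc)
  qed
  also have "\<dots> \<le> ennreal (exp \<epsilon> * exp (- 1 / 8) ^ Suc j) * emeasure std_gauss {z. q z > \<rho>\<^sup>2}"
  proof (intro mult_right_mono ennreal_leI)
    have "(\<Prod>b\<in>Basis. 1 + c * l b) \<le> (\<Prod>b\<in>Basis. exp (c * l b))"
      using one_plus_pos[of c] c by (intro prod_mono) (auto simp: less_imp_le)
    also have "\<dots> = exp (c * p)" by (simp add: exp_sum[symmetric] p_def sum_distrib_left)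
    finally have "(\<Prod>b\<in>Basis. 1 + c * l b) * A \<le> exp (c * p) * A" by (intro mult_right_mono) (auto simp: A_def)
    also have "\<dots> = exp (\<epsilon> - Suc j * (\<eta> * (\<rho>\<^sup>2 / 2 - 2 * \<epsilon> - p)))"
      by (simp add: A_def c_def exp_add[symmetric] algebra_simps)
    also have "\<dots> \<le> exp (\<epsilon> - Suc j * (1 / 8))"
      unfolding exp_le_cancel_iff by (intro diff_left_mono mult_left_mono rate) simp
    also have "\<dots> = exp \<epsilon> * exp (- 1 / 8) ^ Suc j"
      by (simp only: exp_of_nat_mult[symmetric] exp_add[symmetric]) simp
    finally show "(\<Prod>b\<in>Basis. 1 + c * l b) * A \<le> exp \<epsilon> * exp (- 1 / 8) ^ Suc j" .
  qed simp
  finally show ?thesis by (simp only: c_def)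
qed

text \<open>The assumption on \<open>r\<close> gives \<open>\<rho> - \<surd>p \<ge> \<surd>x - 1/r\<close>; the square loses at most \<open>2\<close>, which costs a factor \<open>e \<le> 3\<close>.\<close>

lemma gauss_shell: "emeasure std_gauss {z. q z > \<rho>\<^sup>2} \<le> ennreal (3 * exp (- x / 2))"
proof -
  have sx: "1 / r \<le> sqrt x" using r4 x by (simp add: field_simps) (smt (verit) mult_le_cancel_left1 mult_mono real_sqrt_ge_one)
  have sp: "0 \<le> sqrt p" using p0 by simp
  have 1: "sqrt x - 1 / r \<le> \<rho> - sqrt p"
    using \<rho>_ge r sp unfolding p_def[symmetric] by linarith
  then have sq: "sqrt p \<le> \<rho>" using sx by linarith
  have "emeasure std_gauss {z. q z > \<rho>\<^sup>2} \<le> ennreal (exp (- (\<rho> - sqrt p)\<^sup>2 / (2 * 1)))"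
    unfolding q_def using l sq by (intro std_gauss_diag_tail) (auto simp: p_def)
  also have "\<dots> \<le> ennreal (3 * exp (- x / 2))"
  proof (rule ennreal_leI)
    have "(sqrt x - 1 / r)\<^sup>2 \<le> (\<rho> - sqrt p)\<^sup>2" using 1 sx by (intro power_mono) auto
    moreover have "(sqrt x - 1 / r)\<^sup>2 = x - 2 * (sqrt x / r) + (1 / r)\<^sup>2"
      using x by (simp add: power2_diff)
    moreover have "sqrt x / r \<le> 1" using sqrt_x_le r4 by simp
    ultimately have "x - 2 \<le> (\<rho> - sqrt p)\<^sup>2" by (smt (verit) zero_le_power2)
    then have "exp (- (\<rho> - sqrt p)\<^sup>2 / (2 * 1)) \<le> exp (1 + - x / 2)" by simp
    also have "\<dots> \<le> 3 * exp (- x / 2)" unfolding exp_add by (intro mult_right_mono exp_le) simp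
    finally show "exp (- (\<rho> - sqrt p)\<^sup>2 / (2 * 1)) \<le> 3 * exp (- x / 2)" .
  qed
  finally show ?thesis .
qed

lemma gauss_outside: "measure std_gauss (- K) \<le> 72 * exp (- x / 2)"
proof -
  have "\<rho> \<le> r" using \<eta> r4 by (simp add: \<rho>_def pos_divide_le_eq)
  then have "\<rho>\<^sup>2 \<le> r\<^sup>2" using \<rho>0 by (intro power_mono) auto
  then have "emeasure std_gauss (- K) \<le> emeasure std_gauss {z. q z > \<rho>\<^sup>2}"
    by (intro emeasure_mono) (auto simp: K_def)
  also note gauss_shell
  finally have "measure std_gauss (- K) \<le> 3 * exp (- x / 2)"
    by (simp add: std_gauss.emeasure_eq_measure)
  also have "\<dots> \<le> 72 * exp (- x / 2)" by simp
  finally show ?thesis .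
qed

text \<open>The posterior density relative to the standard Gaussian law, up to normalisation.\<close>

definition E :: "'a \<Rightarrow> real" where "E z = indicator V z * exp (H z + z \<bullet> z / 2)"

lemma E_measurable [measurable]: "E \<in> borel_measurable borel"
  unfolding E_def[abs_def] by measurable

lemma E_nonneg: "0 \<le> E z" by (simp add: E_def)

lemma gauss_E: "gauss_dens z * E z = \<kappa> * (indicator V z * exp (H z))"
proof -
  have "exp (- (z \<bullet> z) / 2) * exp (H z + z \<bullet> z / 2) = exp (H z)" by (simp flip: exp_add)
  then show ?thesis by (simp add: E_def gauss_dens_\<kappa>)
qed

text \<open>The constant is \<open>72 = 24 * 3\<close>: the geometric series over the grid is at most \<open>24\<close>, and the shell contributes
the factor \<open>3\<close>.\<close>

lemma posterior_outside: "(\<integral>\<^sup>+z. ennreal (indicator (- K) z * E z) \<partial>std_gauss) \<le> ennreal (72 * exp (- x / 2))"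
proof -
  have m: "(\<lambda>z. shrink (Suc j * \<eta>) z) \<in> borel_measurable borel" for j
    unfolding shrink_def by (rule linear_borel_measurable[OF linear_diag])
  note [measurable] = m
  have "(\<integral>\<^sup>+z. ennreal (indicator (- K) z * E z) \<partial>std_gauss)
      = (\<integral>\<^sup>+z. ennreal \<kappa> * ennreal (indicator (V - K) z * exp (H z)) \<partial>lborel)"
  proof (subst nn_integral_std_gauss, measurable, rule nn_integral_cong)
    fix z
    have "gauss_dens z * (indicator (- K) z * E z) = \<kappa> * (indicator (V - K) z * exp (H z))"
      using gauss_E[of z] by (auto split: split_indicator simp: E_def)
    then show "ennreal (gauss_dens z) * ennreal (indicator (- K) z * E z) = ennreal \<kappa> * ennreal (indicator (V - K) z * exp (H z))"
      using gauss_dens_pos[of z] \<kappa> by (simp add: ennreal_mult'[symmetric] less_imp_le)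
  qed
  also have "\<dots> \<le> (\<integral>\<^sup>+z. ennreal \<kappa> * (\<Sum>j. ennreal (layer j (shrink (Suc j * \<eta>) z))) \<partial>lborel)"
    by (intro nn_integral_mono mult_left_mono outside_le_layers) simp
  also have "\<dots> = (\<integral>\<^sup>+z. (\<Sum>j. ennreal (\<kappa> * layer j (shrink (Suc j * \<eta>) z))) \<partial>lborel)"
    using \<kappa> by (simp add: ennreal_mult' less_imp_le)
  also have "\<dots> = (\<Sum>j. (\<integral>\<^sup>+z. ennreal (\<kappa> * layer j (shrink (Suc j * \<eta>) z)) \<partial>lborel))"
    by (intro nn_integral_suminf) measurable
  also have "\<dots> \<le> (\<Sum>j. ennreal (exp \<epsilon> * exp (- 1 / 8) ^ Suc j) * emeasure std_gauss {z. q z > \<rho>\<^sup>2})"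
    by (intro suminf_le nn_integral_layer) auto
  also have "\<dots> = (\<Sum>j. ennreal (exp \<epsilon> * exp (- 1 / 8) ^ Suc j)) * emeasure std_gauss {z. q z > \<rho>\<^sup>2}"
    by simp
  also have "\<dots> \<le> ennreal 24 * ennreal (3 * exp (- x / 2))"
  proof (intro mult_mono gauss_shell)
    define a :: real where "a = exp (- 1 / 8)"
    have "1 + 1 / 8 \<le> exp (1 / 8 :: real)" by (rule exp_ge_add_one_self)
    then have a: "0 < a" "a \<le> 8 / 9" by (simp_all add: a_def exp_minus field_simps)
    have "(\<lambda>j. a ^ j) sums (1 / (1 - a))" using a by (intro geometric_sums) simp
    then have "(\<lambda>j. (exp \<epsilon> * a) * a ^ j) sums ((exp \<epsilon> * a) * (1 / (1 - a)))" by (rule sums_mult)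
    then have "(\<lambda>j. exp \<epsilon> * a ^ Suc j) sums (exp \<epsilon> * a / (1 - a))" by (simp add: mult_ac)
    then have "(\<Sum>j. ennreal (exp \<epsilon> * a ^ Suc j)) = ennreal (exp \<epsilon> * a / (1 - a))"
      using a by (intro suminf_ennreal_eq) auto
    also have "\<dots> \<le> ennreal 24"
    proof (rule ennreal_leI)
      have "a / (1 - a) \<le> 8" using a by (simp add: field_simps)
      moreover have "exp \<epsilon> \<le> exp 1" using \<epsilon> by simp
      then have "exp \<epsilon> \<le> 3" using exp_le by linarith
      ultimately have "exp \<epsilon> * (a / (1 - a)) \<le> 3 * 8" using a by (intro mult_mono) auto
      then show "exp \<epsilon> * a / (1 - a) \<le> 24" by simp
    qed
    finally show "(\<Sum>j. ennreal (exp \<epsilon> * exp (- 1 / 8) ^ Suc j)) \<le> ennreal 24" by (simp add: a_def)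
  qed auto
  also have "\<dots> = ennreal (72 * exp (- x / 2))" by (subst ennreal_mult[symmetric]) simp_all
  finally show ?thesis .
qed

lemma E_expansion: "z \<in> K \<Longrightarrow> \<bar>E z - 1 - (H z + z \<bullet> z / 2)\<bar> \<le> \<epsilon>\<^sup>2"
proof -
  assume z: "z \<in> K"
  then have a: "\<bar>H z + z \<bullet> z / 2\<bar> \<le> \<epsilon>" and E: "E z = exp (H z + z \<bullet> z / 2)"
    using approx[of z] inV[of z] by (auto simp: K_def q_def E_def)
  have "(H z + z \<bullet> z / 2)\<^sup>2 \<le> \<epsilon>\<^sup>2"
    using power_mono[OF a, of 2] by simp
  moreover have "\<bar>exp (H z + z \<bullet> z / 2) - 1 - (H z + z \<bullet> z / 2)\<bar> \<le> (H z + z \<bullet> z / 2)\<^sup>2"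
    using a \<epsilon> by (intro exp_minus_one_minus_self) linarith
  ultimately show ?thesis unfolding E by linarith
qed

lemma E_near_1: "z \<in> K \<Longrightarrow> \<bar>E z - 1\<bar> \<le> 2 * \<epsilon>"
proof -
  assume z: "z \<in> K"
  have "\<epsilon>\<^sup>2 \<le> \<epsilon>" using \<epsilon> \<epsilon>0 mult_left_mono[of \<epsilon> 1 \<epsilon>] by (simp add: power2_eq_square)
  moreover have "\<bar>H z + z \<bullet> z / 2\<bar> \<le> \<epsilon>" using z approx[of z] by (simp add: K_def q_def)
  ultimately show ?thesis using E_expansion[OF z] by linarith
qed

lemma integrable_E_outside: "integrable std_gauss (\<lambda>z. indicator (- K) z * E z)"
  and integral_E_outside: "(LINT z|std_gauss. indicator (- K) z * E z) \<le> 72 * exp (- x / 2)"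
proof -
  show i: "integrable std_gauss (\<lambda>z. indicator (- K) z * E z)"
    using posterior_outside E_nonneg by (intro integrableI_nonneg) (auto intro: le_less_trans)
  have "ennreal (LINT z|std_gauss. indicator (- K) z * E z) = (\<integral>\<^sup>+z. ennreal (indicator (- K) z * E z) \<partial>std_gauss)"
    using i E_nonneg by (intro nn_integral_eq_integral[symmetric]) auto
  also note posterior_outside
  finally show "(LINT z|std_gauss. indicator (- K) z * E z) \<le> 72 * exp (- x / 2)"
    by (simp add: ennreal_le_iff)
qed

lemma integrable_E_inside:
  assumes [measurable]: "B \<in> sets borel"
  shows "integrable std_gauss (\<lambda>z. indicator (B \<inter> K) z * (E z - 1))"
  using E_near_1 \<epsilon>0 by (intro integrable_bounded_gauss[where c = "2 * \<epsilon>"]) (auto split: split_indicator)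

lemma integrable_E_set:
  assumes [measurable]: "B \<in> sets borel"
  shows "integrable std_gauss (\<lambda>z. indicator B z * E z)"
proof -
  have "integrable std_gauss (\<lambda>z. indicator (B \<inter> K) z * (E z - 1) + indicator (B \<inter> K) z + indicator B z * (indicator (- K) z * E z))"
    by (intro Bochner_Integration.integrable_add integrable_E_inside integrable_indicator_gauss
          integrable_real_mult_indicator[of B std_gauss "\<lambda>z. indicator (- K) z * E z", simplified mult.commute[of _ "indicator B _"]] integrable_E_outside)
       simp_all
  then show ?thesis by (rule Bochner_Integration.integrable_cong[THEN iffD1, rotated 2]) (auto split: split_indicator)
qed

text \<open>Outside \<open>K\<close> the posterior mass and the Gaussian mass are nonnegative numbers below the same bound, so
their difference is below it as well.\<close>

lemma mass_error:
  assumes [measurable]: "B \<in> sets borel"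
  shows "\<bar>(LINT z|std_gauss. indicator B z * E z) - measure std_gauss B\<bar>
    \<le> \<bar>LINT z|std_gauss. indicator (B \<inter> K) z * (E z - 1)\<bar> + 72 * exp (- x / 2)"
proof -
  have iB: "integrable std_gauss (\<lambda>z. indicator (B - K) z * E z)"
    by (rule integrable_E_set) simp
  have "(LINT z|std_gauss. indicator B z * E z) - (LINT z|std_gauss. indicator B z)
      = (LINT z|std_gauss. indicator B z * E z - indicator B z)"
    by (intro Bochner_Integration.integral_diff[symmetric] integrable_E_set integrable_indicator_gauss) simp_all
  also have "\<dots> = (LINT z|std_gauss. indicator (B \<inter> K) z * (E z - 1) + (indicator (B - K) z * E z - indicator (B - K) z))"
    by (intro Bochner_Integration.integral_cong) (auto split: split_indicator)
  also have "\<dots> = (LINT z|std_gauss. indicator (B \<inter> K) z * (E z - 1))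
      + ((LINT z|std_gauss. indicator (B - K) z * E z) - (LINT z|std_gauss. indicator (B - K) z))"
    by (subst Bochner_Integration.integral_add Bochner_Integration.integral_diff;
        (intro Bochner_Integration.integrable_diff integrable_E_inside iB integrable_indicator_gauss)?; simp)+
  finally have eq: "(LINT z|std_gauss. indicator B z * E z) - measure std_gauss B
     = (LINT z|std_gauss. indicator (B \<inter> K) z * (E z - 1))
      + ((LINT z|std_gauss. indicator (B - K) z * E z) - measure std_gauss (B - K))"
    by simp
  have "(LINT z|std_gauss. indicator (B - K) z * E z) \<le> (LINT z|std_gauss. indicator (- K) z * E z)"
    using E_nonneg by (intro Bochner_Integration.integral_mono iB integrable_E_outside) (auto split: split_indicator)
  moreover have "0 \<le> (LINT z|std_gauss. indicator (B - K) z * E z)"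
    using E_nonneg by (intro integral_nonneg_AE) auto
  moreover have "measure std_gauss (B - K) \<le> measure std_gauss (- K)"
    by (intro std_gauss.finite_measure_mono) auto
  ultimately have "\<bar>(LINT z|std_gauss. indicator (B - K) z * E z) - measure std_gauss (B - K)\<bar> \<le> 72 * exp (- x / 2)"
    using gauss_outside integral_E_outside measure_nonneg[of std_gauss "B - K"] by linarith
  then show ?thesis unfolding eq by linarith
qed

lemma inside_error:
  assumes [measurable]: "B \<in> sets borel"
  shows "\<bar>LINT z|std_gauss. indicator (B \<inter> K) z * (E z - 1)\<bar> \<le> 2 * \<epsilon>"
  using E_near_1 \<epsilon>0 by (intro integrable_bounded_gauss(2)) (auto split: split_indicator)

lemma q_minus: "q (- z) = q z" by (simp add: q_eq)

text \<open>Reflection invariance of the Gaussian law allows averaging the integrand over \<open>z\<close> and \<open>- z\<close>, which removes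
the odd part of the remainder; its square survives as \<open>\<epsilon>\<^sup>2\<close>.\<close>

lemma inside_error_symmetric:
  assumes [measurable]: "B \<in> sets borel" and sym: "\<And>z. - z \<in> B \<longleftrightarrow> z \<in> B"
    and s: "\<And>z. z \<in> K \<Longrightarrow> \<bar>H z + H (- z) + z \<bullet> z\<bar> \<le> s"
  shows "\<bar>LINT z|std_gauss. indicator (B \<inter> K) z * (E z - 1)\<bar> \<le> s / 2 + \<epsilon>\<^sup>2"
proof -
  define f where "f z = indicator (B \<inter> K) z * (E z - 1)" for z
  have [measurable]: "f \<in> borel_measurable borel" unfolding f_def[abs_def] by measurable
  have fi: "integrable std_gauss f" unfolding f_def[abs_def] by (rule integrable_E_inside) simp
  have neg: "orthogonal_transformation (uminus :: 'a \<Rightarrow> 'a)"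
    by (simp add: orthogonal_transformation_def linear_iff)
  have "(LINT z|std_gauss. f z) = (LINT z|distr std_gauss borel uminus. f z)"
    by (simp add: distr_std_gauss_orthogonal[OF neg])
  also have "\<dots> = (LINT z|std_gauss. f (- z))"
    by (rule integral_distr) measurable
  finally have flip: "(LINT z|std_gauss. f z) = (LINT z|std_gauss. f (- z))" .
  have fi': "integrable std_gauss (\<lambda>z. f (- z))"
    using fi integrable_distr_eq[of uminus std_gauss borel f] by (simp add: distr_std_gauss_orthogonal[OF neg])
  have 0: "0 \<le> s" using s[of 0] by (simp add: K_def q_eq) 
  have "2 * (LINT z|std_gauss. f z) = (LINT z|std_gauss. f z + f (- z))"
    using flip fi fi' by simp
  moreover have "\<bar>LINT z|std_gauss. f z + f (- z)\<bar> \<le> s + 2 * \<epsilon>\<^sup>2"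
  proof (rule integrable_bounded_gauss(2))
    fix z
    show "\<bar>f z + f (- z)\<bar> \<le> s + 2 * \<epsilon>\<^sup>2"
    proof (cases "z \<in> B \<inter> K")
      case True
      then have "- z \<in> B \<inter> K" using sym by (simp add: K_def q_minus)
      then show ?thesis
        using True s[of z] E_expansion[of z] E_expansion[of "- z"] by (simp add: f_def)
    next
      case False
      then have "- z \<notin> B \<inter> K" using sym by (simp add: K_def q_minus)
      then show ?thesis using False 0 by (simp add: f_def)
    qed
  qed measurable
  ultimately show ?thesis unfolding f_def[symmetric] by linarith
qed

definition post :: "'a set \<Rightarrow> real" where
  "post B = (LINT z|std_gauss. indicator B z * E z) / (LINT z|std_gauss. E z)"

text \<open>For \<open>t > 1/2\<close> the bound is trivial; otherwise the normalising constant is at least \<open>1/2\<close>.\<close>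

lemma ratio_error:
  assumes B [measurable]: "B \<in> sets borel"
    and t: "\<bar>(LINT z|std_gauss. indicator B z * E z) - measure std_gauss B\<bar> \<le> t"
      "\<bar>(LINT z|std_gauss. E z) - 1\<bar> \<le> t"
  shows "\<bar>post B - measure std_gauss B\<bar> \<le> 4 * t"
proof -
  define I Z g where "I = (LINT z|std_gauss. indicator B z * E z)" and "Z = (LINT z|std_gauss. E z)" and "g = measure std_gauss B"
  have g: "0 \<le> g" "g \<le> 1" by (simp_all add: g_def)
  have I: "0 \<le> I" unfolding I_def using E_nonneg by (intro integral_nonneg_AE) auto
  have IZ: "I \<le> Z" unfolding I_def Z_def
    using E_nonneg integrable_E_set[of UNIV] integrable_E_set[OF B]
    by (intro Bochner_Integration.integral_mono) (auto split: split_indicator)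
  show ?thesis
  proof (cases "t \<le> 1 / 2")
    case True
    then have Z: "1 / 2 \<le> Z" using t(2) by (simp add: Z_def)
    have "I / Z - g = ((I - g) - g * (Z - 1)) / Z" using Z by (simp add: field_simps)
    moreover have "\<bar>(I - g) - g * (Z - 1)\<bar> \<le> 2 * t"
    proof -
      have "\<bar>g * (Z - 1)\<bar> \<le> 1 * t"
        unfolding abs_mult using g t(2) by (intro mult_mono) (auto simp: Z_def)
      then show ?thesis using t(1) by (simp add: I_def g_def)
    qed
    ultimately have "\<bar>I / Z - g\<bar> \<le> 2 * t / Z"
      using Z by (simp add: divide_right_mono)
    also have "\<dots> \<le> 2 * t / (1 / 2)" using Z t by (intro divide_left_mono) auto
    finally show ?thesis by (simp add: post_def I_def Z_def g_def)
  next
    case False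
    have "0 \<le> I / Z" "I / Z \<le> 1" using I IZ by (auto simp: divide_le_eq_1)
    then have "\<bar>I / Z - g\<bar> \<le> 1" using g by linarith
    then show ?thesis using False by (simp add: post_def I_def Z_def g_def)
  qed
qed

theorem post_error:
  assumes "B \<in> sets borel"
  shows "\<bar>post B - measure std_gauss B\<bar> \<le> 4 * (2 * \<epsilon> + 72 * exp (- x / 2))"
  using mass_error[OF assms] inside_error[OF assms] mass_error[of UNIV] inside_error[of UNIV]
    std_gauss.prob_space[where 'a='a]
  by (intro ratio_error assms) auto

theorem post_error_symmetric:
  assumes B: "B \<in> sets borel" "\<And>z. - z \<in> B \<longleftrightarrow> z \<in> B"
    and s: "\<And>z. z \<in> K \<Longrightarrow> \<bar>H z + H (- z) + z \<bullet> z\<bar> \<le> s"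
  shows "\<bar>post B - measure std_gauss B\<bar> \<le> 4 * (s / 2 + \<epsilon>\<^sup>2 + 72 * exp (- x / 2))"
  using mass_error[OF B(1)] inside_error_symmetric[OF B s] mass_error[of UNIV] inside_error_symmetric[of UNIV s]
    std_gauss.prob_space[where 'a='a] s
  by (intro ratio_error B(1)) auto

end

section \<open>Directional derivatives of smooth functions\<close>

lemma C_k_Suc_imp: "C_k (Suc k) f \<Longrightarrow> C_k k f"
proof (induction k arbitrary: f)
  case 0
  then show ?case
    by (auto simp: continuous_on_eq_continuous_at intro!: differentiable_imp_continuous_within)
next
  case (Suc k)
  then show ?case by (metis C_k.simps(2))
qed

lemma C_k_const: "C_k k (\<lambda>x::'a::euclidean_space. c::'b::euclidean_space)"
  by (induction k arbitrary: c) (simp_all add: continuous_on_const)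

lemma frechet_derivative_eqI: "(f has_derivative f') (at x) \<Longrightarrow> frechet_derivative f (at x) = f'"
  by (rule frechet_derivative_at[symmetric])

lemma C_k_linear:
  fixes f :: "'a::euclidean_space \<Rightarrow> 'b::euclidean_space"
  assumes "linear f" shows "C_k k f"
proof -
  have d: "(f has_derivative f) (at x)" for x
    using assms by (simp add: linear_conv_bounded_linear bounded_linear_imp_has_derivative)
  show ?thesis
  proof (cases k)
    case 0
    then show ?thesis
      using assms by (simp add: linear_continuous_on linear_conv_bounded_linear)
  next
    case (Suc j)
    then show ?thesis
      using d by (auto simp: C_k_const frechet_derivative_eqI[OF d] intro: differentiableI)
  qed
qed

lemma C_k_add:
  fixes f g :: "'a::euclidean_space \<Rightarrow> 'b::euclidean_space"
  shows "C_k k f \<Longrightarrow> C_k k g \<Longrightarrow> C_k k (\<lambda>x. f x + g x)"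
proof (induction k arbitrary: f g)
  case 0 then show ?case by (simp add: continuous_on_add)
next
  case (Suc k)
  have d: "((\<lambda>x. f x + g x) has_derivative (\<lambda>v. frechet_derivative f (at x) v + frechet_derivative g (at x) v)) (at x)" for x
    using Suc.prems by (intro has_derivative_add) (simp_all add: frechet_derivative_works[symmetric])
  show ?case
    using Suc by (auto simp: frechet_derivative_eqI[OF d] intro: differentiableI[OF d])
qed

lemma C_k_inner:
  fixes f g :: "'a::euclidean_space \<Rightarrow> 'b::euclidean_space"
  shows "C_k k f \<Longrightarrow> C_k k g \<Longrightarrow> C_k k (\<lambda>x. f x \<bullet> g x)"
proof (induction k arbitrary: f g)
  case 0 then show ?case by (simp add: continuous_on_inner)
next
  case (Suc k)
  have d: "((\<lambda>x. f x \<bullet> g x) has_derivative (\<lambda>v. f x \<bullet> frechet_derivative g (at x) v + frechet_derivative f (at x) v \<bullet> g x)) (at x)" for x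
    using Suc.prems by (intro has_derivative_inner) (simp_all add: frechet_derivative_works[symmetric])
  have "C_k k f" "C_k k g" using Suc.prems C_k_Suc_imp by blast+
  then show ?case
    using Suc by (auto simp: frechet_derivative_eqI[OF d] intro: differentiableI[OF d] C_k_add)
qed

lemma C_k_linear_image:
  fixes f :: "'a::euclidean_space \<Rightarrow> 'b::euclidean_space" and T :: "'b \<Rightarrow> 'c::euclidean_space"
  assumes T: "linear T"
  shows "C_k k f \<Longrightarrow> C_k k (\<lambda>x. T (f x))"
proof (induction k arbitrary: f)
  case 0
  then show ?case using T by (simp add: linear_conv_bounded_linear bounded_linear.continuous_on)
next
  case (Suc k)
  have d: "((\<lambda>x. T (f x)) has_derivative (\<lambda>v. T (frechet_derivative f (at x) v))) (at x)" for x
    using Suc.prems T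
    by (intro bounded_linear.has_derivative[of T f]) (simp_all add: frechet_derivative_works[symmetric] linear_conv_bounded_linear)
  show ?case
    using Suc by (auto simp: frechet_derivative_eqI[OF d] intro: differentiableI[OF d])
qed

lemma C_k_compose_linear:
  fixes f :: "'a::euclidean_space \<Rightarrow> 'b::euclidean_space" and h :: "'c::euclidean_space \<Rightarrow> 'a"
  assumes h: "linear h"
  shows "C_k k f \<Longrightarrow> C_k k (\<lambda>x. f (h x))"
proof (induction k arbitrary: f)
  case 0
  have "continuous_on UNIV h" using h by (simp add: linear_continuous_on linear_conv_bounded_linear)
  then show ?case using 0 by (auto intro: continuous_on_compose2[of UNIV f])
next
  case (Suc k)
  have d: "((\<lambda>x. f (h x)) has_derivative (\<lambda>v. frechet_derivative f (at (h x)) (h v))) (at x)" for x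
    using Suc.prems h
    by (intro has_derivative_compose[of h h x UNIV f])
       (simp_all add: frechet_derivative_works[symmetric] linear_conv_bounded_linear bounded_linear_imp_has_derivative)
  show ?case
    using Suc by (auto simp: frechet_derivative_eqI[OF d] intro: differentiableI[OF d])
qed

lemma smooth_const: "smooth (\<lambda>x. c)"
  and smooth_linear: "linear f \<Longrightarrow> smooth f"
  and smooth_add: "smooth f \<Longrightarrow> smooth g \<Longrightarrow> smooth (\<lambda>x. f x + g x)"
  and smooth_inner: "smooth f \<Longrightarrow> smooth g \<Longrightarrow> smooth (\<lambda>x. f x \<bullet> g x)"
  and smooth_compose_linear: "linear h \<Longrightarrow> smooth f \<Longrightarrow> smooth (\<lambda>x. f (h x))"
  by (simp_all add: smooth_def C_k_const C_k_linear C_k_add C_k_inner C_k_compose_linear)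

lemma smooth_linear_image:
  assumes "linear T" "smooth f" shows "smooth (\<lambda>x. T (f x))"
  using C_k_linear_image[OF assms(1), of _ f] assms(2) by (simp add: smooth_def)

lemma smooth_scaleR: "smooth f \<Longrightarrow> smooth (\<lambda>x. c *\<^sub>R f x)"
  by (rule smooth_linear_image[of "\<lambda>y. c *\<^sub>R y"]) (simp_all add: linear_iff scaleR_add_right)

lemma smooth_diff: "smooth f \<Longrightarrow> smooth g \<Longrightarrow> smooth (\<lambda>x. f x - g x)"
  using smooth_add[of f "\<lambda>x. (-1) *\<^sub>R g x"] smooth_scaleR[of g "-1"] by simp

lemma smooth_cmult: "smooth f \<Longrightarrow> smooth (\<lambda>x. c * f x :: real)"
  using smooth_scaleR[of f c] by simp

lemma smooth_norm_square: "smooth f \<Longrightarrow> smooth (\<lambda>x. (norm (f x))\<^sup>2)"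
  using smooth_inner[of f f] by (simp add: power2_norm_eq_inner)

lemma smooth_continuous: "smooth f \<Longrightarrow> continuous_on UNIV f"
  unfolding smooth_def by (metis C_k.simps(1))

text \<open>The directional derivative as an operator on functions, so that its iterates express \<open>dir_deriv\<close>.\<close>

definition ddir :: "'a \<Rightarrow> ('a::euclidean_space \<Rightarrow> 'b::euclidean_space) \<Rightarrow> 'a \<Rightarrow> 'b" where
  "ddir u f = (\<lambda>x. frechet_derivative f (at x) u)"

lemma smooth_ddir: "smooth f \<Longrightarrow> smooth (ddir u f)"
  unfolding smooth_def ddir_def by (metis C_k.simps(2))

lemma smooth_ddir_iterate: "smooth f \<Longrightarrow> smooth ((ddir u ^^ k) f)"
  by (induction k) (auto intro: smooth_ddir)

lemma smooth_has_derivative: "smooth f \<Longrightarrow> (f has_derivative (\<lambda>u. ddir u f x)) (at x)"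
  unfolding smooth_def ddir_def
  by (metis C_k.simps(2) frechet_derivative_works)

lemma ddir_eqI:
  assumes "\<And>x. (f has_derivative (\<lambda>u. f' u x)) (at x)"
  shows "ddir u f = f' u"
  using frechet_derivative_eqI[OF assms] by (auto simp: ddir_def)

lemma ddir_add:
  assumes "smooth f" "smooth g" shows "ddir u (\<lambda>x. f x + g x) = (\<lambda>x. ddir u f x + ddir u g x)"
  by (rule ddir_eqI) (intro has_derivative_add smooth_has_derivative assms)

lemma ddir_diff:
  assumes "smooth f" "smooth g" shows "ddir u (\<lambda>x. f x - g x) = (\<lambda>x. ddir u f x - ddir u g x)"
  by (rule ddir_eqI) (intro has_derivative_diff smooth_has_derivative assms)

lemma ddir_scaleR:
  assumes "smooth f" shows "ddir u (\<lambda>x. c *\<^sub>R f x) = (\<lambda>x. c *\<^sub>R ddir u f x)"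
  by (rule ddir_eqI) (intro has_derivative_scaleR_right smooth_has_derivative assms)

lemma ddir_const: "ddir u (\<lambda>x. c) = (\<lambda>x. 0)"
  by (rule ddir_eqI) simp

lemma ddir_linear: "linear f \<Longrightarrow> ddir u f = (\<lambda>x. f u)"
  by (rule ddir_eqI) (simp add: linear_conv_bounded_linear bounded_linear_imp_has_derivative)

lemma ddir_inner:
  assumes "smooth f" "smooth g"
  shows "ddir u (\<lambda>x. f x \<bullet> g x) = (\<lambda>x. f x \<bullet> ddir u g x + ddir u f x \<bullet> g x)"
  by (rule ddir_eqI) (intro has_derivative_inner smooth_has_derivative assms)

lemma linear_ddir: "smooth f \<Longrightarrow> linear (\<lambda>u. ddir u f x)"
  using has_derivative_linear[OF smooth_has_derivative] .

lemma ddir_scale_iterate: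
  assumes "smooth f"
  shows "(ddir (s *\<^sub>R u) ^^ k) f = (\<lambda>x. s ^ k *\<^sub>R (ddir u ^^ k) f x)"
proof (induction k)
  case (Suc k)
  have "ddir (s *\<^sub>R u) g = (\<lambda>x. s *\<^sub>R ddir u g x)" if "smooth g" for g :: "'a \<Rightarrow> 'b"
    using linear_scale[OF linear_ddir[OF that]] by auto
  from this[OF smooth_ddir_iterate[OF assms]] show ?case
    by (simp add: Suc ddir_scaleR[OF smooth_ddir_iterate[OF assms]]
        ddir_scaleR[OF smooth_ddir_iterate[OF assms], of "s *\<^sub>R u"] mult_ac)
qed simp

lemma smooth_along_line:
  assumes "smooth f"
  shows "((\<lambda>t. f (x + t *\<^sub>R u)) has_vector_derivative ddir u f (x + t *\<^sub>R u)) (at t)"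
proof -
  have "((\<lambda>t. x + t *\<^sub>R u) has_derivative (\<lambda>h. h *\<^sub>R u)) (at t)"
    by (auto intro!: derivative_eq_intros)
  from has_derivative_compose[OF this smooth_has_derivative[OF assms]]
  show ?thesis
    by (simp add: has_vector_derivative_def linear_scale[OF linear_ddir[OF assms]])
qed

lemma smooth_along_line_real:
  fixes f :: "'a::euclidean_space \<Rightarrow> real"
  assumes "smooth f"
  shows "((\<lambda>t. f (x + t *\<^sub>R u)) has_real_derivative ddir u f (x + t *\<^sub>R u)) (at t)"
  using smooth_along_line[OF assms] by (simp add: has_real_derivative_iff_has_vector_derivative)

lemma curve_deriv_smooth:
  assumes "smooth f"
  shows "curve_deriv k (\<lambda>t. f (x + t *\<^sub>R u)) = (\<lambda>t. (ddir u ^^ k) f (x + t *\<^sub>R u))"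
proof (induction k)
  case 0 then show ?case by (simp add: curve_deriv_def)
next
  case (Suc k)
  have "curve_deriv (Suc k) (\<lambda>t. f (x + t *\<^sub>R u))
      = (\<lambda>t. vector_derivative (curve_deriv k (\<lambda>t. f (x + t *\<^sub>R u))) (at t))"
    by (simp add: curve_deriv_def)
  also have "\<dots> = (\<lambda>t. (ddir u ^^ Suc k) f (x + t *\<^sub>R u))"
    unfolding Suc by (rule ext) (use smooth_along_line[OF smooth_ddir_iterate[OF assms]] in \<open>simp add: vector_derivative_at\<close>)
  finally show ?case .
qed

lemma dir_deriv_smooth: "smooth f \<Longrightarrow> dir_deriv k f x u = (ddir u ^^ k) f x"
  by (simp add: dir_deriv_def curve_deriv_smooth)

lemma ddir_coordinates:
  fixes f :: "'a::euclidean_space \<Rightarrow> real"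
  assumes f: "smooth f"
  shows "ddir v f x = (\<Sum>b\<in>Basis. (v \<bullet> b) * ddir b f x)"
proof -
  have "ddir (\<Sum>b\<in>Basis. (v \<bullet> b) *\<^sub>R b) f x = (\<Sum>b\<in>Basis. ddir ((v \<bullet> b) *\<^sub>R b) f x)"
    by (rule linear_sum[OF linear_ddir[OF f]])
  also have "\<dots> = (\<Sum>b\<in>Basis. (v \<bullet> b) * ddir b f x)"
    using linear_scale[OF linear_ddir[OF f]] by simp
  finally show ?thesis by (simp add: euclidean_representation)
qed

lemma smooth_gradient:
  fixes f :: "'a::euclidean_space \<Rightarrow> real"
  assumes f: "smooth f"
  shows "gradient f = (\<lambda>x. \<Sum>b\<in>Basis. ddir b f x *\<^sub>R b)"
proof
  fix x
  define g where "g = (\<Sum>b\<in>Basis. ddir b f x *\<^sub>R b)"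
  have g: "h \<bullet> g = ddir h f x" for h
    by (simp add: ddir_coordinates[OF f, of h] g_def inner_sum_right mult.commute)
  have "GDERIV f x :> D \<longleftrightarrow> D = g" for D
  proof
    assume "GDERIV f x :> D"
    then have "(\<lambda>h. h \<bullet> D) = (\<lambda>h. ddir h f x)"
      unfolding gderiv_def using has_derivative_unique smooth_has_derivative[OF f] by blast
    then have "h \<bullet> D = h \<bullet> g" for h using g by metis
    then show "D = g" by (metis vector_eq_ldot)
  qed (use smooth_has_derivative[OF f, of x] in \<open>simp add: gderiv_def g\<close>)
  then show "gradient f x = (\<Sum>b\<in>Basis. ddir b f x *\<^sub>R b)"
    by (simp add: gradient_def g_def)
qed

lemma gradient_inner:
  fixes f :: "'a::euclidean_space \<Rightarrow> real"
  assumes f: "smooth f"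
  shows "gradient f x \<bullet> v = ddir v f x"
  by (simp add: smooth_gradient[OF f] ddir_coordinates[OF f, of v] inner_sum_left mult.commute inner_commute[of v])

lemma smooth_sum: "finite I \<Longrightarrow> (\<And>i. i \<in> I \<Longrightarrow> smooth (f i)) \<Longrightarrow> smooth (\<lambda>x. \<Sum>i\<in>I. f i x)"
  by (induction I rule: finite_induct) (auto intro: smooth_const smooth_add)

lemma
  fixes f :: "'a::euclidean_space \<Rightarrow> real"
  assumes f: "smooth f"
  shows hessian_inner: "hessian f x u \<bullet> v = ddir u (ddir v f) x"
    and linear_hessian: "linear (hessian f x)"
proof -
  have "smooth (\<lambda>x. ddir b f x *\<^sub>R b)" for b
    by (rule smooth_linear_image[of "\<lambda>t. t *\<^sub>R b"]) (simp_all add: linear_iff scaleR_add_left smooth_ddir f)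
  then have sg: "smooth (gradient f)" unfolding smooth_gradient[OF f] by (intro smooth_sum) auto
  have h: "hessian f x = (\<lambda>u. ddir u (gradient f) x)" by (simp add: hessian_def ddir_def)
  show "linear (hessian f x)" unfolding h by (rule linear_ddir[OF sg])
  have "ddir u (\<lambda>x. gradient f x \<bullet> v) x = ddir u (gradient f) x \<bullet> v"
    by (simp add: ddir_inner[OF sg smooth_const] ddir_const)
  then show "hessian f x u \<bullet> v = ddir u (ddir v f) x"
    by (simp add: h gradient_inner[OF f])
qed

text \<open>The mean value theorem is applied first along \<open>u\<close> and then along \<open>v\<close>.\<close>

lemma second_difference:
  fixes f :: "'a::euclidean_space \<Rightarrow> real"
  assumes f: "smooth f" and s: "0 < s"
  shows "\<exists>a b. 0 < a \<and> a < s \<and> 0 < b \<and> b < s \<and>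
    f (x + s *\<^sub>R u + s *\<^sub>R v) - f (x + s *\<^sub>R u) - f (x + s *\<^sub>R v) + f x
      = s * s * ddir v (ddir u f) (x + a *\<^sub>R u + b *\<^sub>R v)"
proof -
  define g where "g t = f ((x + s *\<^sub>R v) + t *\<^sub>R u) - f (x + t *\<^sub>R u)" for t
  have "(g has_real_derivative (ddir u f ((x + s *\<^sub>R v) + t *\<^sub>R u) - ddir u f (x + t *\<^sub>R u))) (at t)" for t
    unfolding g_def by (intro DERIV_diff smooth_along_line_real f)
  from MVT2[OF s this] obtain a where a: "0 < a" "a < s"
    "g s - g 0 = (s - 0) * (ddir u f ((x + s *\<^sub>R v) + a *\<^sub>R u) - ddir u f (x + a *\<^sub>R u))"
    by auto
  have "((\<lambda>t. ddir u f ((x + a *\<^sub>R u) + t *\<^sub>R v)) has_real_derivative ddir v (ddir u f) ((x + a *\<^sub>R u) + t *\<^sub>R v)) (at t)" for t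
    by (intro smooth_along_line_real smooth_ddir f)
  from MVT2[OF s this] obtain b where b: "0 < b" "b < s"
    "ddir u f ((x + a *\<^sub>R u) + s *\<^sub>R v) - ddir u f ((x + a *\<^sub>R u) + 0 *\<^sub>R v)
      = (s - 0) * ddir v (ddir u f) ((x + a *\<^sub>R u) + b *\<^sub>R v)"
    by auto
  have "ddir u f ((x + s *\<^sub>R v) + a *\<^sub>R u) - ddir u f (x + a *\<^sub>R u)
      = s * ddir v (ddir u f) (x + a *\<^sub>R u + b *\<^sub>R v)"
    using b(3) by (simp add: add_ac)
  then have "g s - g 0 = s * (s * ddir v (ddir u f) (x + a *\<^sub>R u + b *\<^sub>R v))"
    using a(3) by simp
  moreover have "g s - g 0 = f (x + s *\<^sub>R u + s *\<^sub>R v) - f (x + s *\<^sub>R u) - f (x + s *\<^sub>R v) + f x"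
    by (simp add: g_def add_ac)
  ultimately show ?thesis using a b by (intro exI[of _ a] exI[of _ b]) simp
qed

text \<open>The second difference over a parallelogram is symmetric in its two sides, so both mixed derivatives are
limits of the same quotients.\<close>

lemma ddir_commute:
  fixes f :: "'a::euclidean_space \<Rightarrow> real"
  assumes f: "smooth f"
  shows "ddir u (ddir v f) x = ddir v (ddir u f) x"
proof -
  define s where "s n = 1 / real (Suc n)" for n
  have s: "0 < s n" for n by (simp add: s_def)
  have s0: "s \<longlonglongrightarrow> 0" unfolding s_def by (rule LIMSEQ_inverse_real_of_nat[unfolded inverse_eq_divide])
  have "\<exists>a b a' b'. 0 < a \<and> a < s n \<and> 0 < b \<and> b < s n \<and> 0 < a' \<and> a' < s n \<and> 0 < b' \<and> b' < s n \<and>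
      ddir v (ddir u f) (x + a *\<^sub>R u + b *\<^sub>R v) = ddir u (ddir v f) (x + a' *\<^sub>R v + b' *\<^sub>R u)" for n
  proof -
    obtain a b where ab: "0 < a" "a < s n" "0 < b" "b < s n"
      "f (x + s n *\<^sub>R u + s n *\<^sub>R v) - f (x + s n *\<^sub>R u) - f (x + s n *\<^sub>R v) + f x
        = s n * s n * ddir v (ddir u f) (x + a *\<^sub>R u + b *\<^sub>R v)"
      using second_difference[OF f s[of n], of x u v] by blast
    obtain a' b' where ab': "0 < a'" "a' < s n" "0 < b'" "b' < s n"
      "f (x + s n *\<^sub>R v + s n *\<^sub>R u) - f (x + s n *\<^sub>R v) - f (x + s n *\<^sub>R u) + f x
        = s n * s n * ddir u (ddir v f) (x + a' *\<^sub>R v + b' *\<^sub>R u)"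
      using second_difference[OF f s[of n], of x v u] by blast
    have swap: "x + s n *\<^sub>R v + s n *\<^sub>R u = x + s n *\<^sub>R u + s n *\<^sub>R v" by (simp add: add_ac)
    have "s n * s n * ddir v (ddir u f) (x + a *\<^sub>R u + b *\<^sub>R v) = s n * s n * ddir u (ddir v f) (x + a' *\<^sub>R v + b' *\<^sub>R u)"
      using ab(5) ab'(5)[unfolded swap] by linarith
    then have "ddir v (ddir u f) (x + a *\<^sub>R u + b *\<^sub>R v) = ddir u (ddir v f) (x + a' *\<^sub>R v + b' *\<^sub>R u)"
      using s[of n] by simp
    then show ?thesis using ab ab' by blast
  qed
  then obtain a b a' b' where ab: "\<And>n. 0 < a n \<and> a n < s n \<and> 0 < b n \<and> b n < s n \<and> 0 < a' n \<and> a' n < s n \<and> 0 < b' n \<and> b' n < s n \<and>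
      ddir v (ddir u f) (x + a n *\<^sub>R u + b n *\<^sub>R v) = ddir u (ddir v f) (x + a' n *\<^sub>R v + b' n *\<^sub>R u)"
    by metis
  have lim: "c \<longlonglongrightarrow> 0" if "\<And>n. 0 < c n \<and> c n < s n" for c :: "nat \<Rightarrow> real"
    using that by (intro tendsto_sandwich[OF _ _ tendsto_const s0]) (auto intro!: always_eventually less_imp_le)
  have pt: "(\<lambda>n. x + c n *\<^sub>R w + d n *\<^sub>R w') \<longlonglongrightarrow> x" if "c \<longlonglongrightarrow> 0" "d \<longlonglongrightarrow> 0" for c d :: "nat \<Rightarrow> real" and w w'
    using tendsto_add[OF tendsto_add[OF tendsto_const[of x] tendsto_scaleR[OF that(1) tendsto_const[of w]]] tendsto_scaleR[OF that(2) tendsto_const[of w']]]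
    by simp
  have cont: "isCont (ddir w (ddir w' f)) x" for w w'
    using smooth_continuous[OF smooth_ddir[OF smooth_ddir[OF f]]] by (simp add: continuous_on_eq_continuous_at)
  have "(\<lambda>n. ddir v (ddir u f) (x + a n *\<^sub>R u + b n *\<^sub>R v)) \<longlonglongrightarrow> ddir v (ddir u f) x"
    using ab by (intro isCont_tendsto_compose[OF cont] pt lim) auto
  moreover have "(\<lambda>n. ddir v (ddir u f) (x + a n *\<^sub>R u + b n *\<^sub>R v)) \<longlonglongrightarrow> ddir u (ddir v f) x"
  proof -
    have "(\<lambda>n. ddir u (ddir v f) (x + a' n *\<^sub>R v + b' n *\<^sub>R u)) \<longlonglongrightarrow> ddir u (ddir v f) x"
      using ab by (intro isCont_tendsto_compose[OF cont] pt lim) auto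
    then show ?thesis using ab by simp
  qed
  ultimately show ?thesis by (rule LIMSEQ_unique[symmetric])
qed

lemma ddir_affine:
  assumes "linear T" shows "ddir u (\<lambda>x. T x - c) = (\<lambda>x. T u)"
  using ddir_diff[OF smooth_linear[OF assms] smooth_const] by (simp add: ddir_linear assms ddir_const)

lemma smooth_affine: "linear T \<Longrightarrow> smooth (\<lambda>x. T x - c)"
  by (intro smooth_diff smooth_linear smooth_const)

lemma ddir_affine_norm_square:
  fixes T :: "'a::euclidean_space \<Rightarrow> 'b::euclidean_space"
  assumes "linear T"
  shows "ddir u (\<lambda>x. a * (norm (T x - c))\<^sup>2) = (\<lambda>x. (2 * a) * ((T x - c) \<bullet> T u))"
proof -
  have "ddir u (\<lambda>x. a *\<^sub>R ((T x - c) \<bullet> (T x - c))) = (\<lambda>x. (2 * a) * ((T x - c) \<bullet> T u))"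
    by (subst ddir_scaleR, intro smooth_inner smooth_affine assms)
       (simp add: ddir_inner smooth_affine assms ddir_affine inner_commute mult_ac)
  then show ?thesis by (simp add: power2_norm_eq_inner)
qed

lemma ddir_affine_inner:
  fixes T :: "'a::euclidean_space \<Rightarrow> 'b::euclidean_space"
  assumes "linear T"
  shows "ddir u (\<lambda>x. a * ((T x - c) \<bullet> v)) = (\<lambda>x. a * (T u \<bullet> v))"
proof -
  have "ddir u (\<lambda>x. a *\<^sub>R ((T x - c) \<bullet> v)) = (\<lambda>x. a * (T u \<bullet> v))"
    by (subst ddir_scaleR, intro smooth_inner smooth_affine smooth_const assms)
       (simp add: ddir_inner smooth_affine smooth_const assms ddir_affine ddir_const)
  then show ?thesis by simp
qed

lemma DERIV_increment_le:
  fixes f :: "real \<Rightarrow> real"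
  assumes "0 \<le> t" "\<And>s. 0 \<le> s \<Longrightarrow> s \<le> t \<Longrightarrow> (f has_real_derivative f' s) (at s)"
    and "\<And>s. 0 \<le> s \<Longrightarrow> s \<le> t \<Longrightarrow> f' s \<le> d"
  shows "f t \<le> f 0 + d * t"
proof -
  have "f t - d * t \<le> f 0 - d * 0"
  proof (rule DERIV_nonpos_imp_nonincreasing[OF assms(1)])
    fix s assume s: "0 \<le> s" "s \<le> t"
    show "\<exists>y. ((\<lambda>t. f t - d * t) has_real_derivative y) (at s) \<and> y \<le> 0"
      using assms(2,3)[OF s] by (intro exI[of _ "f' s - d"]) (auto intro!: derivative_eq_intros)
  qed
  then show ?thesis by simp
qed

lemma argmax_local_on_line:
  fixes f :: "'a::euclidean_space \<Rightarrow> real"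
  assumes "open S" "is_arg_max f (\<lambda>\<upsilon>. \<upsilon> \<in> S) \<upsilon>"
  obtains d where "0 < d" "\<And>t. \<bar>t\<bar> < d \<Longrightarrow> f (\<upsilon> + t *\<^sub>R u) \<le> f \<upsilon>"
proof -
  have \<upsilon>: "\<upsilon> \<in> S" "\<And>y. y \<in> S \<Longrightarrow> f y \<le> f \<upsilon>"
    using assms(2) by (auto simp: is_arg_max_def not_less)
  obtain d where d: "d > 0" "ball \<upsilon> d \<subseteq> S" using assms(1) \<upsilon>(1) by (meson open_contains_ball)
  define d' where "d' = d / (norm u + 1)"
  have nu: "norm u + 1 > 0" by (simp add: add_nonneg_pos)
  have "d' > 0" using d nu by (simp add: d'_def)
  moreover have "f (\<upsilon> + t *\<^sub>R u) \<le> f \<upsilon>" if t: "\<bar>t\<bar> < d'" for t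
  proof -
    have "norm (t *\<^sub>R u) \<le> \<bar>t\<bar> * (norm u + 1)" by (simp add: mult_left_mono)
    also have "\<dots> < d' * (norm u + 1)" using t nu by (intro mult_strict_right_mono) auto
    also have "\<dots> = d" using nu by (simp add: d'_def)
    finally have "\<upsilon> + t *\<^sub>R u \<in> ball \<upsilon> d" by (simp add: dist_norm)
    then have "\<upsilon> + t *\<^sub>R u \<in> S" using d(2) by blast
    then show ?thesis by (rule \<upsilon>(2))
  qed
  ultimately show ?thesis using that by blast
qed

lemma critical_point:
  fixes f :: "'a::euclidean_space \<Rightarrow> real"
  assumes f: "smooth f" and S: "open S" "is_arg_max f (\<lambda>\<upsilon>. \<upsilon> \<in> S) \<upsilon>"
  shows "ddir u f \<upsilon> = 0"
proof -
  obtain d where d: "0 < d" "\<And>t. \<bar>t\<bar> < d \<Longrightarrow> f (\<upsilon> + t *\<^sub>R u) \<le> f \<upsilon>"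
    using argmax_local_on_line[OF S] by blast
  show ?thesis
  proof (rule DERIV_local_max[OF _ d(1)])
    show "((\<lambda>t. f (\<upsilon> + t *\<^sub>R u)) has_real_derivative ddir u f \<upsilon>) (at 0)"
      using smooth_along_line_real[OF f, of \<upsilon> u 0] by simp
  qed (use d(2) in auto)
qed

text \<open>A positive second derivative would make the function increase strictly to the right of the critical
point.\<close>

lemma second_order_condition:
  fixes f :: "'a::euclidean_space \<Rightarrow> real"
  assumes f: "smooth f" and S: "open S" "is_arg_max f (\<lambda>\<upsilon>. \<upsilon> \<in> S) \<upsilon>"
  shows "ddir u (ddir u f) \<upsilon> \<le> 0"
proof (rule ccontr)
  assume "\<not> ddir u (ddir u f) \<upsilon> \<le> 0"
  then have pos: "0 < ddir u (ddir u f) (\<upsilon> + 0 *\<^sub>R u)" by simp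
  obtain d where d: "0 < d" "\<And>t. \<bar>t\<bar> < d \<Longrightarrow> f (\<upsilon> + t *\<^sub>R u) \<le> f \<upsilon>"
    using argmax_local_on_line[OF S] by blast
  obtain a where a: "0 < a" "\<And>k. 0 < k \<Longrightarrow> k < a \<Longrightarrow> ddir u f (\<upsilon> + 0 *\<^sub>R u) < ddir u f (\<upsilon> + (0 + k) *\<^sub>R u)"
    using DERIV_pos_inc_right[OF smooth_along_line_real[OF smooth_ddir[OF f]] pos] by blast
  define k where "k = min (a / 2) (d / 2)"
  have k: "0 < k" "k < a" "k < d" using a d by (auto simp: k_def)
  have "((\<lambda>t. f (\<upsilon> + t *\<^sub>R u)) has_real_derivative ddir u f (\<upsilon> + t *\<^sub>R u)) (at t)" for t
    by (rule smooth_along_line_real[OF f])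
  from MVT2[OF k(1) this] obtain t where t: "0 < t" "t < k"
    "f (\<upsilon> + k *\<^sub>R u) - f (\<upsilon> + 0 *\<^sub>R u) = (k - 0) * ddir u f (\<upsilon> + t *\<^sub>R u)" by blast
  have "0 < ddir u f (\<upsilon> + t *\<^sub>R u)"
    using a(2)[of t] t k critical_point[OF f S, of u] by simp
  then have "0 < k * ddir u f (\<upsilon> + t *\<^sub>R u)" using k by simp
  then show False using t(3) d(2)[of k] k by simp
qed

section \<open>The log-likelihood and its information operators\<close>

locale calming_setting =
  fixes P :: "('w, 'x::euclidean_space, 'y::euclidean_space) calming_model"
  assumes model: "is_model P" and noise2: "integrable (Pr P) (\<lambda>\<omega>. (norm (noise P \<omega>))\<^sup>2)"
begin

lemma sig_pos: "0 < sig P" and smooth_Aop: "smooth (Aop P)"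
  and Gop: "pos_def (Gop P)" and Gam: "pos_def (Gam P)"
  using model by (auto simp: is_model_def)

sublocale prob_space "Pr P" using model by (simp add: is_model_def)

definition gstar :: 'y where "gstar = Aop P (fstar P)"

lemma noise_eq: "noise P \<omega> = (1 / sig P) *\<^sub>R (Obs P \<omega> - gstar)"
  using model by (simp add: noise_def gstar_def is_model_def)

lemma integrable_noise: "integrable (Pr P) (noise P)" and expectation_noise: "(\<integral>\<omega>. noise P \<omega> \<partial>Pr P) = 0"
proof -
  have O: "integrable (Pr P) (Obs P)" "(\<integral>\<omega>. Obs P \<omega> \<partial>Pr P) = gstar"
    using model by (simp_all add: is_model_def gstar_def)
  then have i: "integrable (Pr P) (\<lambda>\<omega>. Obs P \<omega> - gstar)" by simp
  then show "integrable (Pr P) (noise P)" unfolding noise_eq[abs_def] by simp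
  show "(\<integral>\<omega>. noise P \<omega> \<partial>Pr P) = 0" unfolding noise_eq using O i by (simp add: prob_space)
qed

definition noise_const :: real where "noise_const = - (1 / 2) * (\<integral>\<omega>. (norm (noise P \<omega>))\<^sup>2 \<partial>Pr P)"

text \<open>The noise enters the log-likelihood through a constant and a linear term only. Therefore the observed
and the expected log-posterior have the same derivatives from the second order on.\<close>

lemma loglik_eq: "loglik P (Obs P \<omega>) \<upsilon> = - (1 / 2) * (norm (noise P \<omega>))\<^sup>2 + (1 / sig P) * (noise P \<omega> \<bullet> (snd \<upsilon> - gstar))
   - 1 / (2 * (sig P)\<^sup>2) * (norm (snd \<upsilon> - gstar))\<^sup>2 - structure_term P \<upsilon>"
proof -
  define e where "e = noise P \<omega>"
  have "Obs P \<omega> - snd \<upsilon> = sig P *\<^sub>R e - (snd \<upsilon> - gstar)" using sig_pos by (simp add: e_def noise_eq)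
  then have sq: "(norm (Obs P \<omega> - snd \<upsilon>))\<^sup>2 = (sig P)\<^sup>2 * (norm e)\<^sup>2 - 2 * sig P * (e \<bullet> (snd \<upsilon> - gstar)) + (norm (snd \<upsilon> - gstar))\<^sup>2"
    unfolding power2_norm_eq_inner
    by (simp add: inner_diff_left inner_diff_right inner_commute power2_eq_square algebra_simps)
  show ?thesis using sig_pos
    unfolding loglik_def structure_term_def sq e_def[symmetric] by (simp add: power2_eq_square field_simps)
qed

lemma integrable_loglik: "integrable (Pr P) (\<lambda>\<omega>. loglik P (Obs P \<omega>) \<upsilon>)"
  unfolding loglik_eq using noise2 integrable_noise by simp

lemma E_loglik_eq: "E_loglik P \<upsilon> = noise_const - 1 / (2 * (sig P)\<^sup>2) * (norm (snd \<upsilon> - gstar))\<^sup>2 - structure_term P \<upsilon>"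
proof -
  have "(\<integral>\<omega>. noise P \<omega> \<bullet> (snd \<upsilon> - gstar) \<partial>Pr P) = 0"
    using integral_inner_left[OF integrable_noise, of "snd \<upsilon> - gstar"] by (simp add: expectation_noise)
  then show ?thesis
    unfolding E_loglik_def loglik_eq noise_const_def using noise2 integrable_noise by (simp add: prob_space)
qed

lemma E_loglik_G_eq: "E_loglik_G P \<upsilon> = E_loglik P \<upsilon> - 1 / 2 * (norm (Gop P (fst \<upsilon> - f0 P)))\<^sup>2
                                    - 1 / 2 * (norm (Gam P (snd \<upsilon> - g0 P)))\<^sup>2"
  unfolding E_loglik_G_def E_loglik_def loglik_G_def using integrable_loglik by (simp add: prob_space)

lemma loglik_G_eq:
  "loglik_G P (Obs P \<omega>) \<upsilon> = E_loglik_G P \<upsilon> + ((1 / sig P) *\<^sub>R noise P \<omega>) \<bullet> snd \<upsilon>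
     + (- (1 / 2) * (norm (noise P \<omega>))\<^sup>2 - noise_const - (1 / sig P) * (noise P \<omega> \<bullet> gstar))"
  unfolding loglik_G_def E_loglik_G_eq E_loglik_eq loglik_eq by (simp add: inner_diff_right algebra_simps)

lemma linear_Gop: "linear (Gop P)" and linear_Gam: "linear (Gam P)"
  using Gop Gam by (auto simp: pos_def_def self_adjoint_linear)

lemma linear_Gfst: "linear (\<lambda>\<upsilon>::'x \<times> 'y. Gop P (fst \<upsilon>))" and linear_Gamsnd: "linear (\<lambda>\<upsilon>::'x \<times> 'y. Gam P (snd \<upsilon>))"
  using linear_compose[OF linear_fst linear_Gop] linear_compose[OF linear_snd linear_Gam] by (simp_all add: o_def)

lemma smooth_structure: "smooth (structure_term P)"
  unfolding structure_term_def[abs_def]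
  by (intro smooth_cmult smooth_norm_square smooth_diff smooth_linear linear_snd smooth_compose_linear[OF linear_fst] smooth_Aop)

definition quad :: "'x \<times> 'y \<Rightarrow> real" where
  "quad \<upsilon> = noise_const - 1 / (2 * (sig P)\<^sup>2) * (norm (snd \<upsilon> - gstar))\<^sup>2"

definition pen :: "'x \<times> 'y \<Rightarrow> real" where
  "pen \<upsilon> = 1 / 2 * (norm (Gop P (fst \<upsilon>) - Gop P (f0 P)))\<^sup>2 + 1 / 2 * (norm (Gam P (snd \<upsilon>) - Gam P (g0 P)))\<^sup>2"

lemma E_loglik_quad: "E_loglik P = (\<lambda>\<upsilon>. quad \<upsilon> - structure_term P \<upsilon>)"
  by (rule ext) (simp add: E_loglik_eq quad_def)

lemma E_loglik_G_pen: "E_loglik_G P = (\<lambda>\<upsilon>. E_loglik P \<upsilon> - pen \<upsilon>)"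
  by (rule ext) (simp add: E_loglik_G_eq pen_def linear_diff[OF linear_Gop] linear_diff[OF linear_Gam])

lemma smooth_quad: "smooth quad" and smooth_pen: "smooth pen"
  unfolding quad_def[abs_def] pen_def[abs_def]
  by (intro smooth_diff smooth_add smooth_const smooth_cmult smooth_norm_square smooth_linear linear_snd linear_Gfst linear_Gamsnd)+

lemma ddir_quad: "ddir v quad = (\<lambda>\<upsilon>. - (1 / (sig P)\<^sup>2) * ((snd \<upsilon> - gstar) \<bullet> snd v))"
proof -
  have "smooth (\<lambda>\<upsilon>::'x \<times> 'y. 1 / (2 * (sig P)\<^sup>2) * (norm (snd \<upsilon> - gstar))\<^sup>2)"
    by (intro smooth_cmult smooth_norm_square smooth_affine linear_snd)
  then show ?thesis unfolding quad_def[abs_def]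
    by (simp only: ddir_diff[OF smooth_const] ddir_const ddir_affine_norm_square[OF linear_snd]) simp
qed

lemma ddir_ddir_quad: "ddir u (ddir v quad) = (\<lambda>\<upsilon>. - (1 / (sig P)\<^sup>2) * (snd u \<bullet> snd v))"
  unfolding ddir_quad by (rule ddir_affine_inner[OF linear_snd])

lemma ddir_pen: "ddir v pen = (\<lambda>\<upsilon>. 1 * ((Gop P (fst \<upsilon>) - Gop P (f0 P)) \<bullet> Gop P (fst v)) + 1 * ((Gam P (snd \<upsilon>) - Gam P (g0 P)) \<bullet> Gam P (snd v)))"
proof -
  have "smooth (\<lambda>\<upsilon>::'x \<times> 'y. 1 / 2 * (norm (Gop P (fst \<upsilon>) - Gop P (f0 P)))\<^sup>2)"
    "smooth (\<lambda>\<upsilon>::'x \<times> 'y. 1 / 2 * (norm (Gam P (snd \<upsilon>) - Gam P (g0 P)))\<^sup>2)"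
    by (intro smooth_cmult smooth_norm_square smooth_affine linear_Gfst linear_Gamsnd)+
  then show ?thesis unfolding pen_def[abs_def]
    by (simp only: ddir_add ddir_affine_norm_square[OF linear_Gfst] ddir_affine_norm_square[OF linear_Gamsnd]) simp
qed

lemma ddir_ddir_pen: "ddir u (ddir v pen) = (\<lambda>\<upsilon>. Gop P (fst u) \<bullet> Gop P (fst v) + Gam P (snd u) \<bullet> Gam P (snd v))"
proof -
  have "smooth (\<lambda>\<upsilon>::'x \<times> 'y. 1 * ((Gop P (fst \<upsilon>) - Gop P (f0 P)) \<bullet> Gop P (fst v)))"
    "smooth (\<lambda>\<upsilon>::'x \<times> 'y. 1 * ((Gam P (snd \<upsilon>) - Gam P (g0 P)) \<bullet> Gam P (snd v)))"
    by (intro smooth_cmult smooth_inner smooth_const smooth_affine linear_Gfst linear_Gamsnd)+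
  then show ?thesis unfolding ddir_pen
    by (simp only: ddir_add ddir_affine_inner[OF linear_Gfst] ddir_affine_inner[OF linear_Gamsnd]) simp
qed

lemma smooth_E_loglik: "smooth (E_loglik P)" and smooth_E_loglik_G: "smooth (E_loglik_G P)"
  unfolding E_loglik_G_pen E_loglik_quad by (intro smooth_diff smooth_quad smooth_pen smooth_structure)+

lemma Fisher_inner: "Fisher P \<upsilon> u \<bullet> v = 1 / (sig P)\<^sup>2 * (snd u \<bullet> snd v) + ddir u (ddir v (structure_term P)) \<upsilon>"
proof -
  have "Fisher P \<upsilon> u \<bullet> v = - ddir u (ddir v (E_loglik P)) \<upsilon>"
    by (simp add: Fisher_def hessian_inner[OF smooth_E_loglik])
  then show ?thesis unfolding E_loglik_quad
    by (simp add: ddir_diff smooth_ddir smooth_quad smooth_structure ddir_ddir_quad)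
qed

lemma Fisher_G_inner: "Fisher_G P \<upsilon> u \<bullet> v = Fisher P \<upsilon> u \<bullet> v + Gop P (fst u) \<bullet> Gop P (fst v) + Gam P (snd u) \<bullet> Gam P (snd v)"
proof -
  have "Fisher_G P \<upsilon> u \<bullet> v = - ddir u (ddir v (E_loglik_G P)) \<upsilon>"
    by (simp add: Fisher_G_def hessian_inner[OF smooth_E_loglik_G])
  then show ?thesis unfolding E_loglik_G_pen
    by (simp add: ddir_diff smooth_ddir smooth_pen smooth_E_loglik ddir_ddir_pen Fisher_def hessian_inner)
qed

lemma linear_Fisher_G: "linear (Fisher_G P \<upsilon>)"
  unfolding Fisher_G_def by (intro linear_compose_neg linear_hessian smooth_E_loglik_G)

lemma pos_def_kernel: "pos_def T \<Longrightarrow> T u = 0 \<Longrightarrow> u = 0"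
  by (metis inner_zero_left less_irrefl pos_def_def)

lemma pos_def_Fisher_G:
  assumes F: "psd (Fisher P \<upsilon>)" shows "pos_def (Fisher_G P \<upsilon>)"
proof -
  have "Fisher_G P \<upsilon> u \<bullet> v = u \<bullet> Fisher_G P \<upsilon> v" for u v
  proof -
    have sym: "Fisher P \<upsilon> u \<bullet> v = Fisher P \<upsilon> v \<bullet> u"
      using self_adjointD[OF psd_self_adjoint[OF F], of u v] by (simp add: inner_commute)
    show ?thesis
      unfolding inner_commute[of u "Fisher_G P \<upsilon> v"] Fisher_G_inner sym
      by (simp only: inner_commute[of "Gop P (fst u)"] inner_commute[of "Gam P (snd u)"])
  qed
  moreover have "0 < Fisher_G P \<upsilon> u \<bullet> u" if "u \<noteq> 0" for u
  proof -
    have "Gop P (fst u) \<noteq> 0 \<or> Gam P (snd u) \<noteq> 0"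
      using that pos_def_kernel[OF Gop] pos_def_kernel[OF Gam] by (metis prod_eq_iff fst_zero snd_zero)
    then have "0 < Gop P (fst u) \<bullet> Gop P (fst u) + Gam P (snd u) \<bullet> Gam P (snd u)"
      by (auto intro: add_pos_nonneg add_nonneg_pos)
    then show ?thesis using psd_nonneg[OF F, of u] by (simp add: Fisher_G_inner)
  qed
  ultimately show ?thesis using linear_Fisher_G by (simp add: pos_def_def self_adjoint_def)
qed

text \<open>At the target this follows from maximality and symmetry of second derivatives, before anything is known
about \<open>Fisher\<close> there. It guarantees that the root in \<open>local_ball_G\<close> exists and hence that the target belongs
to its own local ball.\<close>

lemma psd_Fisher_G_target:
  assumes target: "is_target P \<upsilon>" and L: "cond_L P"
  shows "psd (Fisher_G P \<upsilon>)"
proof -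
  have ip: "Fisher_G P \<upsilon> u \<bullet> v = - ddir u (ddir v (E_loglik_G P)) \<upsilon>" for u v
    by (simp add: Fisher_G_def hessian_inner[OF smooth_E_loglik_G])
  have "Fisher_G P \<upsilon> u \<bullet> v = u \<bullet> Fisher_G P \<upsilon> v" for u v
    unfolding inner_commute[of u "Fisher_G P \<upsilon> v"] ip using ddir_commute[OF smooth_E_loglik_G] by simp
  moreover have "0 \<le> Fisher_G P \<upsilon> u \<bullet> u" for u
    unfolding ip using target L second_order_condition[OF smooth_E_loglik_G, of "Ups P" \<upsilon> u]
    by (simp add: is_target_def cond_L_def)
  ultimately show ?thesis using linear_Fisher_G by (simp add: psd_def self_adjoint_def)
qed

lemma Fisher_le_Fisher_G: "loewner_le (Fisher P \<upsilon>) (Fisher_G P \<upsilon>)"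
  by (simp add: loewner_le_def Fisher_G_inner)

lemma norm_D_op: "psd (Fisher P \<upsilon>) \<Longrightarrow> (norm (D_op P \<upsilon> u))\<^sup>2 = Fisher P \<upsilon> u \<bullet> u"
  by (simp add: D_op_def norm_psd_sqrt)

lemma norm_D_G_op: "psd (Fisher P \<upsilon>) \<Longrightarrow> (norm (D_G_op P \<upsilon> u))\<^sup>2 = Fisher_G P \<upsilon> u \<bullet> u"
  by (simp add: D_G_op_def norm_psd_sqrt pos_def_imp_psd pos_def_Fisher_G)

lemma linear_D_G_op: "psd (Fisher P \<upsilon>) \<Longrightarrow> linear (D_G_op P \<upsilon>)"
  by (simp add: D_G_op_def psd_linear psd_psd_sqrt pos_def_imp_psd pos_def_Fisher_G)

end

section \<open>Location of the maximum a posteriori point\<close>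

locale calming_observation = calming_setting P
  for P :: "('w, 'x::euclidean_space, 'y::euclidean_space) calming_model" +
  fixes \<omega> :: 'w
begin

definition logpost :: "'x \<times> 'y \<Rightarrow> real" where "logpost = loglik_G P (Obs P \<omega>)"

text \<open>The random part of the gradient of the log-posterior.\<close>

definition score :: "'x \<times> 'y" where "score = (0, (1 / sig P) *\<^sub>R noise P \<omega>)"

definition noise_offset :: real where
  "noise_offset = - (1 / 2) * (norm (noise P \<omega>))\<^sup>2 - noise_const - (1 / sig P) * (noise P \<omega> \<bullet> gstar)"

lemma logpost_eq: "logpost = (\<lambda>\<upsilon>. E_loglik_G P \<upsilon> + (\<upsilon> \<bullet> score + noise_offset))"
  by (rule ext) (simp add: logpost_def loglik_G_eq score_def noise_offset_def inner_prod_def inner_commute)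

lemma linear_score: "linear (\<lambda>\<upsilon>. \<upsilon> \<bullet> score)"
  by (rule linearI) (auto simp: inner_add_left)

lemma smooth_logpost: "smooth logpost" unfolding logpost_eq
  by (intro smooth_add smooth_E_loglik_G smooth_linear linear_score smooth_const)

lemma ddir_logpost: "ddir u logpost = (\<lambda>\<upsilon>. ddir u (E_loglik_G P) \<upsilon> + u \<bullet> score)"
  unfolding logpost_eq
  by (simp add: ddir_add smooth_add smooth_E_loglik_G smooth_linear linear_score smooth_const ddir_linear ddir_const)

lemma ddir_ddir_logpost: "ddir u (ddir v logpost) = (\<lambda>\<upsilon>. - Fisher_G P \<upsilon> u \<bullet> v)"
  unfolding ddir_logpost
  by (simp add: ddir_add smooth_ddir smooth_E_loglik_G smooth_const ddir_const Fisher_G_def hessian_inner)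

text \<open>The part of the second derivative of the negative log-posterior along \<open>u\<close> that does not depend on the point.\<close>

definition constant_curvature :: "'x \<times> 'y \<Rightarrow> real" where
  "constant_curvature u = 1 / (sig P)\<^sup>2 * (snd u \<bullet> snd u) + Gop P (fst u) \<bullet> Gop P (fst u) + Gam P (snd u) \<bullet> Gam P (snd u)"

lemma ddir_logpost_2: "(ddir u ^^ 2) logpost = (\<lambda>\<upsilon>. (- constant_curvature u) - (ddir u ^^ 2) (structure_term P) \<upsilon>)"
  by (simp add: numeral_2_eq_2 ddir_ddir_logpost Fisher_G_inner Fisher_inner constant_curvature_def fun_eq_iff)

lemma ddir_logpost_3: "(ddir u ^^ 3) logpost = (\<lambda>\<upsilon>. 0 - (ddir u ^^ 3) (structure_term P) \<upsilon>)"
proof -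
  have "(ddir u ^^ 3) logpost = ddir u ((ddir u ^^ 2) logpost)" by (simp add: numeral_3_eq_3 numeral_2_eq_2)
  also have "\<dots> = (\<lambda>\<upsilon>. 0 - ddir u ((ddir u ^^ 2) (structure_term P)) \<upsilon>)"
    unfolding ddir_logpost_2 by (subst ddir_diff) (simp_all only: smooth_const smooth_ddir_iterate[OF smooth_structure] ddir_const)
  finally show ?thesis by (simp add: numeral_3_eq_3 numeral_2_eq_2)
qed

lemma ddir_logpost_4: "(ddir u ^^ 4) logpost = (\<lambda>\<upsilon>. 0 - (ddir u ^^ 4) (structure_term P) \<upsilon>)"
proof -
  have e: "(ddir u ^^ 4) f = ddir u ((ddir u ^^ 3) f)" for f :: "'x \<times> 'y \<Rightarrow> real"
    by (simp add: eval_nat_numeral)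
  show ?thesis unfolding e ddir_logpost_3
    by (subst ddir_diff) (simp_all only: smooth_const smooth_ddir_iterate[OF smooth_structure] ddir_const)
qed

lemma concave_logpost:
  assumes "cond_L P" shows "concave_on (Ups P) logpost"
proof -
  have c: "concave_on (Ups P) (E_loglik_G P)" using assms by (simp add: cond_L_def)
  show ?thesis unfolding concave_on_iff
  proof (intro conjI ballI allI impI)
    show "convex (Ups P)" using assms by (simp add: cond_L_def)
    fix x y :: "'x \<times> 'y" and u v :: real
    assume *: "x \<in> Ups P" "y \<in> Ups P" "0 \<le> u" "0 \<le> v" "u + v = 1"
    have "u * E_loglik_G P x + v * E_loglik_G P y \<le> E_loglik_G P (u *\<^sub>R x + v *\<^sub>R y)"
      using c * unfolding concave_on_iff by blast
    moreover have "u * noise_offset + v * noise_offset = noise_offset" using *(5) by (metis distrib_right mult_1)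
    ultimately show "logpost (u *\<^sub>R x + v *\<^sub>R y) \<ge> u * logpost x + v * logpost y"
      unfolding logpost_eq by (simp add: inner_add_left algebra_simps)
  qed
qed

text \<open>Cauchy-Schwarz in the metric of \<open>D_G_op\<close>: the dual norm of the score is the quadratic form of \<open>HG_inv\<close> because
the score has no component in the first factor.\<close>

lemma noise_bound:
  assumes F: "psd (Fisher P \<upsilon>)" and z: "0 \<le> z"
    and le: "(1 / (sig P)\<^sup>2) * (noise P \<omega> \<bullet> HG_inv P \<upsilon> (noise P \<omega>)) \<le> z\<^sup>2"
  shows "u \<bullet> score \<le> z * norm (D_G_op P \<upsilon> u)"
proof -
  define T where "T = Fisher_G P \<upsilon>"
  define D where "D = psd_sqrt T"
  have T: "pos_def T" unfolding T_def by (rule pos_def_Fisher_G[OF F])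
  have D: "pos_def D" unfolding D_def by (rule pos_def_psd_sqrt[OF T])
  have saD: "self_adjoint D" using D by (simp add: pos_def_def)
  note bD = pos_def_bij[OF D] and bT = pos_def_bij[OF T]
  have saT: "self_adjoint (inv T)" using self_adjoint_inv[OF _ bT] T by (simp add: pos_def_def)
  have [simp]: "D (inv D w) = w" for w using bD by (simp add: bij_is_surj surj_f_inv_f)
  have iT: "inv T w = inv D (inv D w)" for w
    using o_inv_distrib[OF bD bD] psd_sqrt_twice[OF pos_def_imp_psd[OF T]] unfolding D_def[symmetric]
    by (metis comp_apply ext)
  have "u \<bullet> score = D u \<bullet> inv D score"
    using self_adjointD[OF saD, of u "inv D score"] by simp
  also have "\<dots> \<le> norm (D u) * norm (inv D score)" by (rule norm_cauchy_schwarz)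
  also have "norm (inv D score) \<le> z"
  proof (rule power2_le_imp_le[OF _ z])
    have score: "score = (1 / sig P) *\<^sub>R (0, noise P \<omega>)" by (simp add: score_def scaleR_prod_def)
    have "(norm (inv D score))\<^sup>2 = score \<bullet> inv T score"
      using self_adjointD[OF self_adjoint_inv[OF saD bD], of score "inv D score"] by (simp add: iT power2_norm_eq_inner)
    also have "\<dots> = (1 / (sig P)\<^sup>2) * (noise P \<omega> \<bullet> HG_inv P \<upsilon> (noise P \<omega>))"
      unfolding score linear_scale[OF self_adjoint_linear[OF saT]]
      by (simp add: inner_prod_def HG_inv_def gg_block_def T_def power2_eq_square)
    also note le
    finally show "(norm (inv D score))\<^sup>2 \<le> z\<^sup>2" .
  qed
  then have "norm (D u) * norm (inv D score) \<le> norm (D u) * z" by (intro mult_left_mono) auto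
  finally show ?thesis by (simp add: D_def T_def D_G_op_def mult.commute)
qed

text \<open>Suppose the maximiser lies outside, and let \<open>u\<close> point to it with \<open>\<parallel>D u\<parallel> = r\<close>; let \<open>d\<close> bound the third derivative. At \<open>vs + u\<close> the slope
along \<open>u\<close> is at most \<open>z r - r\<^sup>2 + d \<le> 0\<close>, and the second derivative is negative. So the log-posterior decreases
strictly just beyond \<open>vs + u\<close>, which contradicts concavity and the larger value at the maximiser.\<close>

lemma MAP_in_local_ball:
  assumes target: "is_target P vs" and L: "cond_L P" and F: "psd (Fisher P vs)"
    and MAP: "is_MAP P \<omega> vt" and ball: "local_ball_G P vs r \<subseteq> Ups P" and r: "0 < r"
    and delta: "3 * delta3_G P vs r / ereal (r\<^sup>2) \<le> ereal \<rho>" and \<rho>: "\<rho> \<le> 1 / 2"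
    and z: "0 \<le> z" "z \<le> (1 - \<rho>) * r"
    and le: "(1 / (sig P)\<^sup>2) * (noise P \<omega> \<bullet> HG_inv P vs (noise P \<omega>)) \<le> z\<^sup>2"
  shows "vt \<in> local_ball_G P vs r"
proof (rule ccontr)
  assume notin: "vt \<notin> local_ball_G P vs r"
  define D where "D = D_G_op P vs"
  note linD = linear_D_G_op[OF F, folded D_def]
  define T where "T = norm (D (vt - vs)) / r"
  have T: "T > 1" using notin r by (simp add: local_ball_G_def D_def T_def)
  define u where "u = (1 / T) *\<^sub>R (vt - vs)"
  have "norm (D (vt - vs)) = T * r" using r by (simp add: T_def)
  then have Du: "norm (D u) = r" using T by (simp add: u_def linear_scale[OF linD])
  have vt: "vt = vs + T *\<^sub>R u" using T by (simp add: u_def)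
  define d where "d = \<rho> * r\<^sup>2 / 3"
  have dle: "delta3_G P vs r \<le> ereal d"
    using delta r by (cases "delta3_G P vs r") (auto simp: d_def field_simps)
  have in_ball: "vs + t *\<^sub>R u \<in> local_ball_G P vs r" if "0 \<le> t" "t \<le> 1" for t
    using that r by (simp add: local_ball_G_def D_def[symmetric] linear_scale[OF linD] Du mult_left_le_one_le)
  have h3: "\<bar>(ddir u ^^ 3) logpost (vs + t *\<^sub>R u)\<bar> \<le> d" if "0 \<le> t" "t \<le> 1" for t
  proof -
    have "ereal \<bar>dir_deriv 3 (structure_term P) (vs + t *\<^sub>R u) u\<bar> \<le> delta3_G P vs r"
      unfolding delta3_G_def using Du in_ball[OF that]
      by (intro SUP_upper2[of "vs + t *\<^sub>R u"] SUP_upper2[of u]) (auto simp: D_def)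
    also note dle
    finally show ?thesis by (simp add: ddir_logpost_3 dir_deriv_smooth[OF smooth_structure])
  qed
  have d0: "0 \<le> d" using h3[of 0] by simp
  then have \<rho>0: "0 \<le> \<rho>" using r by (simp add: d_def zero_le_mult_iff)
  have D1: "((\<lambda>t. logpost (vs + t *\<^sub>R u)) has_real_derivative ddir u logpost (vs + t *\<^sub>R u)) (at t)" for t
    by (rule smooth_along_line_real[OF smooth_logpost])
  have D2: "((\<lambda>t. ddir u logpost (vs + t *\<^sub>R u)) has_real_derivative (ddir u ^^ 2) logpost (vs + t *\<^sub>R u)) (at t)" for t
    using smooth_along_line_real[OF smooth_ddir[OF smooth_logpost]] by (simp add: numeral_2_eq_2)
  have D3: "((\<lambda>t. (ddir u ^^ 2) logpost (vs + t *\<^sub>R u)) has_real_derivative (ddir u ^^ 3) logpost (vs + t *\<^sub>R u)) (at t)" for t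
    using smooth_along_line_real[OF smooth_ddir_iterate[where k = 2 and u = u, OF smooth_logpost]]
    by (simp add: eval_nat_numeral)
  have h2_0: "(ddir u ^^ 2) logpost vs = - r\<^sup>2"
    using norm_D_G_op[OF F, of u] by (simp add: numeral_2_eq_2 ddir_ddir_logpost Du[unfolded D_def])
  have h2: "(ddir u ^^ 2) logpost (vs + t *\<^sub>R u) \<le> - r\<^sup>2 + d" if t: "0 \<le> t" "t \<le> 1" for t
  proof -
    have "(ddir u ^^ 2) logpost (vs + t *\<^sub>R u) \<le> (ddir u ^^ 2) logpost (vs + 0 *\<^sub>R u) + d * t"
      using t h3 by (intro DERIV_increment_le[OF t(1) D3]) (auto simp: abs_le_iff)
    also have "d * t \<le> d" using t d0 by (simp add: mult_left_le)
    finally show ?thesis by (simp add: h2_0)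
  qed
  have "ddir u logpost (vs + 1 *\<^sub>R u) \<le> ddir u logpost (vs + 0 *\<^sub>R u) + (- r\<^sup>2 + d) * 1"
    using h2 by (intro DERIV_increment_le[OF _ D2]) auto
  moreover have "ddir u logpost vs \<le> z * r"
  proof -
    have "ddir u (E_loglik_G P) vs = 0"
      using target L by (intro critical_point[OF smooth_E_loglik_G, of "Ups P"]) (auto simp: is_target_def cond_L_def)
    then show ?thesis using noise_bound[OF F z(1) le, of u] by (simp add: ddir_logpost Du[unfolded D_def])
  qed
  moreover have "z * r \<le> (1 - \<rho>) * r * r" using z r by (intro mult_right_mono) auto
  ultimately have h1: "ddir u logpost (vs + 1 *\<^sub>R u) \<le> 0"
  proof -
    assume a: "ddir u logpost (vs + 1 *\<^sub>R u) \<le> ddir u logpost (vs + 0 *\<^sub>R u) + (- r\<^sup>2 + d) * 1"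
      "ddir u logpost vs \<le> z * r" "z * r \<le> (1 - \<rho>) * r * r"
    have "(1 - \<rho>) * r * r - r\<^sup>2 + d = - (2 / 3) * (\<rho> * r\<^sup>2)" by (simp add: d_def power2_eq_square algebra_simps)
    moreover have "0 \<le> \<rho> * r\<^sup>2" using \<rho>0 by simp
    ultimately show ?thesis using a by simp
  qed
  have "\<rho> * r\<^sup>2 \<le> 1 / 2 * r\<^sup>2" using \<rho> by (intro mult_right_mono) auto
  then have "d < r\<^sup>2" using r by (simp add: d_def)
  then have "(ddir u ^^ 2) logpost (vs + 1 *\<^sub>R u) < 0" using h2[of 1] by simp
  then obtain a where a: "a > 0" "\<And>k. 0 < k \<Longrightarrow> k < a \<Longrightarrow> ddir u logpost (vs + (1 + k) *\<^sub>R u) < ddir u logpost (vs + 1 *\<^sub>R u)"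
    using DERIV_neg_dec_right[OF D2[of 1]] by auto
  define k where "k = min (a / 2) ((T - 1) / 2)"
  have k: "0 < k" "k < a" "1 + k < T" using a T by (auto simp: k_def min_def field_simps)
  have "logpost (vs + (1 + k) *\<^sub>R u) < logpost (vs + 1 *\<^sub>R u)"
  proof (rule DERIV_neg_imp_decreasing_open[of 1 "1 + k" "\<lambda>t. logpost (vs + t *\<^sub>R u)"])
    show "continuous_on {1..1 + k} (\<lambda>t. logpost (vs + t *\<^sub>R u))"
      using D1 by (meson DERIV_continuous_on has_field_derivative_at_within)
    fix t assume t: "1 < t" "t < 1 + k"
    have "ddir u logpost (vs + (1 + (t - 1)) *\<^sub>R u) < ddir u logpost (vs + 1 *\<^sub>R u)"
      using t k by (intro a(2)) auto
    then have "ddir u logpost (vs + t *\<^sub>R u) < 0" using h1 by simp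
    then show "\<exists>y. ((\<lambda>t. logpost (vs + t *\<^sub>R u)) has_real_derivative y) (at t) \<and> y < 0"
      using D1 by blast
  qed (use k in simp)
  moreover have "logpost (vs + 1 *\<^sub>R u) \<le> logpost (vs + (1 + k) *\<^sub>R u)"
  proof -
    \<comment> \<open>The point \<open>vs + (1 + k) u\<close> divides the segment from \<open>vs + u\<close> to the maximiser \<open>vs + T u\<close> in the ratio \<open>\<theta> : 1 - \<theta>\<close>.\<close>
    define \<theta> where "\<theta> = k / (T - 1)"
    have \<theta>: "0 \<le> \<theta>" "\<theta> \<le> 1" using k T by (auto simp: \<theta>_def field_simps)
    have in1: "vs + 1 *\<^sub>R u \<in> Ups P" using in_ball[of 1] ball by auto
    have m: "vt \<in> Ups P" "logpost (vs + 1 *\<^sub>R u) \<le> logpost vt"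
      using MAP in1 unfolding is_MAP_def is_arg_max_def logpost_def by (metis not_less)+
    have "(1 - \<theta>) *\<^sub>R (vs + 1 *\<^sub>R u) + \<theta> *\<^sub>R vt = vs + (1 + \<theta> * (T - 1)) *\<^sub>R u"
      unfolding vt by (simp add: algebra_simps)
    also have "\<theta> * (T - 1) = k" using T by (simp add: \<theta>_def)
    finally have eq: "(1 - \<theta>) *\<^sub>R (vs + 1 *\<^sub>R u) + \<theta> *\<^sub>R vt = vs + (1 + k) *\<^sub>R u" .
    have "(1 - \<theta>) * logpost (vs + 1 *\<^sub>R u) + \<theta> * logpost vt \<le> logpost (vs + (1 + k) *\<^sub>R u)"
      using concave_logpost[OF L] in1 m \<theta> unfolding concave_on_iff eq[symmetric] by simp
    moreover have "\<theta> * logpost (vs + 1 *\<^sub>R u) \<le> \<theta> * logpost vt" using m \<theta> by (intro mult_left_mono) auto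
    ultimately show ?thesis by (simp add: algebra_simps)
  qed
  ultimately show False by simp
qed

end

section \<open>Taylor expansion at the maximum\<close>

text \<open>A bound on the ball \<open>\<parallel>D u\<parallel> \<le> r\<close> extends by homogeneity. \<open>D\<close> may be singular: on its kernel every multiple
of \<open>u\<close> lies in the ball, so the derivative vanishes there.\<close>

lemma (in calming_setting) homogeneous_bound:
  assumes F: "psd (Fisher P \<upsilon>)" and r: "0 < r" and k: "0 < k"
    and bound: "\<And>u. norm (D_op P \<upsilon> u) \<le> r \<Longrightarrow> \<bar>dir_deriv k (structure_term P) \<upsilon> u\<bar> \<le> d"
  shows "\<bar>(ddir u ^^ k) (structure_term P) \<upsilon>\<bar> * r ^ k \<le> d * norm (D_op P \<upsilon> u) ^ k"
proof -
  define N where "N = norm (D_op P \<upsilon> u)"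
  define v where "v = (ddir u ^^ k) (structure_term P) \<upsilon>"
  have linD: "linear (D_op P \<upsilon>)" by (simp add: D_op_def psd_linear psd_psd_sqrt F)
  have b: "\<bar>s\<bar> ^ k * \<bar>v\<bar> \<le> d" if "\<bar>s\<bar> * N \<le> r" for s
    using bound[of "s *\<^sub>R u"] that
    by (simp add: linear_scale[OF linD] N_def v_def dir_deriv_smooth[OF smooth_structure]
        ddir_scale_iterate[OF smooth_structure] abs_mult power_abs)
  show ?thesis
  proof (cases "N = 0")
    case True
    have "v = 0"
    proof (rule ccontr)
      assume v: "v \<noteq> 0"
      define s where "s = 1 + \<bar>d\<bar> / \<bar>v\<bar>"
      have s: "1 \<le> s" by (simp add: s_def)
      have "s * \<bar>v\<bar> \<le> s ^ k * \<bar>v\<bar>"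
        using s k self_le_power[of s k] by (intro mult_right_mono) auto
      also have "\<dots> \<le> d" using b[of s] True s r by simp
      also have "s * \<bar>v\<bar> = \<bar>v\<bar> + \<bar>d\<bar>" using v by (simp add: s_def distrib_right)
      finally have "\<bar>v\<bar> + \<bar>d\<bar> \<le> d" .
      then show False using v by linarith
    qed
    then show ?thesis using True k by (simp add: v_def N_def zero_power)
  next
    case False
    then have N: "N > 0" by (simp add: N_def)
    have "(r / N) ^ k * \<bar>v\<bar> \<le> d" using b[of "r / N"] N r by simp
    then have "r ^ k * \<bar>v\<bar> \<le> d * N ^ k" using N by (simp add: power_divide field_simps)
    then show ?thesis by (simp add: v_def N_def mult.commute)
  qed
qed

text \<open>The local conditions at the maximum a posteriori point, with the suprema \<open>delta\<close> replaced by real bounds.\<close>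

locale laplace_point = calming_observation P \<omega>
  for P :: "('w, 'x::euclidean_space, 'y::euclidean_space) calming_model" and \<omega> +
  fixes U0 :: "('x \<times> 'y) set" and r d3 d4 x :: real and vt :: "'x \<times> 'y"
  assumes L: "cond_L P" and MAP: "is_MAP P \<omega> vt"
    and U0: "U0 \<subseteq> Ups P" and F: "\<And>\<upsilon>. \<upsilon> \<in> U0 \<Longrightarrow> psd (Fisher P \<upsilon>)"
    and nbhd: "{\<upsilon>'. norm (D_op P vt (\<upsilon>' - vt)) \<le> r} \<subseteq> U0"
    and vt: "vt \<in> U0"
    and bound3: "\<And>\<upsilon> u. \<upsilon> \<in> U0 \<Longrightarrow> norm (D_op P \<upsilon> u) \<le> r \<Longrightarrow> \<bar>dir_deriv 3 (structure_term P) \<upsilon> u\<bar> \<le> d3"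
    and bound4: "\<And>\<upsilon> u. \<upsilon> \<in> U0 \<Longrightarrow> norm (D_op P \<upsilon> u) \<le> r \<Longrightarrow> \<bar>dir_deriv 4 (structure_term P) \<upsilon> u\<bar> \<le> d4"
    and small: "4 * d3\<^sup>2 + 4 * d4 \<le> 1 / 2" and x: "16 \<le> x"
    and r: "2 * sqrt (eff_dim P vt) + sqrt x \<le> r" and p: "0 \<le> eff_dim P vt"
begin

lemma r4: "4 \<le> r"
proof -
  have "4 \<le> sqrt x" using x by (intro real_le_rsqrt) simp
  then show ?thesis using r p real_sqrt_ge_zero[OF p] by linarith
qed

lemma linear_D: "\<upsilon> \<in> U0 \<Longrightarrow> linear (D_op P \<upsilon>)"
  by (simp add: D_op_def psd_linear psd_psd_sqrt F)

lemma d3: "0 \<le> d3" "d3 \<le> 36 / 100" and d4: "0 \<le> d4"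
proof -
  show a: "0 \<le> d3" using bound3[OF vt, of 0] r4 by (simp add: linear_0[OF linear_D[OF vt]])
  show b: "0 \<le> d4" using bound4[OF vt, of 0] r4 by (simp add: linear_0[OF linear_D[OF vt]])
  have "d3\<^sup>2 \<le> (36 / 100)\<^sup>2" using small b by (simp add: power2_eq_square)
  then show "d3 \<le> 36 / 100" by (rule power2_le_imp_le) simp
qed

lemma segment_in_U0:
  assumes "norm (D_op P vt u) \<le> r" "0 \<le> t" "t \<le> 1"
  shows "vt + t *\<^sub>R u \<in> U0"
proof -
  have "t * norm (D_op P vt u) \<le> 1 * r" using assms by (intro mult_mono) auto
  then show ?thesis using assms nbhd by (auto simp: linear_scale[OF linear_D[OF vt]])
qed

text \<open>Along the segment, \<open>a s = \<parallel>D(vt + s u) u\<parallel>\<^sup>2\<close> satisfies \<open>|a'| \<le> d3 (a / r\<^sup>2)\<^bsup>3/2\<^esup>\<close>. Hence \<open>(a + r\<^sup>2)\<^bsup>-1/2\<^esup>\<close> decreases at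
a rate of at most \<open>d3 / (2 r\<^sup>3)\<close>; the summand \<open>r\<^sup>2\<close> keeps the root differentiable where \<open>a\<close> vanishes.\<close>

lemma self_concordance:
  assumes u: "norm (D_op P vt u) \<le> r" and t: "0 \<le> t" "t \<le> 1"
  shows "norm (D_op P (vt + t *\<^sub>R u) u) \<le> 11 / 10 * r"
proof -
  define a where "a s = Fisher P (vt + s *\<^sub>R u) u \<bullet> u" for s
  define S where "S s = sqrt (a s + r\<^sup>2)" for s
  have a_eq: "a s = (norm (D_op P (vt + s *\<^sub>R u) u))\<^sup>2" if "0 \<le> s" "s \<le> 1" for s
    using norm_D_op[OF F[OF segment_in_U0[OF u that]]] by (simp add: a_def)
  have r0: "0 < r" using r4 by simp
  have S: "0 < a s + r\<^sup>2" "0 < S s" if "0 \<le> s" "s \<le> 1" for s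
    using a_eq[OF that] r0 by (simp_all add: S_def add_nonneg_pos)
  have da: "(a has_real_derivative (ddir u ^^ 3) (structure_term P) (vt + s *\<^sub>R u)) (at s)" for s
  proof -
    have "a = (\<lambda>s. 1 / (sig P)\<^sup>2 * (snd u \<bullet> snd u) + (ddir u ^^ 2) (structure_term P) (vt + s *\<^sub>R u))"
      by (rule ext) (simp add: a_def Fisher_inner numeral_2_eq_2)
    then show ?thesis
      using smooth_along_line_real[OF smooth_ddir_iterate[where k = 2 and u = u, OF smooth_structure], of vt u s]
      by (auto intro!: derivative_eq_intros simp: eval_nat_numeral)
  qed
  have "- inverse (S t) \<le> - inverse (S 0) + d3 / (2 * r ^ 3) * t"
  proof (rule DERIV_increment_le[OF t(1)])
    fix s assume s: "0 \<le> s" "s \<le> t"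
    then have s1: "s \<le> 1" using t by simp
    let ?d = "(ddir u ^^ 3) (structure_term P) (vt + s *\<^sub>R u)"
    have "(S has_real_derivative ?d / (2 * S s)) (at s)"
      unfolding S_def using S(1)[OF s(1) s1]
      by (auto intro!: derivative_eq_intros da simp: field_simps)
    then show "((\<lambda>s. - inverse (S s)) has_real_derivative ?d / (2 * S s ^ 3)) (at s)"
      using S(2)[OF s(1) s1] by (auto intro!: derivative_eq_intros simp: power2_eq_square power3_eq_cube field_simps)
    have "?d * r ^ 3 \<le> \<bar>?d\<bar> * r ^ 3" using r0 by (intro mult_right_mono) auto
    also have "\<dots> \<le> d3 * norm (D_op P (vt + s *\<^sub>R u) u) ^ 3"
      using segment_in_U0[OF u s(1) s1] bound3 F r0 by (intro homogeneous_bound) auto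
    also have "\<dots> \<le> d3 * S s ^ 3"
    proof (intro mult_left_mono power_mono d3)
      have "norm (D_op P (vt + s *\<^sub>R u) u) = sqrt (a s)" using a_eq[OF s(1) s1] by simp
      then show "norm (D_op P (vt + s *\<^sub>R u) u) \<le> S s" by (simp add: S_def)
    qed simp
    finally have "?d * r ^ 3 \<le> d3 * S s ^ 3" .
    then show "?d / (2 * S s ^ 3) \<le> d3 / (2 * r ^ 3)"
      using r0 S(2)[OF s(1) s1] by (simp add: field_simps)
  qed
  moreover have "d3 / (2 * r ^ 3) * t \<le> (1 / 50) / r"
  proof -
    have "d3 / (2 * r ^ 3) * t \<le> d3 / (2 * r ^ 3) * 1" using t d3 r0 by (intro mult_left_mono) auto
    also have "d3 / (2 * r ^ 3) * 1 = d3 / (2 * r ^ 3)" by simp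
    also have "\<dots> \<le> (1 / 50) / r"
    proof -
      have "4\<^sup>2 \<le> r\<^sup>2" using r4 by (intro power_mono) auto
      then have "d3 * 50 \<le> 2 * r\<^sup>2" using d3 by simp
      then have "(d3 * 50) * r \<le> (2 * r\<^sup>2) * r" using r0 by (intro mult_right_mono) auto
      then show ?thesis using r0 by (simp add: field_simps power3_eq_cube power2_eq_square)
    qed
    finally show ?thesis .
  qed
  \<comment> \<open>Here \<open>S 0\<^sup>2 \<le> 2 r\<^sup>2\<close>, and \<open>142/100\<close> exceeds the root of two.\<close>
  moreover have "(70 / 100) / r \<le> inverse (S 0)"
  proof -
    have "a 0 \<le> r\<^sup>2"
      using a_eq[of 0] u by (simp add: power_mono)
    then have "S 0 \<le> sqrt ((142 / 100 * r)\<^sup>2)"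
    proof -
      have "(142 / 100 * r)\<^sup>2 = 20164 / 10000 * r\<^sup>2" by (simp add: power_mult_distrib power_divide)
      then have "a 0 + r\<^sup>2 \<le> (142 / 100 * r)\<^sup>2" using \<open>a 0 \<le> r\<^sup>2\<close> zero_le_power2[of r] by linarith
      then show ?thesis unfolding S_def by (rule real_sqrt_le_mono)
    qed
    then have "S 0 \<le> 142 / 100 * r" using r0 by simp
    then have "inverse (142 / 100 * r) \<le> inverse (S 0)" using S(2)[of 0] by (intro le_imp_inverse_le) auto
    moreover have "(70 / 100) / r \<le> inverse (142 / 100 * r)" using r0 by (simp add: field_simps)
    ultimately show ?thesis by linarith
  qed
  moreover have "(70 / 100) / r - (1 / 50) / r = (68 / 100) / r" using r0 by (simp add: field_simps)
  ultimately have "(68 / 100) / r \<le> inverse (S t)" by linarith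
  then have "S t \<le> r / (68 / 100)" using r0 S(2)[OF t] by (simp add: field_simps)
  then have "(S t)\<^sup>2 \<le> (r / (68 / 100))\<^sup>2" using S(2)[OF t] by (intro power_mono) auto
  also have "\<dots> \<le> (221 / 100) * r\<^sup>2" by (simp add: power_divide)
  finally have "a t + r\<^sup>2 \<le> (221 / 100) * r\<^sup>2"
    using S(1)[OF t] by (simp add: S_def)
  moreover have "(11 / 10 * r)\<^sup>2 = 121 / 100 * r\<^sup>2" by (simp add: power_mult_distrib power_divide)
  ultimately have "(norm (D_op P (vt + t *\<^sub>R u) u))\<^sup>2 \<le> (11 / 10 * r)\<^sup>2"
    using a_eq[OF t] by linarith
  then show ?thesis by (rule power2_le_imp_le) (use r0 in simp)
qed

text \<open>The suprema use the metric at the point where the derivative is taken, whereas \<open>u\<close> is measured by the metric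
at \<open>vt\<close>. The two differ by at most the factor \<open>11/10\<close>, whose fourth power is below two.\<close>

lemma derivative_bounds:
  assumes u: "norm (D_op P vt u) \<le> r" and t: "0 \<le> t" "t \<le> 1"
  shows "\<bar>(ddir u ^^ 3) logpost (vt + t *\<^sub>R u)\<bar> \<le> 2 * d3" "\<bar>(ddir u ^^ 4) logpost (vt + t *\<^sub>R u)\<bar> \<le> 2 * d4"
proof -
  note inU = segment_in_U0[OF u t]
  have r0: "0 < r" using r4 by simp
  have gen: "\<bar>(ddir u ^^ k) (structure_term P) (vt + t *\<^sub>R u)\<bar> \<le> 2 * d"
    if b: "\<And>w. norm (D_op P (vt + t *\<^sub>R u) w) \<le> r \<Longrightarrow> \<bar>dir_deriv k (structure_term P) (vt + t *\<^sub>R u) w\<bar> \<le> d"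
      and k: "0 < k" "(11 / 10) ^ k \<le> (2 :: real)" and d: "0 \<le> d" for k d
  proof -
    have "\<bar>(ddir u ^^ k) (structure_term P) (vt + t *\<^sub>R u)\<bar> * r ^ k \<le> d * norm (D_op P (vt + t *\<^sub>R u) u) ^ k"
      using F[OF inU] r0 k(1) b by (rule homogeneous_bound)
    also have "\<dots> \<le> d * (11 / 10 * r) ^ k"
      using self_concordance[OF u t] d by (intro mult_left_mono power_mono) auto
    also have "\<dots> \<le> d * (2 * r ^ k)"
      unfolding power_mult_distrib using d k(2) r0 by (intro mult_left_mono mult_right_mono) auto
    finally have "\<bar>(ddir u ^^ k) (structure_term P) (vt + t *\<^sub>R u)\<bar> * r ^ k \<le> (2 * d) * r ^ k" by simp
    then show ?thesis by (rule mult_right_le_imp_le) (use r0 in simp)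
  qed
  show "\<bar>(ddir u ^^ 3) logpost (vt + t *\<^sub>R u)\<bar> \<le> 2 * d3"
    using gen[OF bound3[OF inU] _ _ d3(1)] by (simp add: ddir_logpost_3 power_divide)
  show "\<bar>(ddir u ^^ 4) logpost (vt + t *\<^sub>R u)\<bar> \<le> 2 * d4"
    using gen[OF bound4[OF inU] _ _ d4] by (simp add: ddir_logpost_4 power_divide)
qed

lemma gradient_at_MAP: "ddir u logpost vt = 0"
  using MAP L by (intro critical_point[OF smooth_logpost, of "Ups P"]) (auto simp: is_MAP_def cond_L_def logpost_def)

lemma taylor:
  assumes "0 < k"
  shows "\<exists>t. 0 < t \<and> t < 1 \<and> logpost (vt + u) =
    (\<Sum>m<k. (ddir u ^^ m) logpost vt / fact m) + (ddir u ^^ k) logpost (vt + t *\<^sub>R u) / fact k"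
proof -
  have "\<exists>t. 0 < t \<and> t < 1 \<and> logpost (vt + 1 *\<^sub>R u) =
    (\<Sum>m<k. (ddir u ^^ m) logpost (vt + 0 *\<^sub>R u) / fact m * 1 ^ m) + (ddir u ^^ k) logpost (vt + t *\<^sub>R u) / fact k * 1 ^ k"
  proof (rule Maclaurin[OF _ assms])
    show "\<forall>m t. m < k \<and> 0 \<le> t \<and> t \<le> 1 \<longrightarrow>
      ((\<lambda>t. (ddir u ^^ m) logpost (vt + t *\<^sub>R u)) has_real_derivative (ddir u ^^ Suc m) logpost (vt + t *\<^sub>R u)) (at t)"
      using smooth_along_line_real[OF smooth_ddir_iterate[OF smooth_logpost]] by simp
  qed simp_all
  then show ?thesis by simp
qed

lemma taylor_3:
  assumes u: "norm (D_op P vt u) \<le> r"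
  shows "\<bar>logpost (vt + u) - logpost vt + Fisher_G P vt u \<bullet> u / 2\<bar> \<le> d3 / 3"
proof -
  obtain t where t: "0 < t" "t < 1" "logpost (vt + u) =
    (\<Sum>m<3. (ddir u ^^ m) logpost vt / fact m) + (ddir u ^^ 3) logpost (vt + t *\<^sub>R u) / fact 3"
    using taylor[of 3 u] by auto
  have "(\<Sum>m<3. (ddir u ^^ m) logpost vt / fact m) = logpost vt - Fisher_G P vt u \<bullet> u / 2"
    by (simp add: eval_nat_numeral gradient_at_MAP ddir_ddir_logpost)
  then have e: "logpost (vt + u) - logpost vt + Fisher_G P vt u \<bullet> u / 2 = (ddir u ^^ 3) logpost (vt + t *\<^sub>R u) / 6"
    using t(3) by (simp add: fact_numeral)
  show ?thesis unfolding e using derivative_bounds(1)[OF u, of t] t(1,2) by simp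
qed

text \<open>The cubic terms for \<open>u\<close> and \<open>- u\<close> cancel, so that only the fourth-order remainder is left.\<close>

lemma taylor_even:
  assumes u: "norm (D_op P vt u) \<le> r"
  shows "\<bar>logpost (vt + u) + logpost (vt - u) - 2 * logpost vt + Fisher_G P vt u \<bullet> u\<bar> \<le> d4 / 6"
proof -
  have exp: "\<exists>R. \<bar>R\<bar> \<le> d4 / 12 \<and> logpost (vt + w) = logpost vt - Fisher_G P vt w \<bullet> w / 2 + (ddir w ^^ 3) logpost vt / 6 + R"
    if w: "norm (D_op P vt w) \<le> r" for w
  proof -
    obtain t where t: "0 < t" "t < 1" "logpost (vt + w) =
      (\<Sum>m<4. (ddir w ^^ m) logpost vt / fact m) + (ddir w ^^ 4) logpost (vt + t *\<^sub>R w) / fact 4"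
      using taylor[of 4 w] by auto
    have "(\<Sum>m<4. (ddir w ^^ m) logpost vt / fact m)
        = (\<Sum>m<3. (ddir w ^^ m) logpost vt / fact m) + (ddir w ^^ 3) logpost vt / fact 3"
      using sum.lessThan_Suc[of "\<lambda>m. (ddir w ^^ m) logpost vt / fact m" 3] by (simp add: eval_nat_numeral)
    moreover have "(\<Sum>m<3. (ddir w ^^ m) logpost vt / fact m) = logpost vt - Fisher_G P vt w \<bullet> w / 2"
      by (simp add: eval_nat_numeral gradient_at_MAP ddir_ddir_logpost)
    ultimately show ?thesis
      using t derivative_bounds(2)[OF w, of t]
      by (intro exI[of _ "(ddir w ^^ 4) logpost (vt + t *\<^sub>R w) / 24"]) (simp add: fact_numeral)
  qed
  have n: "norm (D_op P vt (- u)) \<le> r" using u by (simp add: linear_neg[OF linear_D[OF vt]])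
  have odd: "(ddir (- u) ^^ 3) logpost vt = - (ddir u ^^ 3) logpost vt"
    using ddir_scale_iterate[OF smooth_logpost, of 3 "-1" u] by simp
  have even: "Fisher_G P vt (- u) \<bullet> (- u) = Fisher_G P vt u \<bullet> u"
    by (simp add: linear_neg[OF linear_Fisher_G])
  obtain R R' where "\<bar>R\<bar> \<le> d4 / 12" "\<bar>R'\<bar> \<le> d4 / 12"
    "logpost (vt + u) = logpost vt - Fisher_G P vt u \<bullet> u / 2 + (ddir u ^^ 3) logpost vt / 6 + R"
    "logpost (vt - u) = logpost vt - Fisher_G P vt u \<bullet> u / 2 + - (ddir u ^^ 3) logpost vt / 6 + R'"
    using exp[OF u] exp[OF n] unfolding odd even add_uminus_conv_diff by blast
  then show ?thesis by linarith
qed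

end

section \<open>From the posterior to whitened coordinates\<close>

context laplace_point
begin

lemma norm_D_op_MAP: "(norm (D_op P vt u))\<^sup>2 = Fisher P vt u \<bullet> u"
  by (rule norm_D_op[OF F[OF vt]])

lemma logpost_measurable [measurable]: "logpost \<in> borel_measurable borel"
  by (intro borel_measurable_continuous_onI smooth_continuous smooth_logpost)

text \<open>In the diagonalising coordinates the region \<open>\<parallel>D u\<parallel> \<le> r\<close>, on which the Taylor bounds hold, becomes
\<open>diag l z \<bullet> z \<le> r\<^sup>2\<close>; openness and concavity pass through the affine map.\<close>

lemma whitening:
  obtains Lm :: "'x \<times> 'y \<Rightarrow> 'x \<times> 'y" and l where
    "linear Lm" "bij Lm" "orthogonal_transformation (D_G_op P vt \<circ> Lm)"
    "diagonal_laplace l r x (d3 / 3) {z. vt + Lm z \<in> Ups P} (\<lambda>z. logpost (vt + Lm z) - logpost vt)"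
    "\<And>z. diag l z \<bullet> z \<le> r\<^sup>2 \<Longrightarrow>
       \<bar>(logpost (vt + Lm z) - logpost vt) + (logpost (vt + Lm (- z)) - logpost vt) + z \<bullet> z\<bar> \<le> d4 / 6"
proof -
  obtain Lm :: "'x \<times> 'y \<Rightarrow> 'x \<times> 'y" and l where Lm: "linear Lm" "bij Lm" "orthogonal_transformation (psd_sqrt (Fisher_G P vt) \<circ> Lm)"
    and FG: "\<And>z. Fisher_G P vt (Lm z) \<bullet> Lm z = z \<bullet> z" and Fd: "\<And>z. Fisher P vt (Lm z) \<bullet> Lm z = diag l z \<bullet> z"
    and l: "\<And>b. b \<in> Basis \<Longrightarrow> 0 \<le> l b \<and> l b \<le> 1"
    and tr: "op_trace (Fisher P vt \<circ> inv (Fisher_G P vt)) = (\<Sum>b\<in>Basis. l b)"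
    using simultaneous_diagonalization[OF pos_def_Fisher_G[OF F[OF vt]] F[OF vt] Fisher_le_Fisher_G] by metis
  have r0: "0 \<le> r" using r4 by simp
  have local: "norm (D_op P vt (Lm z)) \<le> r" if "diag l z \<bullet> z \<le> r\<^sup>2" for z
    by (rule power2_le_imp_le[OF _ r0]) (use that in \<open>simp add: norm_D_op_MAP Fd\<close>)
  have cL: "continuous_on UNIV (\<lambda>z. vt + Lm z)"
    using Lm(1) by (intro continuous_intros linear_continuous_on) (simp add: linear_conv_bounded_linear)
  have open_V: "open {z. vt + Lm z \<in> Ups P}"
    using open_vimage[OF _ cL, of "Ups P"] L by (simp add: cond_L_def vimage_def)
  have comb: "vt + Lm (u *\<^sub>R z + v *\<^sub>R w) = u *\<^sub>R (vt + Lm z) + v *\<^sub>R (vt + Lm w)" if "u + v = 1" for u v :: real and z w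
  proof -
    have "u *\<^sub>R vt + v *\<^sub>R vt = vt" using that by (metis scaleR_add_left scaleR_one)
    then show ?thesis by (simp add: linear_add[OF Lm(1)] linear_scale[OF Lm(1)] scaleR_add_right)
  qed
  have conc: "concave_on {z. vt + Lm z \<in> Ups P} (\<lambda>z. logpost (vt + Lm z) - logpost vt)"
    unfolding concave_on_iff
  proof (intro conjI ballI allI impI convexI)
    fix z w :: "'x \<times> 'y" and u v :: real
    assume *: "z \<in> {z. vt + Lm z \<in> Ups P}" "w \<in> {z. vt + Lm z \<in> Ups P}" "0 \<le> u" "0 \<le> v" "u + v = 1"
    show "u *\<^sub>R z + v *\<^sub>R w \<in> {z. vt + Lm z \<in> Ups P}"
      using * L by (simp add: comb cond_L_def convexD)
    have "u * logpost (vt + Lm z) + v * logpost (vt + Lm w) \<le> logpost (vt + Lm (u *\<^sub>R z + v *\<^sub>R w))"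
      using concave_logpost[OF L] * unfolding concave_on_iff comb[OF *(5)] by simp
    moreover have "u * logpost vt + v * logpost vt = logpost vt" using *(5) by (metis distrib_right mult_1)
    ultimately show "u * (logpost (vt + Lm z) - logpost vt) + v * (logpost (vt + Lm w) - logpost vt)
        \<le> logpost (vt + Lm (u *\<^sub>R z + v *\<^sub>R w)) - logpost vt"
      by (simp add: algebra_simps)
  qed
  have 1: "diagonal_laplace l r x (d3 / 3) {z. vt + Lm z \<in> Ups P} (\<lambda>z. logpost (vt + Lm z) - logpost vt)"
  proof
    note [measurable] = linear_borel_measurable[OF Lm(1)]
    show "(\<lambda>z. logpost (vt + Lm z) - logpost vt) \<in> borel_measurable borel" by measurable
    show "z \<in> {z. vt + Lm z \<in> Ups P}" if "diag l z \<bullet> z \<le> r\<^sup>2" for z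
      using segment_in_U0[OF local[OF that], of 1] U0 by auto
    show "\<bar>logpost (vt + Lm z) - logpost vt + z \<bullet> z / 2\<bar> \<le> d3 / 3" if "diag l z \<bullet> z \<le> r\<^sup>2" for z
      using taylor_3[OF local[OF that]] by (simp add: FG)
    show "2 * sqrt (\<Sum>b\<in>Basis. l b) + sqrt x \<le> r" using r by (simp add: eff_dim_def tr)
  qed (use l open_V conc d3 x in auto)
  have 2: "\<bar>(logpost (vt + Lm z) - logpost vt) + (logpost (vt + Lm (- z)) - logpost vt) + z \<bullet> z\<bar> \<le> d4 / 6"
    if "diag l z \<bullet> z \<le> r\<^sup>2" for z
    using taylor_even[OF local[OF that]] by (simp add: FG linear_neg[OF Lm(1)])
  show ?thesis using that[OF Lm(1,2) _ 1 2] Lm(3) by (simp add: D_G_op_def)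
qed

text \<open>The composition of \<open>D_G_op\<close> with the whitening map is a rotation, under which the Gaussian law is invariant.\<close>

lemma gauss_pushforward:
  fixes Lm :: "'x \<times> 'y \<Rightarrow> 'x \<times> 'y"
  assumes R: "orthogonal_transformation (D_G_op P vt \<circ> Lm)" and lin: "linear Lm" and [measurable]: "B \<in> sets borel"
  shows "measure std_gauss {\<gamma>. inv (D_G_op P vt) \<gamma> \<in> B} = measure std_gauss {z. Lm z \<in> B}"
proof -
  define D where "D = D_G_op P vt"
  have D: "pos_def D" unfolding D_def D_G_op_def by (intro pos_def_psd_sqrt pos_def_Fisher_G F vt)
  have "linear (inv D)"
    using self_adjoint_inv[OF _ pos_def_bij[OF D]] D by (simp add: pos_def_def self_adjoint_linear)
  note [measurable] = linear_borel_measurable[OF this] linear_borel_measurable[OF lin]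
  have [simp]: "inv D (D z) = z" for z using pos_def_bij[OF D] by (simp add: bij_is_inj)
  have "emeasure std_gauss {\<gamma>. inv D \<gamma> \<in> B} = (\<integral>\<^sup>+\<gamma>. indicator {\<gamma>. inv D \<gamma> \<in> B} \<gamma> \<partial>std_gauss)"
    by (intro nn_integral_indicator[symmetric]) measurable
  also have "\<dots> = (\<integral>\<^sup>+z. indicator {\<gamma>. inv D \<gamma> \<in> B} ((D \<circ> Lm) z) \<partial>std_gauss)"
    by (intro nn_integral_std_gauss_orthogonal[OF R[folded D_def], symmetric]) measurable
  also have "\<dots> = (\<integral>\<^sup>+z. indicator {z. Lm z \<in> B} z \<partial>std_gauss)"
    by (intro nn_integral_cong) (simp add: indicator_def)
  also have "\<dots> = emeasure std_gauss {z. Lm z \<in> B}"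
    by (intro nn_integral_indicator) measurable
  finally show ?thesis by (simp add: measure_def D_def)
qed

text \<open>The Jacobian of the whitening map, the normalisation of the Gaussian density and the value of the
log-posterior at its maximum are common factors of numerator and denominator.\<close>

lemma posterior_pullback:
  fixes Lm :: "'x \<times> 'y \<Rightarrow> 'x \<times> 'y"
  assumes lap: "diagonal_laplace l r x (d3 / 3) {z. vt + Lm z \<in> Ups P} (\<lambda>z. logpost (vt + Lm z) - logpost vt)"
    and lin: "linear Lm" "bij Lm" and B: "B \<in> sets borel"
  shows "measure (posterior P (Obs P \<omega>)) {\<upsilon>. \<upsilon> - vt \<in> B}
    = diagonal_laplace.post {z. vt + Lm z \<in> Ups P} (\<lambda>z. logpost (vt + Lm z) - logpost vt) {z. Lm z \<in> B}"
proof -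
  interpret diagonal_laplace l r x "d3 / 3" "{z. vt + Lm z \<in> Ups P}" "\<lambda>z. logpost (vt + Lm z) - logpost vt"
    by (rule lap)
  note [measurable] = linear_borel_measurable[OF lin(1)]
  have [measurable]: "Ups P \<in> sets borel" using L by (simp add: cond_L_def borel_open)
  define I where "I B = (LINT z|std_gauss. indicator {z. Lm z \<in> B} z * E z)" for B :: "('x \<times> 'y) set"
  have I0: "0 \<le> I B" for B
    unfolding I_def using E_nonneg by (intro integral_nonneg_AE) auto
  define f where "f \<upsilon> = ennreal (indicator (Ups P) \<upsilon> * exp (logpost \<upsilon>))" for \<upsilon>
  have f [measurable]: "f \<in> borel_measurable borel" unfolding f_def[abs_def] by measurable
  define \<mu> where "\<mu> = density lborel f"
  obtain k where k: "0 < k" "k < \<infinity>"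
    "\<And>h. h \<in> borel_measurable borel \<Longrightarrow> (\<integral>\<^sup>+z. h (Lm z) \<partial>lborel) = k * (\<integral>\<^sup>+z. h z \<partial>lborel)"
    using nn_integral_lborel_linear[OF lin] by metis
  obtain kr where kr: "k = ennreal kr" "0 < kr"
    using k(1,2) by (cases k) (auto simp: zero_less_iff_neq_zero ennreal_eq_0_iff)
  define c where "c = exp (logpost vt) / (\<kappa> * kr)"
  have c: "c > 0" using \<kappa> kr by (simp add: c_def)
  have mass: "emeasure \<mu> {\<upsilon>. \<upsilon> - vt \<in> B} = ennreal (c * I B)" if [measurable]: "B \<in> sets borel" for B
  proof -
    have "emeasure \<mu> {\<upsilon>. \<upsilon> - vt \<in> B} = (\<integral>\<^sup>+\<upsilon>. f \<upsilon> * indicator B (\<upsilon> - vt) \<partial>lborel)"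
      unfolding \<mu>_def by (subst emeasure_density) (auto intro!: nn_integral_cong simp: indicator_def)
    also have "\<dots> = (\<integral>\<^sup>+w. f (vt + w) * indicator B (vt + w - vt) \<partial>lborel)"
      by (rule nn_integral_lborel_translate[symmetric]) measurable
    also have "\<dots> = (\<integral>\<^sup>+w. f (vt + w) * indicator B w \<partial>lborel)" by simp
    finally have "k * emeasure \<mu> {\<upsilon>. \<upsilon> - vt \<in> B} = (\<integral>\<^sup>+z. f (vt + Lm z) * indicator B (Lm z) \<partial>lborel)"
      using k(3)[of "\<lambda>w. f (vt + w) * indicator B w"] by simp
    then have "ennreal \<kappa> * (k * emeasure \<mu> {\<upsilon>. \<upsilon> - vt \<in> B}) = (\<integral>\<^sup>+z. ennreal \<kappa> * (f (vt + Lm z) * indicator B (Lm z)) \<partial>lborel)"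
      by (simp add: nn_integral_cmult)
    also have "\<dots> = (\<integral>\<^sup>+z. ennreal (gauss_dens z) * ennreal (exp (logpost vt) * (indicator {z. Lm z \<in> B} z * E z)) \<partial>lborel)"
    proof (rule nn_integral_cong)
      fix z
      have "gauss_dens z * (exp (logpost vt) * (indicator {z. Lm z \<in> B} z * E z))
          = exp (logpost vt) * indicator B (Lm z) * (gauss_dens z * E z)" by (simp add: indicator_def)
      also have "\<dots> = \<kappa> * (indicator (Ups P) (vt + Lm z) * exp (logpost (vt + Lm z)) * indicator B (Lm z))"
        unfolding gauss_E by (auto simp: indicator_def exp_diff)
      finally show "ennreal \<kappa> * (f (vt + Lm z) * indicator B (Lm z))
          = ennreal (gauss_dens z) * ennreal (exp (logpost vt) * (indicator {z. Lm z \<in> B} z * E z))"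
        using gauss_dens_pos[of z] \<kappa>
        by (auto simp: f_def ennreal_mult'[symmetric] less_imp_le split: split_indicator split_indicator_asm)
    qed
    also have "\<dots> = (\<integral>\<^sup>+z. ennreal (exp (logpost vt) * (indicator {z. Lm z \<in> B} z * E z)) \<partial>std_gauss)"
      by (rule nn_integral_std_gauss[symmetric]) measurable
    also have "\<dots> = ennreal (LINT z|std_gauss. exp (logpost vt) * (indicator {z. Lm z \<in> B} z * E z))"
      using E_nonneg by (intro nn_integral_eq_integral) (auto intro!: integrable_E_set)
    also have "\<dots> = ennreal (exp (logpost vt) * I B)" by (simp add: I_def)
    finally have eq: "ennreal (\<kappa> * kr) * emeasure \<mu> {\<upsilon>. \<upsilon> - vt \<in> B} = ennreal (exp (logpost vt) * I B)"
      using \<kappa> kr by (simp add: ennreal_mult' less_imp_le mult.assoc)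
    have pos: "\<kappa> * kr > 0" using \<kappa> kr by simp
    have "ennreal (1 / (\<kappa> * kr)) * (ennreal (\<kappa> * kr) * emeasure \<mu> {\<upsilon>. \<upsilon> - vt \<in> B}) = emeasure \<mu> {\<upsilon>. \<upsilon> - vt \<in> B}"
      using pos \<kappa> kr(2) by (simp add: mult.assoc[symmetric] ennreal_mult'[symmetric])
    moreover have "ennreal (1 / (\<kappa> * kr)) * ennreal (exp (logpost vt) * I B) = ennreal (c * I B)"
      using pos by (subst ennreal_mult'[symmetric]) (auto simp: c_def)
    ultimately show ?thesis unfolding eq by simp
  qed
  have Z: "emeasure \<mu> UNIV = ennreal (c * I UNIV)" using mass[of UNIV] by simp
  have post: "posterior P (Obs P \<omega>) = scale_measure (1 / emeasure \<mu> UNIV) \<mu>"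
    by (simp add: posterior_def Let_def \<mu>_def f_def[abs_def] logpost_def)
  have "emeasure (posterior P (Obs P \<omega>)) {\<upsilon>. \<upsilon> - vt \<in> B} = (1 / ennreal (c * I UNIV)) * ennreal (c * I B)"
    unfolding post using mass[OF B] by (simp add: Z)
  also have "\<dots> = ennreal (I B / I UNIV)"
  proof (cases "I UNIV = 0")
    case True
    have "I B \<le> I UNIV" unfolding I_def
      using E_nonneg integrable_E_set[of UNIV] integrable_E_set[of "{z. Lm z \<in> B}"] B
      by (intro Bochner_Integration.integral_mono) (auto split: split_indicator)
    then have "I B = 0" using True I0[of B] by simp
    then show ?thesis using True by simp
  next
    case False
    then have "0 < I UNIV" using I0[of UNIV] by simp
    then show ?thesis using c I0[of B]
      by (simp add: divide_ennreal ennreal_1[symmetric] ennreal_mult'[symmetric] del: ennreal_1)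
  qed
  finally have "measure (posterior P (Obs P \<omega>)) {\<upsilon>. \<upsilon> - vt \<in> B} = I B / I UNIV"
    using I0[of B] I0[of UNIV] by (simp add: measure_def)
  then show ?thesis by (simp add: post_def I_def)
qed

lemma posterior_gap_le:
  assumes B: "B \<in> sets borel"
  shows "posterior_gap P \<omega> vt B \<le> 4 * (2 * (d3 / 3) + 72 * exp (- x / 2))"
proof -
  obtain Lm :: "'x \<times> 'y \<Rightarrow> 'x \<times> 'y" and l where Lm: "linear Lm" "bij Lm" "orthogonal_transformation (D_G_op P vt \<circ> Lm)"
    and lap: "diagonal_laplace l r x (d3 / 3) {z. vt + Lm z \<in> Ups P} (\<lambda>z. logpost (vt + Lm z) - logpost vt)"
    using whitening by metis
  note [measurable] = linear_borel_measurable[OF Lm(1)] B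
  have "{z. Lm z \<in> B} \<in> sets borel" by measurable
  from diagonal_laplace.post_error[OF lap this] show ?thesis
    by (simp add: posterior_gap_def posterior_pullback[OF lap Lm(1,2) B] gauss_pushforward[OF Lm(3,1) B])
qed

lemma posterior_gap_symmetric_le:
  assumes B: "B \<in> sym_borel"
  shows "posterior_gap P \<omega> vt B \<le> 4 * (d4 / 6 / 2 + (d3 / 3)\<^sup>2 + 72 * exp (- x / 2))"
proof -
  obtain Lm :: "'x \<times> 'y \<Rightarrow> 'x \<times> 'y" and l where Lm: "linear Lm" "bij Lm" "orthogonal_transformation (D_G_op P vt \<circ> Lm)"
    and lap: "diagonal_laplace l r x (d3 / 3) {z. vt + Lm z \<in> Ups P} (\<lambda>z. logpost (vt + Lm z) - logpost vt)"
    and even: "\<And>z. diag l z \<bullet> z \<le> r\<^sup>2 \<Longrightarrow>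
       \<bar>(logpost (vt + Lm z) - logpost vt) + (logpost (vt + Lm (- z)) - logpost vt) + z \<bullet> z\<bar> \<le> d4 / 6"
    using whitening by metis
  have Bb: "B \<in> sets borel" and sym: "uminus ` B = B" using B by (auto simp: sym_borel_def)
  note [measurable] = linear_borel_measurable[OF Lm(1)] Bb
  have "{z. Lm z \<in> B} \<in> sets borel" by measurable
  moreover have "- z \<in> {z. Lm z \<in> B} \<longleftrightarrow> z \<in> {z. Lm z \<in> B}" for z
  proof -
    have "- w \<in> B" if "w \<in> B" for w using sym that by blast
    from this[of "Lm z"] this[of "- Lm z"] show ?thesis by (auto simp: linear_neg[OF Lm(1)])
  qed
  ultimately show ?thesis
    using diagonal_laplace.post_error_symmetric[OF lap, of "{z. Lm z \<in> B}" "d4 / 6"] even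
    by (simp add: posterior_gap_def posterior_pullback[OF lap Lm(1,2) Bb] gauss_pushforward[OF Lm(3,1) Bb]
        diagonal_laplace.K_def[OF lap] diagonal_laplace.q_def[OF lap])
qed

end

section \<open>Assembly of the bounds\<close>

lemma (in calming_setting) psd_B_SG:
  assumes F: "psd (Fisher P \<upsilon>)" and S: "pos_def S"
  shows "psd (B_SG P S \<upsilon>)"
proof -
  note T = psd_inv[OF pos_def_Fisher_G[OF F]]
  note linT = psd_linear[OF T]
  have saS: "self_adjoint S" using S by (simp add: pos_def_def)
  have H: "HG_inv P \<upsilon> g \<bullet> h = inv (Fisher_G P \<upsilon>) (0, g) \<bullet> (0, h)" for g h
    by (simp add: HG_inv_def gg_block_def inner_prod_def)
  have q: "B_SG P S \<upsilon> u \<bullet> v = 1 / (sig P)\<^sup>2 * (inv (Fisher_G P \<upsilon>) (0, S u) \<bullet> (0, S v))" for u v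
    by (simp add: B_SG_def self_adjointD[OF saS] H)
  have "linear (\<lambda>g. snd (inv (Fisher_G P \<upsilon>) (0, S g)))"
  proof (rule linearI)
    show "snd (inv (Fisher_G P \<upsilon>) (0, S (g + h))) = snd (inv (Fisher_G P \<upsilon>) (0, S g)) + snd (inv (Fisher_G P \<upsilon>) (0, S h))" for g h
      using linear_add[OF linT, of "(0, S g)" "(0, S h)"] by (simp add: linear_add[OF self_adjoint_linear[OF saS]])
    show "snd (inv (Fisher_G P \<upsilon>) (0, S (a *\<^sub>R g))) = a *\<^sub>R snd (inv (Fisher_G P \<upsilon>) (0, S g))" for a g
      using linear_scale[OF linT, of a "(0, S g)"] by (simp add: linear_scale[OF self_adjoint_linear[OF saS]])
  qed
  from linear_compose_scale_right[OF linear_compose[OF this self_adjoint_linear[OF saS]]]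
  have "linear (B_SG P S \<upsilon>)"
    unfolding B_SG_def HG_inv_def gg_block_def by (simp add: o_def)
  moreover have "B_SG P S \<upsilon> u \<bullet> v = u \<bullet> B_SG P S \<upsilon> v" for u v
  proof -
    have "inv (Fisher_G P \<upsilon>) (0, S u) \<bullet> (0, S v) = inv (Fisher_G P \<upsilon>) (0, S v) \<bullet> (0, S u)"
      using self_adjointD[OF psd_self_adjoint[OF T], of "(0, S u)" "(0, S v)"] by (simp only: inner_commute)
    then show ?thesis unfolding inner_commute[of u "B_SG P S \<upsilon> v"] q by simp
  qed
  moreover have "0 \<le> B_SG P S \<upsilon> u \<bullet> u" for u
    unfolding q using psd_nonneg[OF T] by (intro mult_nonneg_nonneg) simp_all
  ultimately show ?thesis by (simp add: psd_def self_adjoint_def)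
qed

lemma (in calming_setting) eff_dim_nonneg:
  assumes F: "psd (Fisher P \<upsilon>)" shows "0 \<le> eff_dim P \<upsilon>"
proof (rule simultaneous_diagonalization[OF pos_def_Fisher_G[OF F] F Fisher_le_Fisher_G])
  fix l :: "'x \<times> 'y \<Rightarrow> real"
  assume "\<And>b. b \<in> Basis \<Longrightarrow> 0 \<le> l b \<and> l b \<le> 1"
    and "op_trace (Fisher P \<upsilon> \<circ> inv (Fisher_G P \<upsilon>)) = (\<Sum>b\<in>Basis. l b)"
  then show ?thesis by (simp add: eff_dim_def sum_nonneg)
qed

text \<open>This includes the degenerate cases of a total mass \<open>0\<close> or \<open>\<infinity>\<close>, in which every set
has measure \<open>0\<close> by the conventions \<open>1 / 0 = \<infinity>\<close>, \<open>1 / \<infinity> = 0\<close> and \<open>0 * \<infinity> = 0\<close>.\<close>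

lemma measure_posterior_le_1: "measure (posterior P y) A \<le> 1"
proof -
  define \<mu> where "\<mu> = density lborel (\<lambda>\<upsilon>. ennreal (indicator (Ups P) \<upsilon> * exp (loglik_G P y \<upsilon>)))"
  have "emeasure (posterior P y) A = 1 / emeasure \<mu> UNIV * emeasure \<mu> A"
    by (simp add: posterior_def Let_def \<mu>_def)
  also have "\<dots> \<le> 1 / emeasure \<mu> UNIV * emeasure \<mu> UNIV"
    using emeasure_space[of \<mu> A] by (intro mult_left_mono) (auto simp: \<mu>_def)
  also have "\<dots> \<le> 1"
  proof (cases "emeasure \<mu> UNIV = 0 \<or> emeasure \<mu> UNIV = \<infinity>")
    case True then show ?thesis by auto
  next
    case False
    then show ?thesis by (simp add: ennreal_divide_times less_top)
  qed
  finally show ?thesis by (simp add: measure_def enn2real_leI)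
qed

lemma posterior_gap_le_1: "posterior_gap P \<omega> vt B \<le> 1"
proof -
  have "0 \<le> measure (posterior P (Obs P \<omega>)) {\<upsilon>. \<upsilon> - vt \<in> B}" "measure (posterior P (Obs P \<omega>)) {\<upsilon>. \<upsilon> - vt \<in> B} \<le> 1"
    by (simp_all add: measure_posterior_le_1)
  moreover have "0 \<le> measure std_gauss {\<gamma>. inv (D_G_op P vt) \<gamma> \<in> B}" "measure std_gauss {\<gamma>. inv (D_G_op P vt) \<gamma> \<in> B} \<le> 1"
    by simp_all
  ultimately show ?thesis unfolding posterior_gap_def by linarith
qed

lemma delta_upper: "\<upsilon> \<in> U0 \<Longrightarrow> norm (D_op P \<upsilon> u) \<le> r \<Longrightarrow> ereal \<bar>dir_deriv k (structure_term P) \<upsilon> u\<bar> \<le> delta P U0 k r"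
  unfolding delta_def by (intro SUP_upper2[of \<upsilon>] SUP_upper2[of u]) auto

context laplace_point
begin

lemma posterior_linear_tail:
  fixes Q :: "'x \<times> 'y \<Rightarrow> 'b::euclidean_space"
  assumes Q: "linear Q"
  shows "measure (posterior P (Obs P \<omega>)) {\<upsilon>. norm (Q (\<upsilon> - vt)) >
      z_quant (Q \<circ> inv (D_G_op P vt) \<circ> inv (D_G_op P vt) \<circ> adjoint Q) x}
    \<le> 4 * (d4 / 6 / 2 + (d3 / 3)\<^sup>2 + 72 * exp (- x / 2)) + exp (- x)"
proof -
  define D where "D = D_G_op P vt"
  have D: "pos_def D" unfolding D_def D_G_op_def by (intro pos_def_psd_sqrt pos_def_Fisher_G F vt)
  have saD: "self_adjoint (inv D)" by (rule psd_self_adjoint[OF psd_inv[OF D]])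
  have linM: "linear (Q \<circ> inv D)" by (intro linear_compose Q self_adjoint_linear[OF saD])
  have "adjoint (Q \<circ> inv D) = inv D \<circ> adjoint Q"
    by (rule adjoint_unique) (simp add: self_adjointD[OF saD, symmetric] adjoint_works[OF Q])
  then have adj: "(Q \<circ> inv D) \<circ> adjoint (Q \<circ> inv D) = Q \<circ> inv D \<circ> inv D \<circ> adjoint Q"
    by (simp add: comp_assoc)
  define z where "z = z_quant (Q \<circ> inv D \<circ> inv D \<circ> adjoint Q) x"
  define B where "B = {u. norm (Q u) > z}"
  have cQ: "continuous_on UNIV (\<lambda>u. norm (Q u))"
    using Q by (intro continuous_on_norm linear_continuous_on) (simp add: linear_conv_bounded_linear)
  have "open B" unfolding B_def by (intro open_Collect_less cQ continuous_on_const)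
  moreover have "uminus ` B = B"
  proof -
    have m: "- u \<in> B" if "u \<in> B" for u using that by (simp add: B_def linear_neg[OF Q])
    show ?thesis
    proof (intro equalityI subsetI)
      fix u assume "u \<in> uminus ` B" then show "u \<in> B" using m by auto
    next
      fix u assume "u \<in> B"
      then have "- u \<in> B" by (rule m)
      then show "u \<in> uminus ` B" by (rule rev_image_eqI) simp
    qed
  qed
  ultimately have "B \<in> sym_borel" by (simp add: sym_borel_def)
  from posterior_gap_symmetric_le[OF this]
  have "measure (posterior P (Obs P \<omega>)) {\<upsilon>. \<upsilon> - vt \<in> B} \<le>
      4 * (d4 / 6 / 2 + (d3 / 3)\<^sup>2 + 72 * exp (- x / 2)) + measure std_gauss {\<gamma>. inv D \<gamma> \<in> B}"
    unfolding posterior_gap_def D_def by linarith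
  also have "measure std_gauss {\<gamma>. inv D \<gamma> \<in> B} \<le> exp (- x)"
    using gauss_image_tail[OF linM, of x] x unfolding adj by (simp add: B_def z_def)
  finally show ?thesis by (simp add: B_def z_def D_def)
qed

end

text \<open>For \<open>n \<le> 10\<^sup>6\<close> the right-hand sides are at least one. Otherwise \<open>x \<ge> 16\<close>, the local conditions hold at the maximum
a posteriori point, and \<open>exp (-x/2) = 1/n\<close> turns the tail terms into multiples of \<open>1/n\<close>.\<close>

lemma corollary_bounds:
  fixes P :: "('w, 'x::euclidean_space, 'y::euclidean_space) calming_model"
  assumes model: "is_model P" and target: "is_target P vs" and L: "cond_L P"
    and ES: "cond_ES P S \<infinity> \<nu>0" and n: "1 \<le> n" and x: "x = 2 * ln n"
    and Om: "(1 / (sig P)\<^sup>2) * (noise P \<omega> \<bullet> HG_inv P vs (noise P \<omega>)) \<le> (z_quant (B_SG P S vs) x)\<^sup>2"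
    and MAP: "is_MAP P \<omega> vt"
    and rG: "0 < rG" and r0: "0 < r0" and U0: "U0 \<subseteq> Ups P" and F: "\<forall>\<upsilon>\<in>U0. psd (Fisher P \<upsilon>)"
    and ballG: "local_ball_G P vs rG \<subseteq> U0"
    and nbhd: "\<forall>\<upsilon>\<in>local_ball_G P vs rG. {\<upsilon>'. norm (D_op P \<upsilon> (\<upsilon>' - \<upsilon>)) \<le> r0} \<subseteq> U0"
    and delta: "3 * delta3_G P vs rG / ereal (rG\<^sup>2) \<le> ereal \<rho>" and \<rho>: "\<rho> \<le> 1 / 2"
    and z: "z_quant (B_SG P S vs) x \<le> (1 - \<rho>) * rG"
    and dia: "diamond P U0 r0 \<le> ereal (1 / 2)"
    and rad: "\<forall>\<upsilon>\<in>U0. ereal (2 * sqrt (eff_dim P \<upsilon>) + sqrt x) \<le> C0_const P U0 r0 * ereal r0"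
  shows "(SUP B\<in>sym_borel. ereal (posterior_gap P \<omega> vt B)) \<le> ereal (10 ^ 6) * (diamond P U0 r0 + ereal (1 / n)) \<and>
        (SUP B\<in>sets borel. ereal (posterior_gap P \<omega> vt B)) \<le> ereal (10 ^ 6) * (delta P U0 3 r0 + ereal (1 / n)) \<and>
        (\<forall>Q :: 'x \<times> 'y \<Rightarrow> 'b::euclidean_space. linear Q \<longrightarrow>
          ereal (measure (posterior P (Obs P \<omega>))
             {\<upsilon>. norm (Q (\<upsilon> - vt)) > z_quant (Q \<circ> inv (D_G_op P vt) \<circ> inv (D_G_op P vt) \<circ> adjoint Q) x})
          \<le> ereal (10 ^ 6) * (diamond P U0 r0 + ereal (1 / n)))"
proof -
  interpret calming_observation P \<omega>
    using model ES by unfold_locales (auto simp: cond_ES_def)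
  have x0: "0 \<le> x" using n x by simp
  have "linear (D_G_op P vs)"
    unfolding D_G_op_def by (intro psd_linear psd_psd_sqrt psd_Fisher_G_target[OF target L])
  then have "vs \<in> local_ball_G P vs rG" using rG by (simp add: local_ball_G_def linear_0)
  then have vs: "vs \<in> U0" using ballG by blast
  then have Fs: "psd (Fisher P vs)" using F by blast
  have zero_D: "norm (D_op P vs 0) \<le> r0"
    using r0 psd_linear[OF psd_psd_sqrt[OF Fs]] by (simp add: D_op_def linear_0)
  have delta0: "0 \<le> delta P U0 k r0" for k
    using delta_upper[OF vs zero_D, of k] by (rule order_trans[rotated]) simp
  obtain d3 d4 where d3: "delta P U0 3 r0 = ereal d3" and d4: "delta P U0 4 r0 = ereal d4"
    and d30: "0 \<le> d3" and d40: "0 \<le> d4"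
    using dia delta0[of 3] delta0[of 4] unfolding diamond_def
    by (cases "delta P U0 3 r0"; cases "delta P U0 4 r0") (auto simp: power2_eq_square)
  have diamond: "diamond P U0 r0 = ereal (4 * d3\<^sup>2 + 4 * d4)"
    by (simp add: diamond_def d3 d4 power2_eq_square)
  have small: "4 * d3\<^sup>2 + 4 * d4 \<le> 1 / 2" using dia by (simp add: diamond)
  have C0: "C0_const P U0 r0 = ereal (1 - 3 / r0\<^sup>2 * d3)"
    by (simp add: C0_const_def d3 one_ereal_def)
  define gb where "gb B = posterior_gap P \<omega> vt B" for B
  have main: "(\<forall>B\<in>sym_borel. gb B \<le> 10 ^ 6 * (4 * d3\<^sup>2 + 4 * d4 + 1 / n)) \<and>
    (\<forall>B\<in>sets borel. gb B \<le> 10 ^ 6 * (d3 + 1 / n)) \<and>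
    (\<forall>Q :: 'x \<times> 'y \<Rightarrow> 'b. linear Q \<longrightarrow> measure (posterior P (Obs P \<omega>))
       {\<upsilon>. norm (Q (\<upsilon> - vt)) > z_quant (Q \<circ> inv (D_G_op P vt) \<circ> inv (D_G_op P vt) \<circ> adjoint Q) x}
      \<le> 10 ^ 6 * (4 * d3\<^sup>2 + 4 * d4 + 1 / n))"
  proof (cases "n \<le> 10 ^ 6")
    case True
    have "1 \<le> 10 ^ 6 * (1 / n)" using True n by (simp add: field_simps)
    moreover have "10 ^ 6 * (1 / n) \<le> 10 ^ 6 * (4 * d3\<^sup>2 + 4 * d4 + 1 / n)"
      using d40 by (intro mult_left_mono) auto
    moreover have "10 ^ 6 * (1 / n) \<le> 10 ^ 6 * (d3 + 1 / n)"
      using d30 by (intro mult_left_mono) auto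
    ultimately have "1 \<le> 10 ^ 6 * (4 * d3\<^sup>2 + 4 * d4 + 1 / n)" "1 \<le> 10 ^ 6 * (d3 + 1 / n)"
      by linarith+
    then show ?thesis
      using posterior_gap_le_1[of P \<omega> vt] measure_posterior_le_1[of P "Obs P \<omega>"]
      unfolding gb_def by (blast intro: order_trans)
  next
    case False
    have "exp 8 = exp (1 :: real) ^ 8" by (simp flip: exp_of_nat_mult)
    also have "\<dots> \<le> 3 ^ 8" by (intro power_mono exp_le) simp
    also have "\<dots> \<le> n" using False by simp
    finally have "8 \<le> ln n" using n by (simp add: ln_ge_iff)
    then have x16: "16 \<le> x" using x by simp
    have e1: "exp (- x / 2) = 1 / n" using n x by (simp add: exp_minus inverse_eq_divide)
    have e2: "exp (- x) \<le> 1 / n" unfolding e1[symmetric] using x0 by simp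
    have "z_quant (B_SG P S vs) x \<ge> 0"
      using ES by (intro z_quant_nonneg psd_B_SG Fs x0) (simp add: cond_ES_def)
    then have in_ball: "vt \<in> local_ball_G P vs rG"
      using ballG U0 by (intro MAP_in_local_ball[OF target L Fs MAP _ rG delta \<rho> _ z Om]) auto
    then have vt: "vt \<in> U0" using ballG by blast
    interpret laplace_point P \<omega> U0 r0 d3 d4 x vt
    proof
      show "\<And>\<upsilon> u. \<upsilon> \<in> U0 \<Longrightarrow> norm (D_op P \<upsilon> u) \<le> r0 \<Longrightarrow> \<bar>dir_deriv 3 (structure_term P) \<upsilon> u\<bar> \<le> d3"
        using delta_upper[where P = P and k = 3 and r = r0 and ?U0.0 = U0] by (simp add: d3)
      show "\<And>\<upsilon> u. \<upsilon> \<in> U0 \<Longrightarrow> norm (D_op P \<upsilon> u) \<le> r0 \<Longrightarrow> \<bar>dir_deriv 4 (structure_term P) \<upsilon> u\<bar> \<le> d4"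
        using delta_upper[where P = P and k = 4 and r = r0 and ?U0.0 = U0] by (simp add: d4)
      have "2 * sqrt (eff_dim P vt) + sqrt x \<le> (1 - 3 / r0\<^sup>2 * d3) * r0"
        using rad vt by (auto simp: C0)
      also have "\<dots> \<le> 1 * r0" using d30 r0 by (intro mult_right_mono) auto
      finally show "2 * sqrt (eff_dim P vt) + sqrt x \<le> r0" by simp
      show "0 \<le> eff_dim P vt" using F vt by (intro eff_dim_nonneg) auto
    qed (use L MAP U0 F nbhd in_ball vt small x16 in auto)
    have n0: "0 \<le> 1 / n" using n by simp
    have lin: "4 * (a / 6 / 2 + s / 9 + 72 * t) + t \<le> 10 ^ 6 * (4 * s + 4 * a + t)"
      if "0 \<le> a" "0 \<le> s" "0 \<le> t" for a s t :: real
      using that by simp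
    have lin1: "4 * (2 * (a / 3) + 72 * t) \<le> 10 ^ 6 * (a + t)" if "0 \<le> a" "0 \<le> t" for a t :: real
      using that by simp
    have sq: "(d3 / 3)\<^sup>2 = d3\<^sup>2 / 9" by (simp add: power_divide)
    note budget = lin[OF d40 zero_le_power2[of d3] n0, folded sq]
    show ?thesis
    proof (intro conjI ballI allI impI)
      fix B :: "('x \<times> 'y) set" assume "B \<in> sym_borel"
      then show "gb B \<le> 10 ^ 6 * (4 * d3\<^sup>2 + 4 * d4 + 1 / n)"
        using posterior_gap_symmetric_le[of B] budget n0 unfolding gb_def e1 by linarith
    next
      fix B :: "('x \<times> 'y) set" assume "B \<in> sets borel"
      then show "gb B \<le> 10 ^ 6 * (d3 + 1 / n)"
        using posterior_gap_le[of B] lin1[OF d30 n0] unfolding gb_def e1 by linarith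
    next
      fix Q :: "'x \<times> 'y \<Rightarrow> 'b" assume "linear Q"
      from posterior_linear_tail[OF this]
      show "measure (posterior P (Obs P \<omega>))
         {\<upsilon>. norm (Q (\<upsilon> - vt)) > z_quant (Q \<circ> inv (D_G_op P vt) \<circ> inv (D_G_op P vt) \<circ> adjoint Q) x}
        \<le> 10 ^ 6 * (4 * d3\<^sup>2 + 4 * d4 + 1 / n)"
        using budget e2 unfolding e1 by linarith
    qed
  qed
  have r1: "ereal (10 ^ 6) * (diamond P U0 r0 + ereal (1 / n)) = ereal (10 ^ 6 * (4 * d3\<^sup>2 + 4 * d4 + 1 / n))"
    by (simp add: diamond)
  have r2: "ereal (10 ^ 6) * (delta P U0 3 r0 + ereal (1 / n)) = ereal (10 ^ 6 * (d3 + 1 / n))"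
    by (simp add: d3)
  show ?thesis
    unfolding r1 r2 using main unfolding gb_def by (intro conjI SUP_least) auto
qed

(* C is chosen before the model.  Since HOL cannot also place it before a quantifier over the
   types 'w, 'x, 'y, 'm, a generous numerical cap keeps C from depending on them, that is,
   on the dimensions; the value of the cap has no significance.

   U0 is "local" for both radii: it contains the rG-vicinity of the target and the r0-vicinity of
   each point that the first vicinity leaves as a possible value of the MAP, so that the suprema
   delta over U0 control the Laplace expansion.  psd (Fisher P v) is what makes the root
   D_op P v meaningful. *)

theorem corollary4p7:
  shows "\<exists>C::real. 0 < C \<and> C \<le> 10 ^ 6 \<and>
    (\<forall>(P :: ('w, 'x::euclidean_space, 'y::euclidean_space) calming_model)
       S \<nu>0 CG U0 Ucirc n x \<Omega> \<rho> rG r0 \<upsilon>s \<upsilon>t.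
      is_model P \<longrightarrow>
      is_target P \<upsilon>s \<longrightarrow>
      cond_L P \<longrightarrow>
      cond_ES P S \<infinity> \<nu>0 \<longrightarrow>
      cond_GGam P \<upsilon>s CG \<longrightarrow>
      cond_L0 P U0 Ucirc \<longrightarrow>
      1 \<le> n \<longrightarrow> x = 2 * ln n \<longrightarrow>
      \<Omega> \<in> sets (Pr P) \<longrightarrow> 1 - exp (- x) \<le> measure (Pr P) \<Omega> \<longrightarrow>
      (\<forall>\<omega>\<in>\<Omega>. (1 / (sig P)\<^sup>2) * (noise P \<omega> \<bullet> HG_inv P \<upsilon>s (noise P \<omega>)) \<le> (z_quant (B_SG P S \<upsilon>s) x)\<^sup>2) \<longrightarrow>
      (\<forall>\<omega>\<in>\<Omega>. is_MAP P \<omega> (\<upsilon>t \<omega>)) \<longrightarrow>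
      0 < rG \<longrightarrow> 0 < r0 \<longrightarrow>
      open U0 \<longrightarrow> U0 \<subseteq> Ups P \<longrightarrow> (\<forall>\<upsilon>\<in>U0. psd (Fisher P \<upsilon>)) \<longrightarrow>
      local_ball_G P \<upsilon>s rG \<subseteq> U0 \<longrightarrow>
      (\<forall>\<upsilon>\<in>local_ball_G P \<upsilon>s rG. {\<upsilon>'. norm (D_op P \<upsilon> (\<upsilon>' - \<upsilon>)) \<le> r0} \<subseteq> U0) \<longrightarrow>
      3 * delta3_G P \<upsilon>s rG / ereal (rG\<^sup>2) \<le> ereal \<rho> \<longrightarrow> \<rho> \<le> 1 / 2 \<longrightarrow>
      z_quant (B_SG P S \<upsilon>s) x \<le> (1 - \<rho>) * rG \<longrightarrow>
      diamond P U0 r0 \<le> ereal (1 / 2) \<longrightarrow>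
      ereal (1 / 2) \<le> C0_const P U0 r0 \<longrightarrow>
      (\<forall>\<upsilon>\<in>U0. ereal (2 * sqrt (eff_dim P \<upsilon>) + sqrt x) \<le> C0_const P U0 r0 * ereal r0) \<longrightarrow>
      (\<forall>\<omega>\<in>\<Omega>.
        (SUP B\<in>sym_borel. ereal (posterior_gap P \<omega> (\<upsilon>t \<omega>) B))
          \<le> ereal C * (diamond P U0 r0 + ereal (1 / n)) \<and>
        (SUP B\<in>sets borel. ereal (posterior_gap P \<omega> (\<upsilon>t \<omega>) B))
          \<le> ereal C * (delta P U0 3 r0 + ereal (1 / n)) \<and>
        (\<forall>Q :: 'x \<times> 'y \<Rightarrow> real ^ 'm. linear Q \<longrightarrow>
          ereal (measure (posterior P (Obs P \<omega>))
             {\<upsilon>. norm (Q (\<upsilon> - \<upsilon>t \<omega>)) >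
                  z_quant (Q \<circ> inv (D_G_op P (\<upsilon>t \<omega>)) \<circ> inv (D_G_op P (\<upsilon>t \<omega>)) \<circ> adjoint Q) x})
          \<le> ereal C * (diamond P U0 r0 + ereal (1 / n)))))"
proof (intro exI[of _ "10 ^ 6"] conjI allI impI, goal_cases)
  case (3 P S \<nu>0 CG U0 Ucirc n x \<Omega> \<rho> rG r0 \<upsilon>s \<upsilon>t)
  show ?case
  proof (rule ballI, goal_cases)
    case (1 \<omega>)
    have "(1 / (sig P)\<^sup>2) * (noise P \<omega> \<bullet> HG_inv P \<upsilon>s (noise P \<omega>)) \<le> (z_quant (B_SG P S \<upsilon>s) x)\<^sup>2"
      "is_MAP P \<omega> (\<upsilon>t \<omega>)"
      using 1 3(11,12) by blast+
    then show ?case by (rule corollary_bounds[OF 3(1-4,7,8) _ _ 3(13,14,16-23,25)])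
  qed
qed simp_all

end
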